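(* Let $\mu,\nu\in\mathcal P(\mathbb R)$ with $\mu\le_{\rm cx}\nu$ and $\nu$ atomless. The following are equivalent: (i) The martingale transport from $\mu$ to $\nu$ is unique, i.e. $\mathcal M(\mu,\nu)$ is a singleton. (ii) The Monge martingale transport from $\mu$ to $\nu$ is unique, i.e. $\mathcal M_M(\mu,\nu)$ is a singleton. (iii) Let $\mu_a:=\sum_{j\in\mathbb N}a_j\delta_{x_j}$ be the atomic part of $\mu$, where $\{x_j\}_{j\in\mathbb N}$ are distinct. Then the shadows $S^\nu(a_j\delta_{x_j})$, $j\in\mathbb N$, are mutually singular and $\mu-\mu_a=\nu-\sum_{j\in\mathbb N}S^\nu(a_j\delta_{x_j})$.
   Context: $\mathcal P(\mathbb R)$ is the set of Borel probability measures on $\mathbb R$ with finite first moment. For finite measures with finite first moment, $\mu\le_{\rm cx}\nu$ means $\int\phi\,d\mu\le\int\phi\,d\nu$ for every convex $\phi:\mathbb R\to\mathbb R$, and $\mu\le_{\rm E}\nu$ means the same inequality for every nonnegative convex $\phi$. $\mathcal M(\mu,\nu)$ is the set of martingale transports: laws of $(X,Y)$ with $X\sim\mu$, $Y\sim\nu$, $\mathbb E[Y|X]=X$ a.s. $\mathcal M_M(\mu,\nu)$ (Monge martingale transports) is the subset of those $\pi$ of the form $\pi=(f,\mathrm{id}_{\mathbb R})_{\#}\nu$ with $f:\mathbb R\to\mathbb R$ Borel. Shadow: for finite measures $\gamma\le_{\rm E}\nu$ with finite first moment, the shadow of $\gamma$ in $\nu$ is $S^\nu(\gamma)=\min\{\eta:\gamma\le_{\rm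 cx}\eta\le\nu\}$, where $\eta\le\nu$ is set-wise and the minimum is with respect to the partial order $\le_{\rm cx}$ (it is known to exist). If $\gamma\le\mu\le_{\rm cx}\nu$ then $\gamma\le_{\rm E}\nu$. If $\mu$ has only finitely many (or no) atoms, the sums in (iii) are finite (or empty); equivalently one may take $a_j=0$ for the surplus indices, with $S^\nu(0)=0$. *)

theory Defs
  imports "HOL-Probability.Probability"
begin

section \<open>Measures with finite first moment and the convex order\<close>

definition finite_moment_measures :: "real measure set" where
  "finite_moment_measures = {M. finite_measure M \<and> sets M = sets borel \<and> integrable M (\<lambda>x. x)}"

definition prob_moment_measures :: "real measure set" where
  "prob_moment_measures = {M. prob_space M \<and> sets M = sets borel \<and> integrable M (\<lambda>x. x)}"

text \<open>
  A convex function need not be integrable, so its integral is taken in \<open>(-\<infinity>, \<infinity>]\<close>.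
  For a measure in \<^const>\<open>finite_moment_measures\<close> and a convex \<open>f\<close>, which has an affine minorant,
  the subtrahend below is finite.
\<close>

definition ext_integral :: "real measure \<Rightarrow> (real \<Rightarrow> real) \<Rightarrow> ereal" where
  "ext_integral M f =
     enn2ereal (\<integral>\<^sup>+x. ennreal (f x) \<partial>M) - enn2ereal (\<integral>\<^sup>+x. ennreal (- f x) \<partial>M)"

definition le_cx :: "real measure \<Rightarrow> real measure \<Rightarrow> bool"  (infix "\<le>cx" 50) where
  "\<mu> \<le>cx \<nu> \<longleftrightarrow> (\<forall>\<phi>. convex_on UNIV \<phi> \<longrightarrow> ext_integral \<mu> \<phi> \<le> ext_integral \<nu> \<phi>)"


section \<open>Martingale transports\<close>

text \<open>The \<open>\<sigma>\<close>-algebra generated by the first coordinate is the one of the vimage algebra.\<close>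

definition martingale_transports :: "real measure \<Rightarrow> real measure \<Rightarrow> (real \<times> real) measure set" where
  "martingale_transports \<mu> \<nu> = {\<pi>. prob_space \<pi> \<and> sets \<pi> = sets borel \<and>
     distr \<pi> borel fst = \<mu> \<and> distr \<pi> borel snd = \<nu> \<and>
     (AE z in \<pi>. real_cond_exp \<pi> (vimage_algebra UNIV fst borel) snd z = fst z)}"

definition monge_martingale_transports :: "real measure \<Rightarrow> real measure \<Rightarrow> (real \<times> real) measure set" where
  "monge_martingale_transports \<mu> \<nu> = {\<pi> \<in> martingale_transports \<mu> \<nu>.
     \<exists>f \<in> borel_measurable borel. \<pi> = distr \<nu> borel (\<lambda>y. (f y, y))}"


section \<open>Shadows\<close>

text \<open>
  In the next definition \<open>\<eta> \<le> \<nu>\<close> is the library order on measures, which for measures with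
  the same \<open>\<sigma>\<close>-algebra is the set-wise order.
\<close>

definition shadow_candidates :: "real measure \<Rightarrow> real measure \<Rightarrow> real measure set" where
  "shadow_candidates \<nu> \<gamma> = {\<eta> \<in> finite_moment_measures. \<gamma> \<le>cx \<eta> \<and> \<eta> \<le> \<nu>}"

text \<open>
  The shadow is the \<open>\<le>cx\<close>-least candidate; \<open>\<le>cx\<close> is antisymmetric on
  \<^const>\<open>finite_moment_measures\<close>. The value is meaningful only where a least candidate exists, which
  is the case if \<open>\<gamma>, \<nu>\<close> are finite with finite first moment and \<open>\<integral>\<phi> d\<gamma> \<le> \<integral>\<phi> d\<nu>\<close> for all
  nonnegative convex \<open>\<phi>\<close>.
\<close>

definition shadow :: "real measure \<Rightarrow> real measure \<Rightarrow> real measure" where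
  "shadow \<nu> \<gamma> = (THE \<eta>. \<eta> \<in> shadow_candidates \<nu> \<gamma> \<and> (\<forall>\<eta>' \<in> shadow_candidates \<nu> \<gamma>. \<eta> \<le>cx \<eta>'))"


section \<open>Atoms, countable sums, singularity\<close>

definition atomless :: "real measure \<Rightarrow> bool" where
  "atomless \<nu> \<longleftrightarrow> (\<forall>x. emeasure \<nu> {x} = 0)"

text \<open>The restriction of \<open>\<mu>\<close> to the (countable, for finite \<open>\<mu>\<close>) set of its atoms.\<close>

definition atomic_part :: "real measure \<Rightarrow> real measure" where
  "atomic_part \<mu> = density \<mu> (indicator {x. emeasure \<mu> {x} \<noteq> 0})"

definition point_mass :: "real \<Rightarrow> real \<Rightarrow> real measure" where
  "point_mass a x = scale_measure (ennreal a) (return borel x)"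

definition suminf_measure :: "(nat \<Rightarrow> real measure) \<Rightarrow> real measure" where
  "suminf_measure M = measure_of UNIV (sets borel) (\<lambda>A. \<Sum>j. emeasure (M j) A)"

lemma sets_suminf_measure [simp]: "sets (suminf_measure M) = sets borel"
  and space_suminf_measure [simp]: "space (suminf_measure M) = UNIV"
  using sets.sigma_sets_eq[of "borel :: real measure"]
  by (auto simp: suminf_measure_def)

lemma emeasure_suminf_measure:
  assumes M: "\<And>j. sets (M j) = sets borel" and A: "A \<in> sets borel"
  shows "emeasure (suminf_measure M) A = (\<Sum>j. emeasure (M j) A)"
proof (rule emeasure_measure_of[OF suminf_measure_def])
  show "countably_additive (sets (suminf_measure M)) (\<lambda>A. \<Sum>j. emeasure (M j) A)"
  proof (rule countably_additiveI)
    fix B :: "nat \<Rightarrow> real set"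
    assume B: "range B \<subseteq> sets (suminf_measure M)" "disjoint_family B"
    have "(\<Sum>i. \<Sum>j. emeasure (M j) (B i)) = (\<Sum>j. \<Sum>i. emeasure (M j) (B i))"
      using nn_integral_suminf[of "\<lambda>j i. emeasure (M j) (B i)" "count_space UNIV"]
      by (simp add: nn_integral_count_space_nat)
    also have "\<dots> = (\<Sum>j. emeasure (M j) (\<Union>i. B i))"
      using B M by (intro suminf_cong suminf_emeasure) auto
    finally show "(\<Sum>i. \<Sum>j. emeasure (M j) (B i)) = (\<Sum>j. emeasure (M j) (\<Union>i. B i))" .
  qed
qed (use A in \<open>auto simp: positive_def\<close>)

definition mutually_singular :: "real measure \<Rightarrow> real measure \<Rightarrow> bool" where
  "mutually_singular M N \<longleftrightarrow> (\<exists>A \<in> sets borel. emeasure M A = 0 \<and> emeasure N (- A) = 0)"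

end

theory Submission
  imports Defs
begin

text \<open>
  A Monge martingale transport exists for every \<open>\<mu> \<le>\<^sub>c\<^sub>x \<nu>\<close>
  with \<open>\<nu>\<close> atomless, and it can be built by splitting: for every \<open>c\<close>
  there are \<open>s \<le> c \<le> z\<close> such that \<open>\<nu>\<close> on \<open>B =
  (-\<infinity>, s] \<union> (c, z]\<close> has the mass and the mean of \<open>\<mu>\<close> on
  \<open>(-\<infinity>, c]\<close>. On \<open>(s, c]\<close> the put function of the restriction of
  \<open>\<nu>\<close> to \<open>B\<close> is affine, that of \<open>\<mu>\<close> is convex, and
  they are ordered at both ends, so both pieces of \<open>\<mu>\<close> are again dominated in
  convex order by the corresponding pieces of \<open>\<nu>\<close>. Iterating over all rational cuts
  gives the map. If \<open>(s, c]\<close> and \<open>(c, z]\<close> both have positive mass, then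
  the middle point can be moved a little, which gives a second splitting and hence a second Monge
  transport. So uniqueness forces the sublevel sets of the map to be half-lines; a monotone
  martingale map is the identity off the atoms of \<open>\<mu>\<close> and collapses disjoint
  intervals to the atoms, and these intervals carry the shadows. Conversely, the shadow bounds the
  fibre over an atom from below in convex order and Jensen's inequality does so for the rest of the
  mass; under (iii) the put functions of these lower bounds already add up to the put function of
  \<open>\<nu>\<close>, so every martingale transport attains all of them.
\<close>

section \<open>Restrictions, put functions and the convex order\<close>

text \<open>The splitting is carried out in the coordinate \<open>cdf \<nu>\<close> and not in the
  points \<open>s\<close>, \<open>c\<close>, \<open>z\<close>: \<nu> has no atoms but may have gaps,
  on which \<open>cdf \<nu>\<close> is constant, so points do not depend continuously on mass
  whereas levels do. The first moment \<open>J\<close> up to a level is continuous, and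
  \<open>J u - c * u\<close> falls strictly up to the level of \<open>c\<close> and rises strictly
  after it; the existence of a splitting and its perturbation are both intermediate value arguments
  about this one function. The order is kept in the form of mass, mean and put functions because
  these are what a splitting controls, one strike at a time. A second splitting contradicts
  uniqueness only if its pieces carry Monge transports again, so existence is proved by a
  construction that applies to restrictions as well. The monotone map is the identity off the atoms
  because a martingale map preserves first moments over preimages: where it moves points from above
  \<open>c\<close> to below \<open>c\<close>, the two first moments relative to \<open>c\<close>
  have opposite signs.\<close>

abbreviation fm :: "real measure set" where "fm \<equiv> finite_moment_measures"

lemma fmD:
  assumes "M \<in> fm"
  shows "finite_measure M" "sets M = sets borel" "space M = UNIV" "integrable M (\<lambda>x. x)"
  using assms sets_eq_imp_space_eq[of M "borel :: real measure"]
  by (auto simp: finite_moment_measures_def)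

lemma fm_set_integrable:
  fixes g :: "real \<Rightarrow> real"
  assumes "M \<in> fm" "A \<in> sets borel" "integrable M g"
  shows "set_integrable M A g"
  using assms by (simp add: set_integrable_def integrable_mult_indicator fmD(2) del: real_scaleR_def)

lemma fm_integrable_const: "M \<in> fm \<Longrightarrow> integrable M (\<lambda>x. c::real)"
  by (simp add: fmD(1) finite_measure.integrable_const)

lemma fm_integrable_affine: "M \<in> fm \<Longrightarrow> integrable M (\<lambda>x. p + q * x :: real)"
  by (intro Bochner_Integration.integrable_add integrable_mult_right) (auto simp: fm_integrable_const fmD)

lemma fm_integrable_put:
  assumes "M \<in> fm" shows "integrable M (\<lambda>x. max 0 (t - x :: real))"
  by (intro Bochner_Integration.integrable_max Bochner_Integration.integrable_diff)
    (auto simp: fm_integrable_const assms fmD)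

lemma fm_integrable_call:
  assumes "M \<in> fm" shows "integrable M (\<lambda>x. max 0 (x - t :: real))"
  by (intro Bochner_Integration.integrable_max Bochner_Integration.integrable_diff)
    (auto simp: fm_integrable_const assms fmD)

text \<open>A density keeps the whole line as space and \<open>borel\<close> as \<sigma>-algebra, so
  restrictions to different sets can be compared and restricted again on the same space.\<close>

definition restricted :: "real measure \<Rightarrow> real set \<Rightarrow> real measure" where
  "restricted M A = density M (indicator A)"

lemma sets_restricted [simp]: "sets (restricted M A) = sets M" and space_restricted [simp]: "space (restricted M A) = space M"
  by (simp_all add: restricted_def)

lemma emeasure_restricted:
  assumes "sets M = sets borel" "A \<in> sets borel" "X \<in> sets borel"
  shows "emeasure (restricted M A) X = emeasure M (A \<inter> X)"
proof -
  have [measurable_cong]: "sets M = sets borel" by fact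
  have [measurable]: "A \<in> sets borel" "X \<in> sets borel" by fact+
  have "emeasure (restricted M A) X = (\<integral>\<^sup>+x. indicator A x * indicator X x \<partial>M)"
    unfolding restricted_def by (rule emeasure_density) auto
  also have "\<dots> = (\<integral>\<^sup>+x. indicator (A \<inter> X) x \<partial>M)"
    by (simp add: indicator_inter_arith)
  finally show ?thesis using assms by simp
qed

lemma measure_restricted:
  assumes "sets M = sets borel" "A \<in> sets borel" "X \<in> sets borel"
  shows "measure (restricted M A) X = measure M (A \<inter> X)"
  using emeasure_restricted[OF assms] by (simp add: measure_def)

lemma integral_restricted:
  fixes g :: "real \<Rightarrow> real"
  assumes "sets M = sets borel" "A \<in> sets borel" "g \<in> borel_measurable borel"
  shows "(LINT x|restricted M A. g x) = (LINT x:A|M. g x)"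
    and "integrable (restricted M A) g \<longleftrightarrow> set_integrable M A g"
proof -
  have eq: "restricted M A = density M (\<lambda>x. ennreal (indicator A x))"
    by (simp add: restricted_def ennreal_indicator[abs_def])
  have [measurable_cong]: "sets M = sets borel" by fact
  have [measurable]: "A \<in> sets borel" "g \<in> borel_measurable borel" by fact+
  show "(LINT x|restricted M A. g x) = (LINT x:A|M. g x)"
    unfolding eq set_lebesgue_integral_def by (subst integral_density) auto
  show "integrable (restricted M A) g \<longleftrightarrow> set_integrable M A g"
    unfolding eq set_integrable_def by (subst integrable_density) auto
qed

lemma set_integral_restricted:
  fixes g :: "real \<Rightarrow> real"
  assumes "sets M = sets borel" "A \<in> sets borel" "B \<in> sets borel" "g \<in> borel_measurable borel"
  shows "(LINT x:B|restricted M A. g x) = (LINT x:A \<inter> B|M. g x)"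
proof -
  have [measurable]: "B \<in> sets borel" "g \<in> borel_measurable borel" by fact+
  have "(LINT x:B|restricted M A. g x) = (LINT x:A|M. indicator B x * g x)"
    unfolding set_lebesgue_integral_def[of "restricted M A"] real_scaleR_def
    by (rule integral_restricted) (use assms in auto)
  also have "\<dots> = (LINT x:A \<inter> B|M. g x)"
    unfolding set_lebesgue_integral_def
    by (rule Bochner_Integration.integral_cong) (auto split: split_indicator)
  finally show ?thesis .
qed

lemma fm_restricted:
  assumes "M \<in> fm" "A \<in> sets borel" shows "restricted M A \<in> fm"
proof -
  note M = fmD[OF assms(1)]
  interpret finite_measure M by (rule M)
  have "emeasure (restricted M A) (space (restricted M A)) = emeasure M A"
    using emeasure_restricted[OF M(2) assms(2), of UNIV] M(3) by simp
  then have "finite_measure (restricted M A)"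
    using emeasure_finite[of A] by (intro finite_measureI) simp
  moreover have "integrable (restricted M A) (\<lambda>x. x)"
    using fm_set_integrable[OF assms M(4)] integral_restricted(2)[OF M(2) assms(2), of "\<lambda>x. x"] by simp
  ultimately show ?thesis using M by (simp add: finite_moment_measures_def)
qed

lemma restricted_restricted:
  assumes "sets M = sets borel" "A \<in> sets borel" "B \<in> sets borel"
  shows "restricted (restricted M A) B = restricted M (A \<inter> B)"
  by (rule measure_eqI) (use assms in \<open>auto simp: emeasure_restricted Int_assoc\<close>)

lemma restricted_UNIV [simp]: "sets M = sets borel \<Longrightarrow> restricted M UNIV = M"
  by (rule measure_eqI) (auto simp: emeasure_restricted)

lemma restricted_cong_AE:
  assumes "sets M = sets borel" "A \<in> sets borel" "B \<in> sets borel" "AE x in M. x \<in> A \<longleftrightarrow> x \<in> B"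
  shows "restricted M A = restricted M B"
proof (rule measure_eqI)
  fix X assume "X \<in> sets (restricted M A)"
  then have X: "X \<in> sets borel" using assms by simp
  have "emeasure M (A \<inter> X) = emeasure M (B \<inter> X)"
    by (rule emeasure_eq_AE) (use assms X in auto)
  then show "emeasure (restricted M A) X = emeasure (restricted M B) X"
    using assms X by (simp add: emeasure_restricted)
qed simp

lemma set_integral_split:
  fixes g :: "real \<Rightarrow> real"
  assumes "M \<in> fm" "A \<in> sets borel" "integrable M g"
  shows "(LINT x:A|M. g x) + (LINT x:-A|M. g x) = (LINT x|M. g x)"
proof -
  have "(LINT x:A \<union> -A|M. g x) = (LINT x:A|M. g x) + (LINT x:-A|M. g x)"
    by (rule set_integral_Un) (use assms in \<open>auto intro!: fm_set_integrable\<close>)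
  then show ?thesis using set_integral_space[OF assms(3)] fmD(3)[OF assms(1)]
    by (simp add: set_lebesgue_integral_def)
qed

lemma set_integral_const:
  assumes "M \<in> fm" "A \<in> sets borel"
  shows "(LINT x:A|M. (c::real)) = c * measure M A"
  using assms fmD[OF assms(1)] finite_measure.emeasure_finite[OF fmD(1)[OF assms(1)]]
  by (simp add: set_lebesgue_integral_def)

lemma set_integral_affine:
  assumes "M \<in> fm" "A \<in> sets borel"
  shows "(LINT x:A|M. p + q * x) = p * measure M A + q * (LINT x:A|M. x)"
  using assms fmD[OF assms(1)]
  by (subst set_integral_add)
    (auto intro!: fm_set_integrable simp: set_integral_const fm_integrable_const)

lemma set_integral_below:
  assumes "M \<in> fm" "A \<in> sets borel"
  shows "(LINT x:A|M. t - x) = t * measure M A - (LINT x:A|M. x)"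
  using set_integral_affine[OF assms, of t "-1"] by simp

lemma set_integral_above:
  assumes "M \<in> fm" "A \<in> sets borel"
  shows "(LINT x:A|M. x - t) = (LINT x:A|M. x) - t * measure M A"
  using set_integral_affine[OF assms, of "-t" "1"] by simp

section \<open>Put and call functions and the order they induce\<close>

definition put :: "real measure \<Rightarrow> real \<Rightarrow> real" where
  "put M t = (LINT x|M. max 0 (t - x))"

definition call :: "real measure \<Rightarrow> real \<Rightarrow> real" where
  "call M t = (LINT x|M. max 0 (x - t))"

text \<open>Put-call parity, from \<open>max 0 (x - t) = max 0 (t - x) + (x - t)\<close>: for equal
  mass and mean, puts and calls of two measures are ordered simultaneously.\<close>

lemma call_eq_put:
  assumes "M \<in> fm"
  shows "call M t = put M t + (LINT x|M. x) - t * measure M UNIV"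
proof -
  have "call M t = (LINT x|M. max 0 (t - x) + (x - t))"
    unfolding call_def by (rule Bochner_Integration.integral_cong) auto
  also have "\<dots> = put M t + (LINT x|M. x - t)"
    unfolding put_def using assms fmD[OF assms]
    by (intro Bochner_Integration.integral_add fm_integrable_put)
      (auto intro!: Bochner_Integration.integrable_diff simp: fm_integrable_const)
  also have "(LINT x|M. x - t) = (LINT x|M. x) - t * measure M UNIV"
    using assms fmD[OF assms] by (subst Bochner_Integration.integral_diff) (auto simp: fm_integrable_const)
  finally show ?thesis by simp
qed

text \<open>The convex order in terms of puts: affine test functions give equal mass and mean, the
  kinks \<open>max 0 (t - x)\<close> give the rest. In contrast to \<open>\<le>cx\<close> it can be
  verified at each strike \<open>t\<close> separately, with different arguments on the two sides of
  a splitting point.\<close>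

definition put_le :: "real measure \<Rightarrow> real measure \<Rightarrow> bool" where
  "put_le M N \<longleftrightarrow> M \<in> fm \<and> N \<in> fm \<and> measure M UNIV = measure N UNIV \<and>
     (LINT x|M. x) = (LINT x|N. x) \<and> (\<forall>t. put M t \<le> put N t)"

lemma put_leD:
  assumes "put_le M N"
  shows "M \<in> fm" "N \<in> fm" "measure M UNIV = measure N UNIV" "(LINT x|M. x) = (LINT x|N. x)"
    "put M t \<le> put N t" "call M t \<le> call N t"
  using assms by (auto simp: put_le_def call_eq_put)

lemma ext_integral_integrable:
  assumes "integrable M f"
  shows "ext_integral M f = ereal (LINT x|M. f x)"
proof -
  have fin: "(\<integral>\<^sup>+x. ennreal (f x) \<partial>M) < \<infinity>" "(\<integral>\<^sup>+x. ennreal (- f x) \<partial>M) < \<infinity>"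
    using assms real_integrable_def by (auto simp: real_integrable_def less_top)
  obtain p q where pq: "0 \<le> p" "0 \<le> q" "(\<integral>\<^sup>+x. ennreal (f x) \<partial>M) = ennreal p"
      "(\<integral>\<^sup>+x. ennreal (- f x) \<partial>M) = ennreal q"
    using fin by (metis ennreal_cases infinity_ennreal_def less_irrefl)
  show ?thesis
    unfolding ext_integral_def real_lebesgue_integral_def[OF assms] pq
    using pq(1,2) by simp
qed

lemma convex_on_max0: "convex_on UNIV (\<lambda>x::real. max 0 (t - x))"
proof (rule convex_onI)
  fix s x y :: real assume s: "0 < s" "s < 1"
  have "(1-s) * (t - x) + s * (t - y) = t - ((1 - s) *\<^sub>R x + s *\<^sub>R y)"
    by (simp add: algebra_simps)
  moreover have "(1-s) * (t - x) \<le> (1-s) * max 0 (t - x)" "s * (t - y) \<le> s * max 0 (t - y)"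
    using s by (auto intro!: mult_left_mono)
  moreover have "0 \<le> (1-s) * max 0 (t - x)" "0 \<le> s * max 0 (t - y)"
    using s by auto
  ultimately show "max 0 (t - ((1 - s) *\<^sub>R x + s *\<^sub>R y)) \<le> (1 - s) * max 0 (t - x) + s * max 0 (t - y)"
    by linarith
qed auto

lemma convex_on_affine: "convex_on UNIV (\<lambda>x::real. p + q * x)"
  by (rule convex_onI) (auto simp: algebra_simps)

lemma le_cx_integrable:
  assumes "M \<le>cx N" "convex_on UNIV f" "integrable M f" "integrable N f"
  shows "(LINT x|M. f x) \<le> (LINT x|N. f x)"
  using assms ext_integral_integrable[OF assms(3)] ext_integral_integrable[OF assms(4)]
  by (auto simp: le_cx_def)

lemma le_cx_put:
  assumes "M \<le>cx N" "M \<in> fm" "N \<in> fm"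
  shows "put M t \<le> put N t"
  unfolding put_def by (rule le_cx_integrable) (use assms in \<open>auto simp: convex_on_max0 fm_integrable_put\<close>)

lemma integral_affine:
  assumes "M \<in> fm"
  shows "(LINT x|M. p + q * x) = p * measure M UNIV + q * (LINT x|M. x)"
  using assms fmD[OF assms] by (subst Bochner_Integration.integral_add) (auto simp: fm_integrable_const)

text \<open>An affine function and its negative are both convex.\<close>

lemma le_cx_affine:
  assumes "M \<le>cx N" "M \<in> fm" "N \<in> fm"
  shows "measure M UNIV = measure N UNIV" "(LINT x|M. x) = (LINT x|N. x)"
proof -
  have *: "p * measure M UNIV + q * (LINT x|M. x) \<le> p * measure N UNIV + q * (LINT x|N. x)" for p q
    using le_cx_integrable[OF assms(1) convex_on_affine[of p q]] assms
    by (simp add: fm_integrable_affine integral_affine)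
  show "measure M UNIV = measure N UNIV" "(LINT x|M. x) = (LINT x|N. x)"
    using *[of 1 0] *[of "-1" 0] *[of 0 1] *[of 0 "-1"] by auto
qed

lemma le_cx_imp_put_le:
  assumes "M \<le>cx N" "M \<in> fm" "N \<in> fm" shows "put_le M N"
  unfolding put_le_def using assms le_cx_put le_cx_affine by auto

lemma put_mono: "M \<in> fm \<Longrightarrow> s \<le> t \<Longrightarrow> put M s \<le> put M t"
  unfolding put_def by (intro integral_mono fm_integrable_put) auto

lemma call_antimono: "M \<in> fm \<Longrightarrow> s \<le> t \<Longrightarrow> call M t \<le> call M s"
  unfolding call_def by (intro integral_mono fm_integrable_call) auto

lemma put_convex:
  assumes "M \<in> fm" shows "convex_on UNIV (put M)"
proof (rule convex_onI)
  fix s x y :: real assume s: "0 < s" "s < 1"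
  have "put M ((1 - s) *\<^sub>R x + s *\<^sub>R y) \<le> (LINT z|M. (1-s) * max 0 (x - z) + s * max 0 (y - z))"
    unfolding put_def
  proof (intro integral_mono fm_integrable_put assms Bochner_Integration.integrable_add integrable_mult_right)
    fix z
    have "(1-s) * (x - z) + s * (y - z) = ((1 - s) *\<^sub>R x + s *\<^sub>R y) - z"
      by (simp add: algebra_simps)
    moreover have "(1-s) * (x - z) \<le> (1-s) * max 0 (x - z)" "s * (y - z) \<le> s * max 0 (y - z)"
      using s by (auto intro!: mult_left_mono)
    moreover have "0 \<le> (1-s) * max 0 (x - z)" "0 \<le> s * max 0 (y - z)"
      using s by auto
    ultimately show "max 0 (((1 - s) *\<^sub>R x + s *\<^sub>R y) - z) \<le> (1-s) * max 0 (x - z) + s * max 0 (y - z)"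
      by linarith
  qed
  also have "\<dots> = (1 - s) * put M x + s * put M y"
    unfolding put_def using assms
    by (subst Bochner_Integration.integral_add) (auto intro!: fm_integrable_put)
  finally show "put M ((1 - s) *\<^sub>R x + s *\<^sub>R y) \<le> (1 - s) * put M x + s * put M y" .
qed auto

lemma call_convex:
  assumes "M \<in> fm" shows "convex_on UNIV (call M)"
proof -
  \<comment> \<open>By parity a call is a put plus an affine function of the strike.\<close>
  have "convex_on UNIV (\<lambda>t. put M t + ((LINT x|M. x) + (- measure M UNIV) * t))"
    by (intro convex_on_add put_convex convex_on_affine assms)
  then show ?thesis
    by (rule iffD1[OF arg_cong[where f="convex_on UNIV"], rotated]) (auto simp: call_eq_put[OF assms] algebra_simps)
qed

section \<open>Quantile levels of an atomless measure\<close>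

locale atomless_fm =
  fixes \<nu> :: "real measure"
  assumes fm: "\<nu> \<in> fm" and atomless: "atomless \<nu>"
begin

sublocale finite_borel_measure \<nu>
  using fmD[OF fm] by (simp add: finite_borel_measure_def finite_borel_measure_axioms_def)

lemma sets_\<nu> [simp, measurable_cong]: "sets \<nu> = sets borel" and space_\<nu> [simp]: "space \<nu> = UNIV"
  using fmD[OF fm] by auto

lemma integrable_id: "integrable \<nu> (\<lambda>y. y)"
  using fmD[OF fm] by auto

definition mass :: real where "mass = measure \<nu> UNIV"

text \<open>In the coordinate \<open>cdf \<nu>\<close> the measure \<open>\<nu>\<close> is uniform on \<open>[0, mass]\<close>; \<open>J\<close> is the antiderivative of its
  quantile function.\<close>

definition lev :: "real \<Rightarrow> real set" where "lev u = {y. cdf \<nu> y \<le> u}"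

definition J :: "real \<Rightarrow> real" where "J u = (LINT y:lev u|\<nu>. y)"

lemma cdf_mono: "mono (cdf \<nu>)"
  by (simp add: mono_def cdf_nondecreasing)

lemma cdf_measurable [measurable]: "cdf \<nu> \<in> borel_measurable borel"
  by (rule borel_measurable_mono[OF cdf_mono])

lemma lev_measurable [measurable, simp]: "lev u \<in> sets borel"
  unfolding lev_def by measurable

lemma isCont_F: "isCont (cdf \<nu>) y"
  using atomless by (simp add: isCont_cdf atomless_def measure_def)

lemma cdf_le_mass: "cdf \<nu> y \<le> mass"
  using cdf_bounded[of y] by (simp add: mass_def)

lemma mass_nonneg: "0 \<le> mass"
  by (simp add: mass_def)

lemma cdf_surj:
  assumes "0 < u" "u < mass" obtains t where "cdf \<nu> t = u"
proof -
  have "\<exists>a. cdf \<nu> a < u"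
    using order_tendstoD(2)[OF cdf_lim_at_bot assms(1)] by (auto simp: eventually_at_bot_linorder)
  moreover have "\<exists>b. u < cdf \<nu> b"
    using order_tendstoD(1)[OF cdf_lim_at_top, of u] assms(2) by (auto simp: eventually_at_top_linorder mass_def)
  ultimately obtain a b where ab: "cdf \<nu> a < u" "u < cdf \<nu> b" by auto
  then have "a \<le> b" using cdf_nondecreasing[of b a] by (cases "a \<le> b") auto
  then obtain t where "cdf \<nu> t = u"
    using IVT[of "cdf \<nu>" a u b] ab isCont_F by auto
  then show ?thesis by (rule that)
qed

lemma lev_eq_UNIV: "mass \<le> u \<Longrightarrow> lev u = UNIV"
  using cdf_le_mass order_trans unfolding lev_def by fastforce

lemma lev_eq_empty: "u < 0 \<Longrightarrow> lev u = {}"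
  using cdf_nonneg unfolding lev_def by (auto simp: not_le intro: less_le_trans)

text \<open>\<open>lev u\<close> is closed, because \<open>cdf \<nu>\<close> is continuous, and
  bounded above for \<open>u < mass\<close>. So its supremum \<open>s\<close> belongs to it, and
  \<open>lev u\<close> lies in \<open>{..s}\<close> with \<open>cdf \<nu> s \<le> u\<close>.\<close>

lemma measure_lev_le:
  assumes "0 \<le> u" shows "measure \<nu> (lev u) \<le> u"
proof (cases "lev u = {} \<or> mass \<le> u")
  case True
  then show ?thesis
    using assms by (auto simp: mass_def intro: order_trans[OF finite_measure_mono[of _ UNIV]])
next
  case False
  have "\<exists>b. u < cdf \<nu> b"
    using order_tendstoD(1)[OF cdf_lim_at_top, of u] False by (auto simp: eventually_at_top_linorder mass_def)
  then obtain b where b: "u < cdf \<nu> b" by auto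
  have bdd: "bdd_above (lev u)"
    using b cdf_nondecreasing[of b] unfolding lev_def bdd_above_def
    by (intro exI[of _ b]) (smt (verit) mem_Collect_eq)
  have "closed (lev u)"
    unfolding lev_def using isCont_F
    by (intro closed_Collect_le) (auto simp: continuous_at_imp_continuous_on)
  then have "Sup (lev u) \<in> lev u"
    using closed_contains_Sup[OF _ bdd] False by auto
  moreover have "lev u \<subseteq> {..Sup (lev u)}"
    using bdd by (auto intro: cSup_upper)
  then have "measure \<nu> (lev u) \<le> cdf \<nu> (Sup (lev u))"
    unfolding cdf_def by (intro finite_measure_mono) auto
  ultimately show ?thesis by (auto simp: lev_def)
qed

lemma measure_lev:
  assumes "0 \<le> u" "u \<le> mass" shows "measure \<nu> (lev u) = u"
proof (rule antisym)
  consider "u = 0" | "u = mass" | "0 < u" "u < mass" using assms by linarith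
  then show "u \<le> measure \<nu> (lev u)"
  proof cases
    case 3
    then obtain t where t: "cdf \<nu> t = u" by (rule cdf_surj)
    then have "{..t} \<subseteq> lev u" using cdf_nondecreasing by (auto simp: lev_def)
    then have "cdf \<nu> t \<le> measure \<nu> (lev u)" unfolding cdf_def by (intro finite_measure_mono) auto
    then show ?thesis using t by simp
  qed (auto simp: lev_eq_UNIV mass_def)
qed (use assms measure_lev_le in auto)

lemma lev_mono: "u \<le> v \<Longrightarrow> lev u \<subseteq> lev v"
  by (auto simp: lev_def)

lemma measure_lev_diff:
  assumes "0 \<le> u" "u \<le> v" "v \<le> mass" shows "measure \<nu> (lev v - lev u) = v - u"
  using assms by (subst finite_measure_Diff) (auto simp: measure_lev lev_mono)

text \<open>A gap of \<nu> is a plateau of \<open>cdf \<nu>\<close>, so the level set can be a whole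
  interval. It is null because it lies in \<open>lev u - lev (u - e)\<close>, whose mass is at most
  \<open>e\<close>.\<close>

lemma AE_cdf_neq: "AE y in \<nu>. cdf \<nu> y \<noteq> u"
proof -
  have meas [measurable]: "{y. cdf \<nu> y = u} \<in> sets borel" by measurable
  have "measure \<nu> {y. cdf \<nu> y = u} \<le> e" if "0 < e" for e
  proof (cases "0 \<le> u \<and> u \<le> mass")
    case True
    have "{y. cdf \<nu> y = u} \<subseteq> lev u - lev (u - e)"
      using that by (auto simp: lev_def)
    then have "measure \<nu> {y. cdf \<nu> y = u} \<le> measure \<nu> (lev u - lev (u - e))"
      by (intro finite_measure_mono) auto
    also have "\<dots> = measure \<nu> (lev u) - measure \<nu> (lev (u - e))"
      using that by (intro finite_measure_Diff) (auto simp: lev_mono)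
    \<comment> \<open>For \<open>u < e\<close> the set \<open>lev (u - e)\<close> is empty and
      \<open>lev u\<close> itself has mass \<open>u\<close>.\<close>
    also have "\<dots> \<le> e"
      using True that by (cases "0 \<le> u - e") (auto simp: measure_lev lev_eq_empty)
    finally show ?thesis .
  next
    case False
    then have "{y. cdf \<nu> y = u} = {}"
      using cdf_nonneg cdf_le_mass by auto
    then show ?thesis using that by simp
  qed
  then have "measure \<nu> {y. cdf \<nu> y = u} = 0"
    using field_le_epsilon[of "measure \<nu> {y. cdf \<nu> y = u}" 0] by (simp add: measure_le_0_iff)
  then show ?thesis
    by (intro AE_I[of _ _ "{y. cdf \<nu> y = u}"]) (auto simp: emeasure_eq_measure)
qed

lemma set_int: "A \<in> sets borel \<Longrightarrow> set_integrable \<nu> A (\<lambda>y. y)"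
  using fm fm_set_integrable integrable_id by blast

lemma set_integral_lev_diff:
  assumes "u \<le> v" shows "(LINT y:lev v - lev u|\<nu>. y) = J v - J u"
proof -
  have "(LINT y:(lev v - lev u) \<union> lev u|\<nu>. y) = (LINT y:lev v - lev u|\<nu>. y) + J u"
    unfolding J_def by (rule set_integral_Un) (auto intro!: set_int)
  moreover have "(lev v - lev u) \<union> lev u = lev v" using lev_mono[OF assms] by auto
  ultimately show ?thesis by (simp add: J_def)
qed

text \<open>Dominated convergence: unless \<open>cdf \<nu> y = u\<close>, a null event, the
  indicator of \<open>lev (X n)\<close> at \<open>y\<close> is eventually constant.\<close>

lemma isCont_J: "isCont J u"
  unfolding isCont_def tendsto_at_iff_sequentially comp_def
proof (intro allI impI)
  fix X :: "nat \<Rightarrow> real" assume "\<forall>i. X i \<in> UNIV - {u}" and X: "X \<longlonglongrightarrow> u"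
  show "(\<lambda>n. J (X n)) \<longlonglongrightarrow> J u"
    unfolding J_def set_lebesgue_integral_def
  proof (rule integral_dominated_convergence)
    show "AE y in \<nu>. (\<lambda>n. indicator (lev (X n)) y *\<^sub>R y) \<longlonglongrightarrow> indicator (lev u) y *\<^sub>R y"
      using AE_cdf_neq[of u]
    proof eventually_elim
      case (elim y)
      have "\<forall>\<^sub>F n in sequentially. indicator (lev (X n)) y *\<^sub>R y = indicator (lev u) y *\<^sub>R y"
      proof (cases "cdf \<nu> y < u")
        case True
        from order_tendstoD(1)[OF X True] show ?thesis
          by eventually_elim (use True in \<open>auto simp: lev_def\<close>)
      next
        case False
        then have "u < cdf \<nu> y" using elim by simp
        from order_tendstoD(2)[OF X this] show ?thesis
          by eventually_elim (use False elim in \<open>auto simp: lev_def\<close>)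
      qed
      then show ?case by (rule tendsto_eventually)
    qed
    show "integrable \<nu> (\<lambda>y. \<bar>y\<bar>)" using integrable_id by simp
  qed (auto split: split_indicator)
qed

lemma J_0: "J 0 = 0"
proof -
  have "emeasure \<nu> (lev 0) = 0" using measure_lev[of 0] mass_nonneg by (simp add: emeasure_eq_measure)
  then have "AE y in \<nu>. y \<notin> lev 0" by (intro AE_not_in) auto
  then have "J 0 = (LINT y|\<nu>. 0)"
    unfolding J_def set_lebesgue_integral_def by (intro integral_cong_AE) (auto elim!: eventually_mono)
  then show ?thesis by simp
qed

lemma J_mass: "J mass = (LINT y|\<nu>. y)"
  by (simp add: J_def lev_eq_UNIV set_lebesgue_integral_def)

text \<open>The function \<open>\<lambda>u. J u - c * u\<close> has derivative quantile minus \<open>c\<close>, so it has its strict minimum at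
  the level of \<open>c\<close>.\<close>

lemma centred_J_increasing:
  assumes "cdf \<nu> c \<le> u" "u < v" "v \<le> mass" shows "J u - c * u < J v - c * v"
proof -
  have u: "0 \<le> u" using assms(1) cdf_nonneg[of c] by simp
  have "(LINT y:lev v - lev u|\<nu>. y - c) = J v - J u - c * (v - u)"
    using u assms by (subst set_integral_above[OF fm]) (auto simp: set_integral_lev_diff measure_lev_diff)
  moreover have "0 < (LINT y:lev v - lev u|\<nu>. y - c)"
  proof -
    have pos: "c < y" if "y \<in> lev v - lev u" for y
      using that assms cdf_nondecreasing[of y c] by (force simp: lev_def not_le[symmetric])
    have int: "integrable \<nu> (\<lambda>y. indicator (lev v - lev u) y * (y - c))"
      using fm_set_integrable[OF fm, of "lev v - lev u" "\<lambda>y. y - c"] fm_integrable_affine[OF fm, of "-c" 1]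
      by (simp add: set_integrable_def)
    have "0 \<le> (LINT y:lev v - lev u|\<nu>. y - c)"
      unfolding set_lebesgue_integral_def using pos
      by (intro integral_nonneg_AE AE_I2) (force split: split_indicator)
    moreover have "(LINT y:lev v - lev u|\<nu>. y - c) \<noteq> 0"
    proof
      assume "(LINT y:lev v - lev u|\<nu>. y - c) = 0"
      then have "AE y in \<nu>. indicator (lev v - lev u) y * (y - c) = 0"
        using int pos unfolding set_lebesgue_integral_def
        by (subst integral_nonneg_eq_0_iff_AE[symmetric]) (force split: split_indicator)+
      then have "AE y in \<nu>. y \<notin> lev v - lev u"
        by eventually_elim (use pos in \<open>force split: split_indicator_asm\<close>)
      then have "emeasure \<nu> (lev v - lev u) = 0"
        by (subst (asm) AE_iff_measurable[of "lev v - lev u"]) auto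
      then show False
        using measure_lev_diff[of u v] u assms by (simp add: measure_def)
    qed
    ultimately show ?thesis by simp
  qed
  ultimately show ?thesis by (simp add: algebra_simps)
qed

lemma centred_J_decreasing:
  assumes "0 \<le> u" "u < v" "v \<le> cdf \<nu> c" shows "J v - c * v < J u - c * u"
proof -
  have v: "v \<le> mass" using assms(3) cdf_le_mass[of c] by simp
  have eq: "(LINT y:lev v - lev u|\<nu>. c - y) = c * (v - u) - (J v - J u)"
    using v assms by (subst set_integral_below[OF fm]) (auto simp: set_integral_lev_diff measure_lev_diff)
  \<comment> \<open>Only almost everywhere: if \<open>v = cdf \<nu> c\<close> and
    \<open>cdf \<nu>\<close> is constant to the right of \<open>c\<close>, then \<open>lev v\<close>
    contains points beyond \<open>c\<close>.\<close>
  have AE: "AE y in \<nu>. y \<in> lev v - lev u \<longrightarrow> y < c"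
    using AE_cdf_neq[of v]
  proof eventually_elim
    case (elim y)
    then show ?case
      using assms cdf_nondecreasing[of c y] by (force simp: lev_def not_less[symmetric])
  qed
  have int: "integrable \<nu> (\<lambda>y. indicator (lev v - lev u) y * (c - y))"
    using fm_set_integrable[OF fm, of "lev v - lev u" "\<lambda>y. c - y"] fm_integrable_affine[OF fm, of "c" "-1"]
    by (simp add: set_integrable_def)
  have nn: "AE y in \<nu>. 0 \<le> indicator (lev v - lev u) y * (c - y)"
    using AE by eventually_elim (auto split: split_indicator)
  have "0 \<le> (LINT y:lev v - lev u|\<nu>. c - y)"
    unfolding set_lebesgue_integral_def using nn by (intro integral_nonneg_AE) auto
  moreover have "(LINT y:lev v - lev u|\<nu>. c - y) \<noteq> 0"
  proof
    assume "(LINT y:lev v - lev u|\<nu>. c - y) = 0"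
    then have "AE y in \<nu>. indicator (lev v - lev u) y * (c - y) = 0"
      using integral_nonneg_eq_0_iff_AE[OF int nn] unfolding set_lebesgue_integral_def by auto
    with AE have "AE y in \<nu>. y \<notin> lev v - lev u"
      by eventually_elim (force split: split_indicator_asm)
    then have "emeasure \<nu> (lev v - lev u) = 0"
      by (subst (asm) AE_iff_measurable[of "lev v - lev u"]) auto
    then show False
      using measure_lev_diff[of u v] v assms by (simp add: measure_def)
  qed
  ultimately show ?thesis using eq by (simp add: algebra_simps)
qed

end

section \<open>Splitting at a point\<close>

text \<open>For \<open>K u = J u - c * u\<close> the two equations prescribe mass and mean of \<open>\<nu>\<close> on
  \<open>lev u \<union> (lev v - lev w)\<close>.\<close>

lemma levels_exist:
  fixes K :: "real \<Rightarrow> real"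
  assumes cont: "\<forall>u. isCont K u"
    and anti: "\<forall>u v. 0 \<le> u \<longrightarrow> u < v \<longrightarrow> v \<le> w \<longrightarrow> K v < K u"
    and mono: "\<forall>u v. w \<le> u \<longrightarrow> u < v \<longrightarrow> v \<le> m \<longrightarrow> K u < K v"
    and "K 0 = 0" "0 \<le> w" "w \<le> m" "0 \<le> k" "k \<le> m" "\<kappa> \<le> 0" "\<kappa> \<le> K m" "K k \<le> \<kappa>"
  obtains u v where "0 \<le> u" "u \<le> w" "w \<le> v" "v \<le> m" "u + v - w = k" "K u + K v - K w = \<kappa>"
proof -
  note cont = cont[rule_format] and anti = anti[rule_format] and mono = mono[rule_format]
  \<comment> \<open>With \<open>v = k + w - u\<close> the mass equation holds, and
    \<open>a \<le> u \<le> b\<close> expresses \<open>0 \<le> u \<le> w\<close> and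
    \<open>w \<le> v \<le> m\<close>; \<open>h\<close> is the left side of the mean
    equation.\<close>
  define a b where "a = max 0 (k + w - m)" and "b = min w k"
  define h where "h u = K u + K (k + w - u) - K w" for u
  have ab: "a \<le> b" using assms by (auto simp: a_def b_def)
  have mono': "K w \<le> K v" if "w \<le> v" "v \<le> m" for v
    using mono[of w v] that by (cases "w = v") auto
  have "isCont h u" for u
    unfolding h_def by (intro continuous_intros isCont_o2[OF _ cont] cont)
  \<comment> \<open>At this end \<open>u = w\<close> or \<open>v = w\<close>, and
    \<open>h b = K k\<close> in both cases.\<close>
  moreover have "h b \<le> \<kappa>" using assms by (cases "w \<le> k") (auto simp: h_def b_def)
  \<comment> \<open>At this end \<open>u = 0\<close> or \<open>v = m\<close>; the remaining
    difference with \<open>K w\<close> is nonnegative because \<open>K\<close> is least at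
    \<open>w\<close>.\<close>
  moreover have "\<kappa> \<le> h a"
  proof (cases "k + w \<le> m")
    case True
    then show ?thesis using mono'[of "k + w"] assms by (auto simp: h_def a_def)
  next
    case False
    moreover have "K w \<le> K (k + w - m)"
      using anti[of "k + w - m" w] False assms(8) by (cases "k = m") simp_all
    ultimately show ?thesis using assms by (auto simp: h_def a_def)
  qed
  ultimately obtain u where u: "a \<le> u" "u \<le> b" "h u = \<kappa>"
    using IVT2[of h b \<kappa> a] ab by auto
  show ?thesis
    by (rule that[of u "k + w - u"]) (use u in \<open>auto simp: a_def b_def h_def\<close>)
qed

text \<open>The middle level is lowered slightly and the other two are solved for again. The new
  middle level is no longer the minimiser of \<open>K\<close>, so its comparison with
  \<open>K u'\<close> and \<open>K v'\<close> has to be delivered separately.\<close>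

lemma levels_perturb:
  fixes K :: "real \<Rightarrow> real"
  assumes cont: "\<forall>u. isCont K u"
    and anti: "\<forall>u v. 0 \<le> u \<longrightarrow> u < v \<longrightarrow> v \<le> w \<longrightarrow> K v < K u"
    and mono: "\<forall>u v. w \<le> u \<longrightarrow> u < v \<longrightarrow> v \<le> m \<longrightarrow> K u < K v"
    and "K 0 = 0" "\<kappa> \<le> 0" "\<kappa> \<le> K m"
    and uv: "0 \<le> u" "u < w" "w < v" "v \<le> m" "u + v - w = k" "K u + K v - K w = \<kappa>"
  obtains u' w' v' where "0 \<le> u'" "u' \<le> w'" "u < w'" "w' < w" "w < v'" "v' \<le> m" "u' + v' - w' = k"
    "K u' + K v' - K w' = \<kappa>" "K w' \<le> K u'" "K w' \<le> K v'"
proof -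
  note cont = cont[rule_format] and anti = anti[rule_format] and mono = mono[rule_format]
  have Kw: "K w < K u" "K w < K v" using anti[of u w] mono[of w v] uv by auto
  \<comment> \<open>At \<open>u = 0\<close> the mean equation reads
    \<open>\<kappa> = K v - K w > 0\<close>, and at \<open>v = m\<close> it gives
    \<open>\<kappa> > K m\<close>; so there is room on the outer sides as well.\<close>
  have u0: "0 < u" using Kw uv assms(4,5) by (cases "u = 0") simp_all
  have vm: "v < m" using Kw uv assms(6) by (cases "v = m") simp_all
  \<comment> \<open>A margin such that \<open>u - e\<close> and \<open>u + e\<close> stay between 0
    and \<open>w\<close>, and \<open>v\<close> may move down by \<open>2 * e\<close> and up by
    \<open>e\<close> between \<open>w\<close> and \<open>m\<close>.\<close>
  define e where "e = min (min (u / 2) ((w - u) / 2)) (min ((v - w) / 3) ((m - v) / 2))"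
  have e: "0 < e" "u - e > 0" "u + e < w" "v - 2 * e > w" "v + e < m"
    using u0 vm uv by (auto simp: e_def min_def field_simps)
  define h where "h z s = K s + K (k + z - s) - K z" for z s
  have k: "k = u + v - w" using uv by simp
  \<comment> \<open>At the old middle level, moving \<open>u\<close> and \<open>v\<close> both away
    from \<open>w\<close> raises the sum and moving both towards \<open>w\<close> lowers it; the
    strict inequalities survive for \<open>z\<close> just below \<open>w\<close>.\<close>
  have h1: "\<kappa> < h w (u - e)"
    using anti[of "u - e" u] mono[of v "v + e"] e uv by (auto simp: h_def k algebra_simps)
  have h2: "h w (u + e) < \<kappa>"
    using anti[of u "u + e"] mono[of "v - e" v] e uv by (auto simp: h_def k algebra_simps)
  have Kv: "K w < K (v - 2 * e)" using mono[of w "v - 2 * e"] e by auto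
  have ch: "isCont (\<lambda>z. h z s) z" "isCont (h z) s" for z s
    unfolding h_def by (intro continuous_intros isCont_o2[OF _ cont] cont)+
  have lim: "(f \<longlongrightarrow> f w) (at_left w)" if "isCont f w" for f :: "real \<Rightarrow> real"
    using that by (simp add: isCont_def filterlim_at_split)
  have "\<forall>\<^sub>F z in at_left w. \<kappa> < h z (u - e) \<and> h z (u + e) < \<kappa> \<and> K z < K (v - 2 * e) \<and> max (w - e) (u + e) < z \<and> z < w"
  proof (intro eventually_conj)
    show "\<forall>\<^sub>F z in at_left w. \<kappa> < h z (u - e)" using order_tendstoD(1)[OF lim[OF ch(1)] h1] .
    show "\<forall>\<^sub>F z in at_left w. h z (u + e) < \<kappa>" using order_tendstoD(2)[OF lim[OF ch(1)] h2] .
    show "\<forall>\<^sub>F z in at_left w. K z < K (v - 2 * e)" using order_tendstoD(2)[OF lim[OF cont] Kv] .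
    show "\<forall>\<^sub>F z in at_left w. max (w - e) (u + e) < z"
      using e by (intro order_tendstoD(1)[OF lim[of "\<lambda>z. z"]]) auto
    show "\<forall>\<^sub>F z in at_left w. z < w" by (auto simp: eventually_at_filter)
  qed
  then obtain z where z: "\<kappa> < h z (u - e)" "h z (u + e) < \<kappa>" "K z < K (v - 2 * e)"
      "w - e < z" "u + e < z" "z < w"
    using eventually_happens'[of "at_left w"] by (auto simp: trivial_limit_at_left_real)
  obtain s where s: "u - e \<le> s" "s \<le> u + e" "h z s = \<kappa>"
    using IVT2[of "h z" "u + e" \<kappa> "u - e"] z e ch by auto
  have v': "v - 2 * e < k + z - s" "k + z - s \<le> v + e" using s z k by linarith+
  show ?thesis
  proof (rule that[of s z "k + z - s"])
    show "K z \<le> K s" using anti[of s z] s z e by auto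
    show "K z \<le> K (k + z - s)" using mono[of "v - 2 * e" "k + z - s"] v' e z by auto
  qed (use s z e v' in \<open>auto simp: h_def\<close>)
qed

section \<open>Masses, means, puts and calls of restrictions\<close>

lemma set_integral_null:
  fixes g :: "real \<Rightarrow> real"
  assumes "M \<in> fm" "A \<in> sets borel" "g \<in> borel_measurable borel" "measure M A = 0"
  shows "(LINT x:A|M. g x) = 0"
proof -
  note [measurable_cong] = fmD(2)[OF assms(1)]
  have [measurable]: "A \<in> sets borel" "g \<in> borel_measurable borel" by fact+
  have "emeasure M A = 0"
    using assms finite_measure.emeasure_eq_measure[OF fmD(1)[OF assms(1)]] by simp
  then have "AE x in M. x \<notin> A" by (intro AE_not_in null_setsI) (simp_all add: assms(2) fmD(2)[OF assms(1)])
  then have "(LINT x:A|M. g x) = (LINT x|M. 0)"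
    unfolding set_lebesgue_integral_def by (intro integral_cong_AE) (auto elim!: eventually_mono)
  then show ?thesis by simp
qed

lemma measure_Compl_fm:
  assumes "M \<in> fm" "A \<in> sets borel" shows "measure M (-A) = measure M UNIV - measure M A"
  using finite_measure.finite_measure_compl[OF fmD(1)[OF assms(1)], of A] fmD[OF assms(1)] assms
  by (simp add: Compl_eq_Diff_UNIV)

lemma put_restricted:
  assumes "M \<in> fm" "A \<in> sets borel" shows "put (restricted M A) t = (LINT x:A|M. max 0 (t - x))"
  unfolding put_def by (rule integral_restricted[OF fmD(2)[OF assms(1)] assms(2)]) measurable

lemma call_restricted:
  assumes "M \<in> fm" "A \<in> sets borel" shows "call (restricted M A) t = (LINT x:A|M. max 0 (x - t))"
  unfolding call_def by (rule integral_restricted[OF fmD(2)[OF assms(1)] assms(2)]) measurable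

lemma mean_restricted:
  assumes "M \<in> fm" "A \<in> sets borel" shows "(LINT x|restricted M A. x) = (LINT x:A|M. x)"
  by (rule integral_restricted[OF fmD(2)[OF assms(1)] assms(2)]) measurable

lemma mass_restricted:
  assumes "M \<in> fm" "A \<in> sets borel" shows "measure (restricted M A) UNIV = measure M A"
  by (simp add: measure_restricted[OF fmD(2)[OF assms(1)] assms(2)])

lemma put_le_callI:
  assumes "M \<in> fm" "N \<in> fm" "measure M UNIV = measure N UNIV" "(LINT x|M. x) = (LINT x|N. x)"
    "\<And>t. call M t \<le> call N t"
  shows "put_le M N"
  unfolding put_le_def using assms call_eq_put[OF assms(1)] call_eq_put[OF assms(2)] by auto

lemma fm_set_integrable_call_put:
  assumes "M \<in> fm" "A \<in> sets borel"
  shows "set_integrable M A (\<lambda>x. max 0 (t - x))" "set_integrable M A (\<lambda>x. max 0 (x - t))"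
    "set_integrable M A (\<lambda>x. t - x)" "set_integrable M A (\<lambda>x. x - t)" "set_integrable M A (\<lambda>x. x)"
  using assms fm_integrable_affine[OF assms(1), of t "-1"] fm_integrable_affine[OF assms(1), of "-t" 1]
    fm_integrable_affine[OF assms(1), of 0 1]
  by (auto intro!: fm_set_integrable fm_integrable_put fm_integrable_call)

lemma set_integral_mono_set:
  fixes f g :: "'a \<Rightarrow> real"
  assumes "set_integrable M A f" "set_integrable M B g"
    "AE x in M. indicator A x * f x \<le> indicator B x * g x"
  shows "(LINT x:A|M. f x) \<le> (LINT x:B|M. g x)"
  using assms unfolding set_lebesgue_integral_def set_integrable_def by (intro integral_mono_AE) auto

lemma set_UNIV_integral: "(LINT x:UNIV|M. f x) = (LINT x|M. f x)"
  by (simp add: set_lebesgue_integral_def)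

context atomless_fm
begin

text \<open>Legendre duality: \<open>put \<nu>\<close> and \<open>J\<close> are conjugate, and the
  affine function \<open>s * u - J u\<close> of \<open>s\<close> touches \<open>put \<nu>\<close>
  where \<open>cdf \<nu> s = u\<close>.\<close>

lemma put_cdf: "put \<nu> s = s * cdf \<nu> s - J (cdf \<nu> s)"
proof -
  have "put \<nu> s = (LINT y:lev (cdf \<nu> s)|\<nu>. s - y)"
    unfolding put_def set_lebesgue_integral_def
  proof (rule integral_cong_AE)
    show "AE y in \<nu>. max 0 (s - y) = indicat_real (lev (cdf \<nu> s)) y *\<^sub>R (s - y)"
      using AE_cdf_neq[of "cdf \<nu> s"]
    proof eventually_elim
      case (elim y)
      have "y \<le> s \<Longrightarrow> y \<in> lev (cdf \<nu> s)" "s < y \<Longrightarrow> y \<notin> lev (cdf \<nu> s)"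
        using cdf_nondecreasing[of y s] cdf_nondecreasing[of s y] elim by (auto simp: lev_def)
      then show ?case by (cases "y \<le> s") auto
    qed
  qed auto
  also have "\<dots> = s * measure \<nu> (lev (cdf \<nu> s)) - J (cdf \<nu> s)"
    unfolding J_def by (rule set_integral_below) (auto simp: fm)
  finally show ?thesis using measure_lev[OF cdf_nonneg cdf_le_mass] by simp
qed

lemma call_cdf: "call \<nu> s = (J mass - J (cdf \<nu> s)) - s * (mass - cdf \<nu> s)"
  by (simp add: call_eq_put[OF fm] put_cdf J_mass flip: mass_def) (simp add: algebra_simps)

lemma set_integral_Compl_lev:
  assumes "0 \<le> v" "v \<le> mass"
  shows "(LINT y:- lev v|\<nu>. y) = J mass - J v" "measure \<nu> (- lev v) = mass - v"
  using set_integral_split[OF fm _ integrable_id, of "lev v"] measure_Compl_fm[OF fm, of "lev v"]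
    measure_lev[OF assms] by (auto simp: J_mass J_def[of v] simp flip: mass_def)

text \<open>\<open>J p\<close> is the least first moment that a part of \<nu> of mass
  \<open>p\<close> can have, and the put order does not allow a part of \<mu> to go below it. The
  bound comes from the strike \<open>t\<close> with \<open>cdf \<nu> t = measure \<mu> C\<close>;
  the masses 0 and \<open>mass\<close> may have no such strike.\<close>

lemma J_measure_le:
  assumes "put_le \<mu> \<nu>" "C \<in> sets borel" shows "J (measure \<mu> C) \<le> (LINT x:C|\<mu>. x)"
proof -
  note \<mu> = put_leD[OF assms(1)]
  have C: "measure \<mu> C \<le> mass"
    using finite_measure.bounded_measure[OF fmD(1)[OF \<mu>(1)], of C] fmD(3)[OF \<mu>(1)] \<mu>(3) by (simp add: mass_def)
  consider "measure \<mu> C = 0" | "measure \<mu> C = mass" | "0 < measure \<mu> C" "measure \<mu> C < mass"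
    using C measure_nonneg[of \<mu> C] by linarith
  then show ?thesis
  proof cases
    case 1
    then show ?thesis using assms \<mu> J_0 by (simp add: set_integral_null)
  next
    case 2
    then have "measure \<mu> (-C) = 0"
      using measure_Compl_fm[OF \<mu>(1) assms(2)] \<mu>(3) by (simp add: mass_def)
    then have "(LINT x:-C|\<mu>. x) = 0"
      using assms \<mu> by (intro set_integral_null) auto
    then show ?thesis
      using 2 set_integral_split[OF \<mu>(1) assms(2) fmD(4)[OF \<mu>(1)]] \<mu>(4) by (simp add: J_mass)
  next
    case 3
    then obtain t where t: "cdf \<nu> t = measure \<mu> C" by (rule cdf_surj)
    have "t * measure \<mu> C - (LINT x:C|\<mu>. x) = (LINT x:C|\<mu>. t - x)"
      using \<mu>(1) assms(2) by (simp add: set_integral_below)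
    also have "\<dots> \<le> put \<mu> t"
      unfolding put_def set_UNIV_integral[of \<mu>, symmetric]
      using \<mu> assms
      by (intro set_integral_mono_set fm_set_integrable_call_put) (auto split: split_indicator)
    also have "\<dots> \<le> put \<nu> t" by (rule \<mu>)
    finally show ?thesis by (simp add: put_cdf t)
  qed
qed

text \<open>Below the level \<open>u\<close> the put functions of the restrictions are those of \<open>\<mu>\<close> and \<open>\<nu>\<close>, at \<open>c\<close> they are ordered by
  hypothesis, and in between a convex function is compared with an affine one.\<close>

lemma left_wing:
  assumes cx: "put_le \<mu> \<nu>" and B: "B \<in> sets borel" "lev u \<subseteq> B" and u: "0 \<le> u" "u \<le> mass"
    and mass: "measure \<nu> B = measure \<mu> {..c}" and mean: "(LINT y:B|\<nu>. y) = (LINT x:{..c}|\<mu>. x)"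
    and K: "J u - c * u \<le> (LINT x:{..c}|\<mu>. x) - c * measure \<mu> {..c}"
  shows "put_le (restricted \<mu> {..c}) (restricted \<nu> B)"
proof -
  note \<mu> = put_leD[OF cx]
  have below: "(LINT x:{..c}|\<mu>. max 0 (t - x)) = put \<mu> t" if "t \<le> c" for t
    unfolding put_def set_lebesgue_integral_def using that
    by (intro Bochner_Integration.integral_cong) (auto split: split_indicator)
  have above: "(LINT x:{..c}|\<mu>. max 0 (t - x)) = t * measure \<mu> {..c} - (LINT x:{..c}|\<mu>. x)" if "c \<le> t" for t
    using that \<mu>(1) by (subst set_integral_below[symmetric])
      (auto intro!: set_lebesgue_integral_cong simp: fmD[OF \<mu>(1)])
  have "put (restricted \<mu> {..c}) t \<le> put (restricted \<nu> B) t" for t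
  proof (cases "t \<le> c")
    case False
    then have "put (restricted \<mu> {..c}) t = (LINT y:B|\<nu>. t - y)"
      using above[of t] \<mu> B fm mass mean by (simp add: put_restricted set_integral_below)
    also have "\<dots> \<le> put (restricted \<nu> B) t"
      using fm B by (auto simp: put_restricted intro!: set_integral_mono fm_set_integrable_call_put)
    finally show ?thesis .
  next
    case t: True
    show ?thesis
    proof (cases "cdf \<nu> t \<le> u")
      case True
      have "put \<nu> t \<le> put (restricted \<nu> B) t"
        unfolding put_restricted[OF fm B(1)] unfolding put_def set_UNIV_integral[of \<nu>, symmetric]
      proof (rule set_integral_mono_set)
        have "y \<in> B" if "y < t" for y
          using that True cdf_nondecreasing[of y t] B by (auto simp: lev_def)
        then show "AE y in \<nu>. indicat_real UNIV y * max 0 (t - y) \<le> indicat_real B y * max 0 (t - y)"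
          by (intro AE_I2) (force split: split_indicator simp: max_def)
      qed (use fm B in \<open>auto intro!: fm_set_integrable_call_put\<close>)
      then show ?thesis
        using below[OF t] \<mu> by (simp add: put_restricted) (metis order_trans)
    next
      case False
      \<comment> \<open>The affine comparison function: it equals \<open>put \<nu>\<close> at a
        point of level \<open>u\<close>, and it minorises the put function of the restriction
        because \<open>lev u \<subseteq> B\<close>.\<close>
      have "t * u - J u = (LINT y:lev u|\<nu>. t - y)"
        using fm u by (simp add: set_integral_below measure_lev J_def)
      also have "\<dots> \<le> put (restricted \<nu> B) t"
        unfolding put_restricted[OF fm B(1)]
        using fm B by (intro set_integral_mono_set fm_set_integrable_call_put)
          (auto split: split_indicator)
      finally have 1: "t * u - J u \<le> put (restricted \<nu> B) t" .
      \<comment> \<open>This is what the hypothesis \<open>K\<close> says at the strike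
        \<open>c\<close>.\<close>
      have c: "put \<mu> c \<le> c * u - J u"
        using above[of c] below[of c] K by simp
      have "put \<mu> t \<le> t * u - J u"
      \<comment> \<open>Level 0 need not be attained by \<open>cdf \<nu>\<close>; there
        \<open>J 0 = 0\<close> and monotonicity of the put function suffice.\<close>
      proof (cases "u = 0")
        case True
        then show ?thesis using c put_mono[OF \<mu>(1) t] by (simp add: J_0)
      next
        case u0: False
        then obtain s where s: "cdf \<nu> s = u"
          using cdf_surj[of u] False cdf_le_mass[of t] u by auto
        have st: "s < t" using False s cdf_nondecreasing[of t s] by force
        have ps: "put \<mu> s \<le> s * u - J u" using \<mu>(5)[of s] put_cdf[of s] s by simp
        define l where "l = (t - s) / (c - s)"
        have l: "0 \<le> l" "l \<le> 1" "l * (c - s) = t - s" using st t by (auto simp: l_def)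
        then have tl: "t = (1 - l) * s + l * c" by (simp add: algebra_simps)
        have "put \<mu> t \<le> (1 - l) * put \<mu> s + l * put \<mu> c"
          using convex_onD[OF put_convex[OF \<mu>(1)] l(1,2), of s c] by (simp add: tl)
        also have "\<dots> \<le> (1 - l) * (s * u - J u) + l * (c * u - J u)"
          using l ps c by (intro add_mono mult_left_mono) auto
        also have "\<dots> = t * u - J u" by (subst tl) (simp add: algebra_simps)
        finally show ?thesis .
      qed
      then show ?thesis using 1 below[OF t] \<mu> by (simp add: put_restricted)
    qed
  qed
  then show ?thesis
    unfolding put_le_def using \<mu> fm B mass mean by (simp add: fm_restricted mean_restricted mass_restricted)
qed

text \<open>Mirror image of \<open>left_wing\<close>, with calls and the upper tail
  \<open>- lev v\<close>. The definition of \<open>lev\<close> is not symmetric under reflection, so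
  the points of level exactly \<open>v\<close> are discarded as a null set.\<close>

lemma right_wing:
  assumes cx: "put_le \<mu> \<nu>" and B: "B \<in> sets borel" "- lev v \<subseteq> B" and v: "0 \<le> v" "v \<le> mass"
    and mass: "measure \<nu> B = measure \<mu> {c<..}" and mean: "(LINT y:B|\<nu>. y) = (LINT x:{c<..}|\<mu>. x)"
    and K: "(LINT x:{c<..}|\<mu>. x) - c * measure \<mu> {c<..} \<le> (J mass - J v) - c * (mass - v)"
  shows "put_le (restricted \<mu> {c<..}) (restricted \<nu> B)"
proof -
  note \<mu> = put_leD[OF cx]
  have below: "(LINT x:{c<..}|\<mu>. max 0 (x - t)) = call \<mu> t" if "c \<le> t" for t
    unfolding call_def set_lebesgue_integral_def using that
    by (intro Bochner_Integration.integral_cong) (auto split: split_indicator)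
  have above: "(LINT x:{c<..}|\<mu>. max 0 (x - t)) = (LINT x:{c<..}|\<mu>. x) - t * measure \<mu> {c<..}" if "t \<le> c" for t
    using that \<mu>(1) by (subst set_integral_above[symmetric])
      (auto intro!: set_lebesgue_integral_cong simp: fmD[OF \<mu>(1)])
  have "call (restricted \<mu> {c<..}) t \<le> call (restricted \<nu> B) t" for t
  proof (cases "c \<le> t")
    case False
    then have "call (restricted \<mu> {c<..}) t = (LINT y:B|\<nu>. y - t)"
      using above[of t] \<mu> B fm mass mean by (simp add: call_restricted set_integral_above)
    also have "\<dots> \<le> call (restricted \<nu> B) t"
      using fm B by (auto simp: call_restricted intro!: set_integral_mono fm_set_integrable_call_put)
    finally show ?thesis .
  next
    case t: True
    show ?thesis
    proof (cases "v \<le> cdf \<nu> t")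
      case True
      have "call \<nu> t \<le> call (restricted \<nu> B) t"
        unfolding call_restricted[OF fm B(1)] unfolding call_def set_UNIV_integral[of \<nu>, symmetric]
      proof (rule set_integral_mono_set)
        show "AE y in \<nu>. indicat_real UNIV y * max 0 (y - t) \<le> indicat_real B y * max 0 (y - t)"
          using AE_cdf_neq[of v]
        proof eventually_elim
          case (elim y)
          have "y \<in> B" if "t < y"
            using that True cdf_nondecreasing[of t y] B elim by (auto simp: lev_def)
          then show ?case by (force split: split_indicator simp: max_def)
        qed
      qed (use fm B in \<open>auto intro!: fm_set_integrable_call_put\<close>)
      then show ?thesis
        using below[OF t] \<mu> by (simp add: call_restricted) (metis order_trans)
    next
      case False
      have "(J mass - J v) - t * (mass - v) = (LINT y:- lev v|\<nu>. y - t)"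
        using fm v by (simp add: set_integral_above set_integral_Compl_lev)
      also have "\<dots> \<le> call (restricted \<nu> B) t"
        unfolding call_restricted[OF fm B(1)]
        using fm B by (intro set_integral_mono_set fm_set_integrable_call_put)
          (auto split: split_indicator)
      finally have 1: "(J mass - J v) - t * (mass - v) \<le> call (restricted \<nu> B) t" .
      have c: "call \<mu> c \<le> (J mass - J v) - c * (mass - v)"
        using above[of c] below[of c] K by simp
      have "call \<mu> t \<le> (J mass - J v) - t * (mass - v)"
      proof (cases "v = mass")
        case True
        then show ?thesis using c call_antimono[OF \<mu>(1) t] by simp
      next
        case v0: False
        then obtain s where s: "cdf \<nu> s = v"
          using cdf_surj[of v] False cdf_nonneg[of t] v by auto
        have st: "t < s" using False s cdf_nondecreasing[of s t] by force
        have ps: "call \<mu> s \<le> (J mass - J v) - s * (mass - v)" using \<mu>(6)[of s] call_cdf[of s] s by simp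
        define l where "l = (s - t) / (s - c)"
        have l: "0 \<le> l" "l \<le> 1" "l * (s - c) = s - t" using st t by (auto simp: l_def)
        then have tl: "t = (1 - l) * s + l * c" by (simp add: algebra_simps)
        have "call \<mu> t \<le> (1 - l) * call \<mu> s + l * call \<mu> c"
          using convex_onD[OF call_convex[OF \<mu>(1)] l(1,2), of s c] by (simp add: tl)
        also have "\<dots> \<le> (1 - l) * ((J mass - J v) - s * (mass - v)) + l * ((J mass - J v) - c * (mass - v))"
          using l ps c by (intro add_mono mult_left_mono) auto
        also have "\<dots> = (J mass - J v) - t * (mass - v)" by (subst tl) (simp add: algebra_simps)
        finally show ?thesis .
      qed
      then show ?thesis using 1 below[OF t] \<mu> by (simp add: call_restricted)
    qed
  qed
  then show ?thesis
    using \<mu> fm B mass mean by (intro put_le_callI) (simp_all add: fm_restricted mean_restricted mass_restricted)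
qed

end

text \<open>\<open>B\<close> is a candidate for the preimage of \<open>{..c}\<close> under a Monge
  transport: the pairs on both sides are ordered again, so each can be transported on its
  own.\<close>

definition admissible :: "real measure \<Rightarrow> real measure \<Rightarrow> real \<Rightarrow> real set \<Rightarrow> bool" where
  "admissible \<mu> \<nu> c B \<longleftrightarrow> B \<in> sets borel \<and> put_le (restricted \<mu> {..c}) (restricted \<nu> B) \<and> put_le (restricted \<mu> {c<..}) (restricted \<nu> (-B))"

context atomless_fm
begin

text \<open>With \<open>K u = J u - c * u\<close>, the two equations say that
  \<open>K u + K v - K w\<close> is the first moment of \<mu> on \<open>{..c}\<close> relative to
  \<open>c\<close>. Hence \<open>K w \<le> K v\<close> is what the left wing requires and
  \<open>K w \<le> K u\<close> what the right wing requires; \<open>w\<close> need not be the level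
  of \<open>c\<close>.\<close>

lemma admissible_levels:
  assumes cx: "put_le \<mu> \<nu>" and uv: "0 \<le> u" "u \<le> w" "w \<le> v" "v \<le> mass"
    and mass: "u + v - w = measure \<mu> {..c}" and mean: "J u + J v - J w = (LINT x:{..c}|\<mu>. x)"
    and K: "J w - c * w \<le> J u - c * u" "J w - c * w \<le> J v - c * v"
  shows "admissible \<mu> \<nu> c (lev u \<union> (lev v - lev w))" (is "admissible _ _ _ ?B")
proof -
  note \<mu> = put_leD[OF cx]
  have dis: "lev u \<inter> (lev v - lev w) = {}" using lev_mono[of u w] uv by auto
  have B: "?B \<in> sets borel" by auto
  have 1: "measure \<nu> ?B = measure \<mu> {..c}"
    using dis uv mass by (subst finite_measure_Union) (auto simp: measure_lev measure_lev_diff)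
  have "(LINT y:?B|\<nu>. y) = J u + (LINT y:lev v - lev w|\<nu>. y)"
    unfolding J_def by (rule set_integral_Un) (use dis in \<open>auto intro!: set_int\<close>)
  then have 2: "(LINT y:?B|\<nu>. y) = (LINT x:{..c}|\<mu>. x)"
    using mean uv by (simp add: set_integral_lev_diff)
  have C: "- {..c} = {c<..}" by auto
  have 3: "measure \<mu> {c<..} = mass - measure \<mu> {..c}"
    using measure_Compl_fm[OF \<mu>(1), of "{..c}"] \<mu>(3) by (simp add: C mass_def)
  have 4: "(LINT x:{c<..}|\<mu>. x) = J mass - (LINT x:{..c}|\<mu>. x)"
    using set_integral_split[OF \<mu>(1) _ fmD(4)[OF \<mu>(1)], of "{..c}"] \<mu>(4) by (simp add: C J_mass)
  have 5: "measure \<nu> (-?B) = measure \<mu> {c<..}"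
    using measure_Compl_fm[OF fm B] 1 3 by (simp add: mass_def)
  have 6: "(LINT y:-?B|\<nu>. y) = (LINT x:{c<..}|\<mu>. x)"
    using set_integral_split[OF fm B integrable_id] 2 4 by (simp add: J_mass)
  have \<kappa>: "(J u - c * u) + (J v - c * v) - (J w - c * w) = (LINT x:{..c}|\<mu>. x) - c * measure \<mu> {..c}"
    unfolding mass[symmetric] mean[symmetric] by (simp add: algebra_simps)
  have "put_le (restricted \<mu> {..c}) (restricted \<nu> ?B)"
    by (rule left_wing[where u = u, OF cx B _ _ _ 1 2]) (use uv \<kappa> K in auto)
  moreover have "put_le (restricted \<mu> {c<..}) (restricted \<nu> (- ?B))"
  proof (rule right_wing[where v = v, OF cx _ _ _ _ 5 6])
    show "- lev v \<subseteq> - ?B" using lev_mono[of u v] uv by auto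
    show "(LINT x:{c<..}|\<mu>. x) - c * measure \<mu> {c<..} \<le> (J mass - J v) - c * (mass - v)"
      using 4 \<kappa> K arg_cong[OF 3, of "\<lambda>z. c * z"] by (simp add: algebra_simps)
  qed (use uv B in auto)
  ultimately show ?thesis using B by (simp add: admissible_def)
qed

text \<open>Either \<open>B\<close> is an initial piece of \<nu>, the only splitting that a monotone
  map allows, or two admissible sets differ by positive mass, which will contradict
  uniqueness.\<close>

lemma split_alternative:
  assumes cx: "put_le \<mu> \<nu>"
  obtains B where "admissible \<mu> \<nu> c B" "AE y in \<nu>. y \<in> B \<longleftrightarrow> y \<in> lev (measure \<mu> {..c})"
  | B B' where "admissible \<mu> \<nu> c B" "admissible \<mu> \<nu> c B'" "measure \<nu> (B' - B) > 0"
proof -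
  note \<mu> = put_leD[OF cx]
  define K where "K u = J u - c * u" for u
  define k where "k = measure \<mu> {..c}"
  define \<kappa> where "\<kappa> = (LINT x:{..c}|\<mu>. x) - c * k"
  define w where "w = cdf \<nu> c"
  have cont: "\<forall>u. isCont K u" unfolding K_def by (intro allI continuous_intros isCont_J)
  have anti: "\<forall>u v. 0 \<le> u \<longrightarrow> u < v \<longrightarrow> v \<le> w \<longrightarrow> K v < K u"
    using centred_J_decreasing[of _ _ c] by (simp add: K_def w_def)
  have mono: "\<forall>u v. w \<le> u \<longrightarrow> u < v \<longrightarrow> v \<le> mass \<longrightarrow> K u < K v"
    using centred_J_increasing[of c] by (simp add: K_def w_def)
  have K0: "K 0 = 0" by (simp add: K_def J_0)
  have w: "0 \<le> w" "w \<le> mass" by (auto simp: w_def cdf_nonneg cdf_le_mass)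
  have k: "0 \<le> k" "k \<le> mass"
    using finite_measure.bounded_measure[OF fmD(1)[OF \<mu>(1)], of "{..c}"] fmD(3)[OF \<mu>(1)] \<mu>(3)
    by (auto simp: mass_def k_def)
  have \<kappa>: "\<kappa> = - (LINT x:{..c}|\<mu>. c - x)"
    using \<mu>(1) by (simp add: set_integral_below \<kappa>_def k_def)
  have \<kappa>0: "\<kappa> \<le> 0"
    unfolding \<kappa> set_lebesgue_integral_def neg_le_0_iff_le
    by (intro integral_nonneg_AE AE_I2) (auto split: split_indicator)
  have C: "- {..c} = {c<..}" by auto
  have "K mass - \<kappa> = (LINT x:{c<..}|\<mu>. x - c)"
    using \<mu>(1) set_integral_split[OF \<mu>(1) _ fmD(4)[OF \<mu>(1)], of "{..c}"] measure_Compl_fm[OF \<mu>(1), of "{..c}"] \<mu>(3,4)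
    by (simp add: set_integral_above C K_def \<kappa>_def k_def J_mass flip: mass_def) (simp add: algebra_simps)
  also have "\<dots> \<ge> 0"
    unfolding set_lebesgue_integral_def by (intro integral_nonneg_AE AE_I2) (auto split: split_indicator)
  finally have \<kappa>m: "\<kappa> \<le> K mass" by simp
  have Kk: "K k \<le> \<kappa>"
    using J_measure_le[OF cx, of "{..c}"] by (simp add: K_def \<kappa>_def k_def)
  obtain u v where uv: "0 \<le> u" "u \<le> w" "w \<le> v" "v \<le> mass" "u + v - w = k" "K u + K v - K w = \<kappa>"
    using levels_exist[where K = K and w = w and m = mass and k = k, OF cont anti mono K0 w k \<kappa>0 \<kappa>m Kk] by metis
  have admissibleI: "admissible \<mu> \<nu> c (lev u \<union> (lev v - lev w))"
    if "0 \<le> u" "u \<le> w" "w \<le> v" "v \<le> mass" "u + v - w = k" "K u + K v - K w = \<kappa>" "K w \<le> K u" "K w \<le> K v" for u v w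
  proof (rule admissible_levels[OF cx that(1-4)])
    show "u + v - w = measure \<mu> {..c}" using that by (simp add: k_def)
    show "J u + J v - J w = (LINT x:{..c}|\<mu>. x)"
      using that(6) that(5)[symmetric] by (simp add: K_def \<kappa>_def algebra_simps)
  qed (use that in \<open>auto simp: K_def\<close>)
  have Kle: "K w \<le> K u" "K w \<le> K v"
    using anti[rule_format, of u w] mono[rule_format, of w v] uv by (cases "u = w"; cases "w = v"; auto)+
  note admissible1 = admissibleI[OF uv Kle]
  show thesis
  proof (cases "u < w \<and> w < v")
    case False
    \<comment> \<open>If \<open>u = w\<close> or \<open>v = w\<close>, a single level remains, and
      it is \<open>k\<close> because \<open>u + v - w = k\<close>.\<close>
    then have "lev u \<union> (lev v - lev w) = lev k"
      using uv lev_mono[of u v] by (cases "u = w") auto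
    then show thesis using that(1)[OF admissible1] by (simp add: k_def)
  next
    case True
    then obtain u' w' v' where p: "0 \<le> u'" "u' \<le> w'" "u < w'" "w' < w" "w < v'" "v' \<le> mass" "u' + v' - w' = k"
        "K u' + K v' - K w' = \<kappa>" "K w' \<le> K u'" "K w' \<le> K v'"
      using levels_perturb[where K = K and w = w and m = mass, OF cont anti mono K0 \<kappa>0 \<kappa>m] uv by metis
    have admissible2: "admissible \<mu> \<nu> c (lev u' \<union> (lev v' - lev w'))"
      by (rule admissibleI) (use p in auto)
    \<comment> \<open>The levels between \<open>w'\<close> and \<open>w\<close> lie above
      \<open>u\<close>, hence outside the first set, and between \<open>w'\<close> and
      \<open>v'\<close>, hence inside the second.\<close>
    have "lev w - lev w' \<subseteq> (lev u' \<union> (lev v' - lev w')) - (lev u \<union> (lev v - lev w))"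
      using lev_mono[of w v'] lev_mono[of u w'] p by auto
    then have "measure \<nu> (lev w - lev w') \<le> measure \<nu> ((lev u' \<union> (lev v' - lev w')) - (lev u \<union> (lev v - lev w)))"
      by (intro finite_measure_mono) auto
    moreover have "measure \<nu> (lev w - lev w') = w - w'"
      using p w by (intro measure_lev_diff) auto
    ultimately show thesis using that(2)[OF admissible1 admissible2] p by simp
  qed
qed

lemma admissible_exists: assumes "put_le \<mu> \<nu>" shows "\<exists>B. admissible \<mu> \<nu> c B"
  using split_alternative[OF assms, of c] by metis

end

section \<open>Existence of Monge martingale transports\<close>

text \<open>For histories that no point realises, both cells are empty.\<close>

lemma restricted_empty_put_le:
  assumes "M \<in> fm" "N \<in> fm" shows "put_le (restricted M {}) (restricted N {})"
  using assms unfolding put_le_def by (simp add: fm_restricted mass_restricted mean_restricted put_restricted set_lebesgue_integral_def)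

lemma (in atomless_fm) atomless_restricted:
  assumes "B \<in> sets borel" shows "atomless_fm (restricted \<nu> B)"
proof
  show "restricted \<nu> B \<in> fm" using fm assms by (rule fm_restricted)
  show "atomless (restricted \<nu> B)"
    unfolding atomless_def
  proof
    fix y
    have "emeasure \<nu> (B \<inter> {y}) \<le> emeasure \<nu> {y}" by (rule emeasure_mono) auto
    then show "emeasure (restricted \<nu> B) {y} = 0"
      using atomless assms by (simp add: emeasure_restricted atomless_def)
  qed
qed

text \<open>Push-forward and martingale property as equalities of mass and first moment over
  preimages. In this form the notion makes sense for finite measures, and maps on complementary
  pieces can be glued.\<close>

definition monge :: "real measure \<Rightarrow> real measure \<Rightarrow> (real \<Rightarrow> real) \<Rightarrow> bool" where
  "monge \<mu> \<nu> f \<longleftrightarrow> f \<in> borel_measurable borel \<and>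
     (\<forall>A \<in> sets borel. measure \<nu> (f -` A) = measure \<mu> A \<and> (LINT y:f -` A|\<nu>. y) = (LINT x:A|\<mu>. x))"

lemma borel_vimage: "f \<in> borel_measurable borel \<Longrightarrow> A \<in> sets borel \<Longrightarrow> f -` A \<in> sets borel"
  for f :: "real \<Rightarrow> real"
  using measurable_sets[of f borel borel A] by simp

text \<open>A Dynkin argument on open half-lines, to be used with the identity for the first moments
  and with the constant 1 for the masses.\<close>

lemma set_integral_vimage_eqI:
  fixes f g :: "real \<Rightarrow> real"
  assumes M: "M \<in> fm" and N: "N \<in> fm" and f: "f \<in> borel_measurable borel"
    and g: "integrable M g" "integrable N g" and total: "(LINT x|M. g x) = (LINT x|N. g x)"
    and half: "\<And>t. (LINT y:f -` {..<t}|N. g y) = (LINT x:{..<t}|M. g x)"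
    and A: "A \<in> sets borel"
  shows "(LINT y:f -` A|N. g y) = (LINT x:A|M. g x)"
proof -
  have borel: "borel = sigma UNIV (range (lessThan :: real \<Rightarrow> real set))"
    by (rule borel_Iio)
  have sets: "sets borel = sigma_sets UNIV (range (lessThan :: real \<Rightarrow> real set))"
    by (subst borel) (rule sets_measure_of, simp)
  have vm: "f -` X \<in> sets borel" if "X \<in> sets borel" for X
    using f that by (rule borel_vimage)
  have int: "set_integrable N (f -` X) g" "set_integrable M X g" if "X \<in> sets borel" for X
    by (rule fm_set_integrable[OF N vm[OF that] g(2)], rule fm_set_integrable[OF M that g(1)])
  have "Int_stable (range (lessThan :: real \<Rightarrow> real set))"
  proof (rule Int_stableI)
    fix a b :: "real set" assume "a \<in> range lessThan" "b \<in> range lessThan"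
    then obtain s t where "a = {..<s}" "b = {..<t}" by auto
    then have "a \<inter> b = {..<min s t}" by auto
    then show "a \<inter> b \<in> range lessThan" by simp
  qed
  then show ?thesis
    using _ A[unfolded sets]
  proof (rule sigma_sets_induct_disjoint)
    show "range lessThan \<subseteq> Pow (UNIV :: real set)" by auto
  next
    fix X assume "X \<in> range (lessThan :: real \<Rightarrow> real set)"
    then show "(LINT y:f -` X|N. g y) = (LINT x:X|M. g x)" using half by auto
  next
    show "(LINT y:f -` {}|N. g y) = (LINT x:{}|M. g x)" by (simp add: set_lebesgue_integral_def)
  next
    fix X assume X: "X \<in> sigma_sets UNIV (range (lessThan :: real \<Rightarrow> real set))"
      and eq: "(LINT y:f -` X|N. g y) = (LINT x:X|M. g x)"
    have X: "X \<in> sets borel" using X sets by auto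
    show "(LINT y:f -` (UNIV - X)|N. g y) = (LINT x:UNIV - X|M. g x)"
      using set_integral_split[OF M X g(1)] set_integral_split[OF N vm[OF X] g(2)] total eq
      by (simp add: Compl_eq_Diff_UNIV[symmetric] vimage_Compl)
  next
    fix X :: "nat \<Rightarrow> real set"
    assume X: "disjoint_family X" "range X \<subseteq> sigma_sets UNIV (range (lessThan :: real \<Rightarrow> real set))"
      and eq: "\<And>i. (LINT y:f -` X i|N. g y) = (LINT x:X i|M. g x)"
    have Xb: "X i \<in> sets borel" for i using X sets by auto
    have "(LINT y:f -` (\<Union>i. X i)|N. g y) = (\<Sum>i. LINT y:f -` X i|N. g y)"
      unfolding vimage_UN
    proof (rule lebesgue_integral_countable_add)
      show "f -` X i \<in> sets N" for i using vm[OF Xb] fmD(2)[OF N] by simp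
      show "f -` X i \<inter> f -` X j = {}" if "i \<noteq> j" for i j
        using X(1) that by (auto simp: disjoint_family_on_def)
      show "set_integrable N (\<Union>i. f -` X i) g"
        unfolding vimage_UN[symmetric] by (rule int) (use Xb in auto)
    qed
    also have "\<dots> = (\<Sum>i. LINT x:X i|M. g x)" by (simp add: eq)
    also have "\<dots> = (LINT x:(\<Union>i. X i)|M. g x)"
    proof (rule lebesgue_integral_countable_add[symmetric])
      show "X i \<in> sets M" for i using Xb fmD(2)[OF M] by simp
      show "X i \<inter> X j = {}" if "i \<noteq> j" for i j
        using X(1) that by (auto simp: disjoint_family_on_def)
      show "set_integrable M (\<Union>i. X i) g" by (rule int) (use Xb in auto)
    qed
    finally show "(LINT y:f -` (\<Union>i. X i)|N. g y) = (LINT x:(\<Union>i. X i)|M. g x)" .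
  qed
qed

section \<open>The recursive splitting along rational cuts\<close>

definition cut :: "nat \<Rightarrow> real" where "cut n = real_of_rat (from_nat n)"

lemma cut_dense: "x < y \<Longrightarrow> \<exists>i. x < cut i \<and> cut i < y"
  using of_rat_dense[of x y] surj_from_nat unfolding cut_def by (metis surjD)

text \<open>The newest answer stands at the head, so \<open>rev\<close> lists the answers in the
  order of the cuts.\<close>

primrec xpath :: "nat \<Rightarrow> real \<Rightarrow> bool list" where
  "xpath 0 x = []"
| "xpath (Suc n) x = (x \<le> cut n) # xpath n x"

text \<open>The history of the first \<open>n\<close> splittings: the cells of equal \<open>xpath\<close> and of equal \<open>ypath\<close> stay in convex
  order.\<close>

primrec ypath :: "real measure \<Rightarrow> real measure \<Rightarrow> nat \<Rightarrow> real \<Rightarrow> bool list" where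
  "ypath \<mu> \<nu> 0 = (\<lambda>y. [])"
| "ypath \<mu> \<nu> (Suc n) = (\<lambda>y. (y \<in> (SOME X. admissible (restricted \<mu> {x. xpath n x = ypath \<mu> \<nu> n y})
      (restricted \<nu> {z. ypath \<mu> \<nu> n z = ypath \<mu> \<nu> n y}) (cut n) X)) # ypath \<mu> \<nu> n y)"

lemma xpath_rev: "xpath n x = rev (map (\<lambda>i. x \<le> cut i) [0..<n])"
  by (induction n) auto

lemma xpath_measurable: "{x. xpath n x = b} \<in> sets borel"
proof (induction n arbitrary: b)
  case (Suc n)
  show ?case
  proof (cases b)
    case (Cons t b')
    have "{x. xpath (Suc n) x = b} = {x. xpath n x = b'} \<inter> (if t then {..cut n} else {cut n<..})"
      using Cons by auto
    then show ?thesis using Suc by auto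
  qed auto
qed auto

locale monge_construction = atomless_fm +
  fixes \<mu> :: "real measure"
  assumes cx: "put_le \<mu> \<nu>"
begin

lemma \<mu>: "\<mu> \<in> fm" "sets \<mu> = sets borel"
  using put_leD(1)[OF cx] fmD(2) by auto

text \<open>A cell of \<mu> and the cell of \<nu> with the same history form an ordered pair with
  atomless target, so the next admissible set exists. The set picked by \<open>SOME\<close> depends
  on \<open>y\<close> only through its history, which keeps the cells measurable.\<close>

lemma ypath_cells: "{y. ypath \<mu> \<nu> n y = b} \<in> sets borel \<and>
    put_le (restricted \<mu> {x. xpath n x = b}) (restricted \<nu> {y. ypath \<mu> \<nu> n y = b})"
proof (induction n arbitrary: b)
  case 0
  show ?case
    by (cases b) (use cx \<mu> in \<open>auto simp: restricted_empty_put_le fm\<close>)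
next
  case (Suc n)
  show ?case
  proof (cases b)
    case Nil
    then show ?thesis using \<mu> fm by (simp add: restricted_empty_put_le)
  next
    case (Cons t b')
    let ?A = "{x. xpath n x = b'}" and ?B = "{y. ypath \<mu> \<nu> n y = b'}"
    define X where "X = (SOME X. admissible (restricted \<mu> ?A) (restricted \<nu> ?B) (cut n) X)"
    interpret B: atomless_fm "restricted \<nu> ?B" by (rule atomless_restricted) (use Suc in auto)
    have "admissible (restricted \<mu> ?A) (restricted \<nu> ?B) (cut n) X"
      unfolding X_def by (rule someI_ex, rule B.admissible_exists) (use Suc in auto)
    then have X: "X \<in> sets borel" "put_le (restricted \<mu> (?A \<inter> {..cut n})) (restricted \<nu> (?B \<inter> X))"
        "put_le (restricted \<mu> (?A \<inter> {cut n<..})) (restricted \<nu> (?B \<inter> - X))"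
      using Suc xpath_measurable[of n b'] \<mu> by (auto simp: admissible_def restricted_restricted)
    have 1: "{x. xpath (Suc n) x = b} = ?A \<inter> (if t then {..cut n} else {cut n<..})"
      using Cons by auto
    have 2: "{y. ypath \<mu> \<nu> (Suc n) y = b} = ?B \<inter> (if t then X else - X)"
      using Cons by (auto simp: X_def)
    show ?thesis unfolding 1 2 using X Suc[of b'] by auto
  qed
qed

section \<open>The limit map of the splittings\<close>

definition bit :: "nat \<Rightarrow> real \<Rightarrow> bool" where "bit i y = hd (ypath \<mu> \<nu> (Suc i) y)"

lemma ypath_rev: "ypath \<mu> \<nu> n y = rev (map (\<lambda>i. bit i y) [0..<n])"
  by (induction n) (auto simp: bit_def)

text \<open>Every event about the first \<open>n\<close> answers is a finite disjoint union of
  cells, and cells of equal history have equal mass and mean.\<close>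

lemma ypath_transfer:
  shows "{y. Q (ypath \<mu> \<nu> n y)} \<in> sets borel"
    and "measure \<nu> {y. Q (ypath \<mu> \<nu> n y)} = measure \<mu> {x. Q (xpath n x)}"
    and "(LINT y:{y. Q (ypath \<mu> \<nu> n y)}|\<nu>. y) = (LINT x:{x. Q (xpath n x)}|\<mu>. x)"
proof -
  define S where "S = {b :: bool list. length b = n \<and> Q b}"
  have "finite {b :: bool list. set b \<subseteq> UNIV \<and> length b = n}"
    by (rule finite_lists_length_eq) simp
  then have S: "finite S" by (rule finite_subset[rotated]) (auto simp: S_def)
  have Y: "{y. Q (ypath \<mu> \<nu> n y)} = (\<Union>b\<in>S. {y. ypath \<mu> \<nu> n y = b})"
    by (auto simp: S_def ypath_rev)
  have X: "{x. Q (xpath n x)} = (\<Union>b\<in>S. {x. xpath n x = b})"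
    by (auto simp: S_def xpath_rev)
  have Ym: "{y. ypath \<mu> \<nu> n y = b} \<in> sets borel" for b using ypath_cells by auto
  note Xm = xpath_measurable[of n]
  show "{y. Q (ypath \<mu> \<nu> n y)} \<in> sets borel" unfolding Y using S Ym by auto
  have dis: "disjoint_family_on (\<lambda>b. {y. ypath \<mu> \<nu> n y = b}) S" "disjoint_family_on (\<lambda>b. {x. xpath n x = b}) S"
    by (auto simp: disjoint_family_on_def)
  have eq: "measure \<nu> {y. ypath \<mu> \<nu> n y = b} = measure \<mu> {x. xpath n x = b}"
      "(LINT y:{y. ypath \<mu> \<nu> n y = b}|\<nu>. y) = (LINT x:{x. xpath n x = b}|\<mu>. x)" for b
    using put_leD(3,4)[OF conjunct2[OF ypath_cells[of n b]]] fm \<mu> Ym Xm by (auto simp: mass_restricted mean_restricted)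
  show "measure \<nu> {y. Q (ypath \<mu> \<nu> n y)} = measure \<mu> {x. Q (xpath n x)}"
    unfolding X Y
    using S dis eq Ym Xm \<mu> finite_measure.finite_measure_finite_Union[OF fmD(1)[OF \<mu>(1)] S _ dis(2)]
      finite_measure_finite_Union[OF S _ dis(1)] by (auto simp: image_subset_iff)
  have "(LINT y:(\<Union>b\<in>S. {y. ypath \<mu> \<nu> n y = b})|\<nu>. y) = (\<Sum>b\<in>S. LINT y:{y. ypath \<mu> \<nu> n y = b}|\<nu>. y)"
    by (rule set_integral_finite_Union[OF S dis(1)]) (use Ym in \<open>auto intro!: set_int\<close>)
  moreover have "(LINT x:(\<Union>b\<in>S. {x. xpath n x = b})|\<mu>. x) = (\<Sum>b\<in>S. LINT x:{x. xpath n x = b}|\<mu>. x)"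
    by (rule set_integral_finite_Union[OF S dis(2)])
      (use Xm \<mu> fmD(4)[OF \<mu>(1)] in \<open>auto intro!: fm_set_integrable\<close>)
  ultimately show "(LINT y:{y. Q (ypath \<mu> \<nu> n y)}|\<nu>. y) = (LINT x:{x. Q (xpath n x)}|\<mu>. x)"
    unfolding X Y by (simp add: eq)
qed

text \<open>\<open>E i\<close> plays the role of the set on which the map is at most \<open>cut i\<close>.\<close>

definition E :: "nat \<Rightarrow> real set" where "E i = {y. bit i y}"

lemma E: "E i \<in> sets borel" "measure \<nu> (E i) = measure \<mu> {..cut i}"
  "(LINT y:E i|\<nu>. y) = (LINT x:{..cut i}|\<mu>. x)"
  using ypath_transfer[where n = "Suc i" and Q = hd] by (simp_all add: E_def bit_def atMost_def)

text \<open>The answers yes at \<open>cut i\<close> and no at \<open>cut j\<close> are impossible on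
  the side of \<mu>, hence by \<open>ypath_transfer\<close> a null event for \<nu>; the selected
  sets are nested only up to null sets.\<close>

lemma E_null:
  assumes "cut i < cut j" shows "AE y in \<nu>. y \<in> E i \<longrightarrow> y \<in> E j"
proof -
  have "\<exists>n. i < n \<and> j < n" by (intro exI[of _ "Suc (max i j)"]) auto
  then obtain n where n: "i < n" "j < n" by auto
  have "{y. rev (ypath \<mu> \<nu> n y) ! i \<and> \<not> rev (ypath \<mu> \<nu> n y) ! j} = E i - E j"
    using n by (auto simp: ypath_rev E_def)
  moreover have "{x. rev (xpath n x) ! i \<and> \<not> rev (xpath n x) ! j} = {}"
    using assms n by (auto simp: xpath_rev)
  ultimately have "measure \<nu> (E i - E j) = 0"
    using ypath_transfer(2)[of "\<lambda>b. rev b ! i \<and> \<not> rev b ! j" n] by (simp only: measure_empty)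
  then have "AE y in \<nu>. y \<notin> E i - E j"
    using E(1) by (intro AE_not_in null_setsI) (auto simp: emeasure_eq_measure)
  then show ?thesis by eventually_elim auto
qed

text \<open>The sets \<open>E i\<close> have the \<mu>-mass of half-lines, which comes arbitrarily
  close to the total mass and to 0. The two statements make the infimum defining \<open>T\<close>
  one over a nonempty set that is bounded below.\<close>

lemma AE_ex_E: "AE y in \<nu>. \<exists>i. y \<in> E i" and AE_ex_not_E: "AE y in \<nu>. \<exists>i. y \<notin> E i"
proof -
  interpret M: finite_borel_measure \<mu>
    using fmD[OF \<mu>(1)] by (simp add: finite_borel_measure_def finite_borel_measure_axioms_def)
  have tot: "measure \<mu> UNIV = mass" using put_leD(3)[OF cx] by (simp add: mass_def)
  have meas: "(\<Inter>i. - E i) \<in> sets borel" "(\<Inter>i. E i) \<in> sets borel" using E(1) by auto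
  have "measure \<nu> (\<Inter>i. - E i) \<le> e" if "0 < e" for e
  proof -
    have "\<forall>\<^sub>F t in at_top. mass - e < cdf \<mu> t"
      using order_tendstoD(1)[OF M.cdf_lim_at_top, of "mass - e"] tot that fmD(3)[OF \<mu>(1)] by simp
    then obtain t where "mass - e < cdf \<mu> t" by (auto simp: eventually_at_top_linorder)
    moreover obtain i where "t < cut i" using cut_dense[of t "t + 1"] by auto
    ultimately have "mass - e < measure \<mu> {..cut i}"
      using M.cdf_nondecreasing[of t "cut i"] by (simp add: cdf_def)
    then have "measure \<nu> (- E i) \<le> e"
      using measure_Compl_fm[OF fm E(1), of i] E(2)[of i] by (simp add: mass_def)
    moreover have "measure \<nu> (\<Inter>i. - E i) \<le> measure \<nu> (- E i)"
      using E(1) by (intro finite_measure_mono) auto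
    ultimately show ?thesis by simp
  qed
  then have "measure \<nu> (\<Inter>i. - E i) = 0"
    using field_le_epsilon[of "measure \<nu> (\<Inter>i. - E i)" 0] by (simp add: measure_le_0_iff)
  then have "AE y in \<nu>. y \<notin> (\<Inter>i. - E i)"
    using meas by (intro AE_not_in null_setsI) (auto simp: emeasure_eq_measure)
  then show "AE y in \<nu>. \<exists>i. y \<in> E i" by eventually_elim auto
  have "measure \<nu> (\<Inter>i. E i) \<le> e" if "0 < e" for e
  proof -
    have "\<forall>\<^sub>F t in at_bot. cdf \<mu> t < e"
      using order_tendstoD(2)[OF M.cdf_lim_at_bot that] .
    then obtain t where "cdf \<mu> t < e" by (auto simp: eventually_at_bot_linorder)
    moreover obtain i where "cut i < t" using cut_dense[of "t - 1" t] by auto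
    ultimately have "measure \<mu> {..cut i} < e"
      using M.cdf_nondecreasing[of "cut i" t] by (simp add: cdf_def)
    moreover have "measure \<nu> (\<Inter>i. E i) \<le> measure \<nu> (E i)"
      using E(1) by (intro finite_measure_mono) auto
    ultimately show ?thesis using E(2)[of i] by simp
  qed
  then have "measure \<nu> (\<Inter>i. E i) = 0"
    using field_le_epsilon[of "measure \<nu> (\<Inter>i. E i)" 0] by (simp add: measure_le_0_iff)
  then have "AE y in \<nu>. y \<notin> (\<Inter>i. E i)"
    using meas by (intro AE_not_in null_setsI) (auto simp: emeasure_eq_measure)
  then show "AE y in \<nu>. \<exists>i. y \<notin> E i" by eventually_elim auto
qed

text \<open>A set of full measure on which the answers are monotone along the cuts and take both
  values, so that they determine a real number.\<close>

definition G :: "real set" where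
  "G = {y. (\<exists>i. y \<in> E i) \<and> (\<exists>i. y \<notin> E i) \<and> (\<forall>i j. cut i < cut j \<longrightarrow> y \<in> E i \<longrightarrow> y \<in> E j)}"

lemma AE_G: "AE y in \<nu>. y \<in> G"
proof -
  have "AE y in \<nu>. \<forall>i j. cut i < cut j \<longrightarrow> y \<in> E i \<longrightarrow> y \<in> E j"
    using E_null by (auto simp: AE_all_countable)
  then show ?thesis using AE_ex_E AE_ex_not_E by eventually_elim (auto simp: G_def)
qed

lemma G_measurable: "G \<in> sets borel"
proof -
  note E(1)[measurable]
  have "G = {y. (\<exists>i. y \<in> E i) \<and> (\<exists>i. y \<notin> E i) \<and> (\<forall>i j. cut i < cut j \<longrightarrow> y \<in> E i \<longrightarrow> y \<in> E j)}"
    by (simp add: G_def)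
  also have "\<dots> \<in> sets borel" by measurable
  finally show ?thesis .
qed

text \<open>The value 0 off \<open>G\<close> is arbitrary; it enters only the measurability of
  \<open>T\<close>.\<close>

definition T :: "real \<Rightarrow> real" where
  "T y = (if y \<in> G then Inf (cut ` {i. y \<in> E i}) else 0)"

lemma T_less:
  assumes "y \<in> G" shows "T y < t \<longleftrightarrow> (\<exists>i. y \<in> E i \<and> cut i < t)"
proof -
  obtain i0 where i0: "y \<notin> E i0" using assms by (auto simp: G_def)
  have "cut i0 \<le> cut i" if "y \<in> E i" for i
    using assms that i0 unfolding G_def by (metis (mono_tags, lifting) mem_Collect_eq not_le)
  then have bdd: "bdd_below (cut ` {i. y \<in> E i})"
    unfolding bdd_below_def by (intro exI[of _ "cut i0"]) auto
  have "cut ` {i. y \<in> E i} \<noteq> {}" using assms by (auto simp: G_def)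
  from cInf_less_iff[OF this bdd] show ?thesis using assms by (auto simp: T_def)
qed

lemma T_measurable: "T \<in> borel_measurable borel"
proof (rule borel_measurableI_less)
  fix t
  have "{y \<in> space borel. T y < t} = (G \<inter> (\<Union>i\<in>{i. cut i < t}. E i)) \<union> (if 0 < t then - G else {})"
    using T_less by (auto simp: T_def)
  also have "\<dots> \<in> sets borel" using G_measurable E(1) by auto
  finally show "{y \<in> space borel. T y < t} \<in> sets borel" .
qed

text \<open>The cuts approach \<open>t\<close> strictly from below, because a point with
  \<open>T y = cut i\<close> may lie inside or outside \<open>E i\<close>:
  \<open>T y < cut i\<close> puts \<open>y\<close> into \<open>E i\<close>, and
  \<open>t \<le> T y\<close> keeps it out of every \<open>E i\<close> with
  \<open>cut i < t\<close>.\<close>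

lemma T_half:
  fixes g :: "real \<Rightarrow> real"
  assumes g: "integrable \<mu> g" "integrable \<nu> g" and gm [measurable]: "g \<in> borel_measurable borel"
    and eq: "\<And>i. (LINT y:E i|\<nu>. g y) = (LINT x:{..cut i}|\<mu>. g x)"
  shows "(LINT y:T -` {..<t}|\<nu>. g y) = (LINT x:{..<t}|\<mu>. g x)"
proof -
  note [measurable_cong] = \<mu>(2) and [measurable] = E(1) borel_vimage[OF T_measurable]
  have "\<forall>n. \<exists>i. t - 1 / real (Suc n) < cut i \<and> cut i < t"
    by (intro allI cut_dense) simp
  then obtain k where k: "\<And>n. t - 1 / real (Suc n) < cut (k n)" "\<And>n. cut (k n) < t" by metis
  have lim: "(\<lambda>n. cut (k n)) \<longlonglongrightarrow> t"
  proof (rule tendsto_sandwich[of "\<lambda>n. t - 1 / real (Suc n)" _ _ "\<lambda>n. t"])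
    show "(\<lambda>n. t - 1 / real (Suc n)) \<longlonglongrightarrow> t"
      using tendsto_diff[OF tendsto_const[of t] LIMSEQ_Suc[OF lim_1_over_n]] by simp
  qed (use k in \<open>auto intro: less_imp_le always_eventually\<close>)
  have "(\<lambda>n. LINT y:E (k n)|\<nu>. g y) \<longlonglongrightarrow> (LINT y:T -` {..<t}|\<nu>. g y)"
    unfolding set_lebesgue_integral_def
  proof (rule integral_dominated_convergence)
    show "AE y in \<nu>. (\<lambda>n. indicator (E (k n)) y *\<^sub>R g y) \<longlonglongrightarrow> indicator (T -` {..<t}) y *\<^sub>R g y"
      using AE_G
    proof eventually_elim
      case (elim y)
      have "\<forall>\<^sub>F n in sequentially. indicator (E (k n)) y *\<^sub>R g y = indicator (T -` {..<t}) y *\<^sub>R g y"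
      proof (cases "T y < t")
        case True
        from order_tendstoD(1)[OF lim True] show ?thesis
        proof eventually_elim
          case (elim n)
          then obtain i where "y \<in> E i" "cut i < cut (k n)" using T_less[OF \<open>y \<in> G\<close>] by auto
          then have "y \<in> E (k n)" using \<open>y \<in> G\<close> by (auto simp: G_def)
          then show ?case using True by simp
        qed
      next
        case False
        then have "y \<notin> E (k n)" for n using T_less[OF \<open>y \<in> G\<close>, of t] k(2) by auto
        then show ?thesis using False by simp
      qed
      then show ?case by (rule tendsto_eventually)
    qed
    show "integrable \<nu> (\<lambda>y. \<bar>g y\<bar>)" using g by simp
  qed (auto split: split_indicator)
  moreover have "(\<lambda>n. LINT x:{..cut (k n)}|\<mu>. g x) \<longlonglongrightarrow> (LINT x:{..<t}|\<mu>. g x)"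
    unfolding set_lebesgue_integral_def
  proof (rule integral_dominated_convergence)
    show "AE x in \<mu>. (\<lambda>n. indicator {..cut (k n)} x *\<^sub>R g x) \<longlonglongrightarrow> indicator {..<t} x *\<^sub>R g x"
    proof (intro AE_I2 tendsto_eventually)
      fix x
      show "\<forall>\<^sub>F n in sequentially. indicator {..cut (k n)} x *\<^sub>R g x = indicator {..<t} x *\<^sub>R g x"
      proof (cases "x < t")
        case True
        from order_tendstoD(1)[OF lim True] show ?thesis
          by eventually_elim (use True in auto)
      next
        case False
        then have "\<not> x \<le> cut (k n)" for n using k(2)[of n] by simp
        then show ?thesis using False by simp
      qed
    qed
    show "integrable \<mu> (\<lambda>x. \<bar>g x\<bar>)" using g by simp
  qed (auto split: split_indicator)
  ultimately show ?thesis unfolding eq by (rule LIMSEQ_unique)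
qed

lemma monge_T: "monge \<mu> \<nu> T"
  unfolding monge_def
proof (intro conjI ballI T_measurable)
  fix A :: "real set" assume A: "A \<in> sets borel"
  note cxD = put_leD[OF cx]
  show "(LINT y:T -` A|\<nu>. y) = (LINT x:A|\<mu>. x)"
    by (rule set_integral_vimage_eqI[OF \<mu>(1) fm T_measurable fmD(4)[OF \<mu>(1)] integrable_id cxD(4)
          T_half[OF fmD(4)[OF \<mu>(1)] integrable_id _ E(3)] A]) simp
  have "(LINT y:T -` A|\<nu>. 1) = (LINT x:A|\<mu>. 1 :: real)"
  proof (rule set_integral_vimage_eqI[OF \<mu>(1) fm T_measurable _ _ _ T_half A])
    show "(LINT x|\<mu>. 1 :: real) = (LINT x|\<nu>. 1)" using cxD(3) fmD(3)[OF \<mu>(1)] by simp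
    show "(LINT y:E i|\<nu>. 1) = (LINT x:{..cut i}|\<mu>. 1 :: real)" for i
      using E(1,2) fm \<mu> by (simp add: set_integral_const)
  qed (simp_all add: fm \<mu>(1) fm_integrable_const)
  then show "measure \<nu> (T -` A) = measure \<mu> A"
    using fm \<mu> A borel_vimage[OF T_measurable A] by (simp add: set_integral_const)
qed

end

theorem monge_exists:
  assumes "put_le \<mu> \<nu>" "atomless \<nu>" obtains f where "monge \<mu> \<nu> f"
proof -
  interpret monge_construction \<nu> \<mu>
    by unfold_locales (use assms put_leD in auto)
  show thesis using monge_T by (rule that)
qed

section \<open>Transport laws and uniqueness of the Monge map\<close>

lemma fst_snd_measurable [measurable]:
  "fst \<in> borel_measurable (borel :: (real \<times> real) measure)"
  "snd \<in> borel_measurable (borel :: (real \<times> real) measure)"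
  by (auto intro!: borel_measurable_continuous_onI continuous_intros)

lemma prob_moment_fm: "M \<in> prob_moment_measures \<Longrightarrow> M \<in> fm"
  by (auto simp: prob_moment_measures_def finite_moment_measures_def prob_space_def)

text \<open>The \<sigma>-algebra of the first coordinate consists of the preimages under
  \<open>fst\<close>, and \<open>fst\<close> is measurable for it, so the conditional expectation
  can be tested by integrals over these preimages. Afterwards conditional expectations no longer
  occur.\<close>

lemma martingale_transports_iff:
  assumes "\<mu> \<in> prob_moment_measures" "\<nu> \<in> prob_moment_measures"
  shows "\<pi> \<in> martingale_transports \<mu> \<nu> \<longleftrightarrow> prob_space \<pi> \<and> sets \<pi> = sets borel \<and>
     distr \<pi> borel fst = \<mu> \<and> distr \<pi> borel snd = \<nu> \<and>
     (\<forall>A \<in> sets borel. (LINT z:fst -` A|\<pi>. snd z) = (LINT z:fst -` A|\<pi>. fst z))"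
proof -
  let ?F = "vimage_algebra UNIV fst borel :: (real \<times> real) measure"
  have "(AE z in \<pi>. real_cond_exp \<pi> ?F snd z = fst z) \<longleftrightarrow>
      (\<forall>A \<in> sets borel. (LINT z:fst -` A|\<pi>. snd z) = (LINT z:fst -` A|\<pi>. fst z))"
    if p: "prob_space \<pi>" and s: "sets \<pi> = sets borel" and m: "distr \<pi> borel fst = \<mu>" "distr \<pi> borel snd = \<nu>"
  proof -
    note [measurable_cong] = s
    interpret prob_space \<pi> by (rule p)
    have sp: "space \<pi> = UNIV" using sets_eq_imp_space_eq[OF s] by simp
    have sF: "sets ?F = {fst -` A |A. A \<in> sets borel}" using sets_vimage_algebra2[of "fst :: real \<times> real \<Rightarrow> real" UNIV borel] by simp
    have vm: "fst -` A \<in> sets \<pi>" if "A \<in> sets borel" for A :: "real set"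
      using measurable_sets[OF fst_snd_measurable(1) that] s by simp
    have "subalgebra \<pi> ?F"
      unfolding subalgebra_def using vm sp by (auto simp: sF)
    then interpret S: finite_measure_subalgebra \<pi> ?F
      by unfold_locales
    have ms: "fst \<in> measurable \<pi> borel" "snd \<in> measurable \<pi> borel" by measurable
    have int: "integrable \<pi> fst" "integrable \<pi> snd"
      using assms integrable_distr[OF ms(1), of "\<lambda>x. x"] integrable_distr[OF ms(2), of "\<lambda>x. x"]
      unfolding m by (simp_all add: prob_moment_measures_def)
    have fF: "fst \<in> borel_measurable ?F"
      by (rule measurable_vimage_algebra1) auto
    show ?thesis
    proof
      assume ae: "AE z in \<pi>. real_cond_exp \<pi> ?F snd z = fst z"
      show "\<forall>A \<in> sets borel. (LINT z:fst -` A|\<pi>. snd z) = (LINT z:fst -` A|\<pi>. fst z)"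
      proof
        fix A :: "real set" assume A: "A \<in> sets borel"
        have "(LINT z:fst -` A|\<pi>. snd z) = (LINT z:fst -` A|\<pi>. real_cond_exp \<pi> ?F snd z)"
          by (rule S.real_cond_exp_intA[OF int(2)]) (use A in \<open>auto simp: sF\<close>)
        also have "\<dots> = (LINT z:fst -` A|\<pi>. fst z)"
          using ae vm[OF A] by (intro set_lebesgue_integral_cong_AE) (auto elim: eventually_mono)
        finally show "(LINT z:fst -` A|\<pi>. snd z) = (LINT z:fst -` A|\<pi>. fst z)" .
      qed
    next
      assume eq: "\<forall>A \<in> sets borel. (LINT z:fst -` A|\<pi>. snd z) = (LINT z:fst -` A|\<pi>. fst z)"
      show "AE z in \<pi>. real_cond_exp \<pi> ?F snd z = fst z"
        by (rule S.real_cond_exp_charact) (use eq int fF in \<open>auto simp: sF\<close>)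
    qed
  qed
  then show ?thesis by (auto simp: martingale_transports_def)
qed

section \<open>Laws carried by graphs and gluing of Monge maps\<close>

definition graph_law :: "real measure \<Rightarrow> (real \<Rightarrow> real) \<Rightarrow> (real \<times> real) measure" where
  "graph_law \<nu> f = distr \<nu> borel (\<lambda>y. (f y, y))"

lemma pair_measurable:
  "f \<in> borel_measurable borel \<Longrightarrow> (\<lambda>y. (f y, y)) \<in> borel_measurable (borel :: real measure)" for f :: "real \<Rightarrow> real"
  by (intro borel_measurable_Pair) auto

lemma graph_law_monge:
  assumes "\<mu> \<in> prob_moment_measures" "\<nu> \<in> prob_moment_measures" and f: "monge \<mu> \<nu> f"
  shows "graph_law \<nu> f \<in> monge_martingale_transports \<mu> \<nu>"
proof -
  have \<nu>: "prob_space \<nu>" "sets \<nu> = sets borel" "\<nu> \<in> fm" "integrable \<nu> (\<lambda>y. y)" "space \<nu> = UNIV"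
    and \<mu>: "prob_space \<mu>" "sets \<mu> = sets borel" "\<mu> \<in> fm" "integrable \<mu> (\<lambda>y. y)"
    using assms(1,2) prob_moment_fm[OF assms(1)] prob_moment_fm[OF assms(2)]
      fmD(3)[OF prob_moment_fm[OF assms(2)]] by (simp_all add: prob_moment_measures_def)
  interpret \<nu>: prob_space \<nu> by (rule \<nu>)
  interpret \<mu>: prob_space \<mu> by (rule \<mu>)
  note [measurable_cong] = \<nu>(2)
  have fm [measurable]: "f \<in> borel_measurable borel" using f by (simp add: monge_def)
  have pm: "(\<lambda>y. (f y, y)) \<in> measurable \<nu> borel"
    using pair_measurable[OF fm] by measurable
  have d1: "distr \<nu> borel f = \<mu>"
  proof (rule measure_eqI)
    fix A assume "A \<in> sets (distr \<nu> borel f)"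
    then show "emeasure (distr \<nu> borel f) A = emeasure \<mu> A"
      using f \<nu>(5) by (simp add: emeasure_distr \<nu>.emeasure_eq_measure \<mu>.emeasure_eq_measure monge_def)
  qed (simp add: \<mu>)
  have d2: "distr \<nu> borel (\<lambda>y. y) = \<nu>" by (rule distr_id2) (simp add: \<nu>)
  have "integrable (distr \<nu> borel f) (\<lambda>x. x)" unfolding d1 by (rule \<mu>)
  then have fint: "integrable \<nu> f" by (subst (asm) integrable_distr_eq) auto
  have "graph_law \<nu> f \<in> martingale_transports \<mu> \<nu>"
    unfolding martingale_transports_iff[OF assms(1,2)]
  proof (intro conjI ballI)
    show "prob_space (graph_law \<nu> f)" unfolding graph_law_def by (rule \<nu>.prob_space_distr[OF pm])
    show "distr (graph_law \<nu> f) borel fst = \<mu>" "distr (graph_law \<nu> f) borel snd = \<nu>"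
      unfolding graph_law_def using pm d1 d2 by (simp_all add: distr_distr comp_def)
    fix A :: "real set" assume A [measurable]: "A \<in> sets borel"
    have vm [measurable]: "fst -` A \<in> sets (borel :: (real \<times> real) measure)"
      using measurable_sets[OF fst_snd_measurable(1) A] by simp
    have "(LINT z:fst -` A|graph_law \<nu> f. snd z) = (LINT y:f -` A|\<nu>. y)"
      unfolding graph_law_def set_lebesgue_integral_def
      by (subst integral_distr[OF pm]) (auto intro!: Bochner_Integration.integral_cong split: split_indicator)
    also have "\<dots> = (LINT x:A|\<mu>. x)" using f A by (simp add: monge_def)
    also have "\<dots> = (LINT y:f -` A|\<nu>. f y)"
      unfolding d1[symmetric] set_lebesgue_integral_def
      by (subst integral_distr) (auto intro!: Bochner_Integration.integral_cong split: split_indicator)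
    also have "\<dots> = (LINT z:fst -` A|graph_law \<nu> f. fst z)"
      unfolding graph_law_def set_lebesgue_integral_def
      by (subst integral_distr[OF pm]) (auto intro!: Bochner_Integration.integral_cong split: split_indicator)
    finally show "(LINT z:fst -` A|graph_law \<nu> f. snd z) = (LINT z:fst -` A|graph_law \<nu> f. fst z)" .
  qed (simp add: graph_law_def)
  then show ?thesis
    unfolding monge_martingale_transports_def using fm by (auto simp: graph_law_def)
qed

text \<open>Tested on the complement \<open>D\<close> of the graph of \<open>f\<close>: the law of
  \<open>f\<close> does not charge it, and its mass under the law of \<open>g\<close> is that of the
  points where \<open>f\<close> and \<open>g\<close> differ.\<close>

lemma graph_law_inj:
  assumes "finite_measure \<nu>" "sets \<nu> = sets borel" and f: "f \<in> borel_measurable borel" and g: "g \<in> borel_measurable borel"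
    and eq: "graph_law \<nu> f = graph_law \<nu> g"
  shows "AE y in \<nu>. f y = g y"
proof -
  note [measurable_cong] = assms(2)
  have sp: "space \<nu> = UNIV" using sets_eq_imp_space_eq[OF assms(2)] by simp
  have pm: "(\<lambda>y. (f y, y)) \<in> measurable \<nu> borel" "(\<lambda>y. (g y, y)) \<in> measurable \<nu> borel"
    using pair_measurable[OF f] pair_measurable[OF g] by measurable
  define D where "D = {z :: real \<times> real. fst z \<noteq> f (snd z)}"
  have D: "D \<in> sets borel" unfolding D_def using f by measurable
  have "emeasure (graph_law \<nu> f) D = emeasure \<nu> {}"
    unfolding graph_law_def by (subst emeasure_distr[OF pm(1) D]) (auto simp: D_def)
  moreover have "emeasure (graph_law \<nu> g) D = emeasure \<nu> {y. g y \<noteq> f y}"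
    unfolding graph_law_def by (subst emeasure_distr[OF pm(2) D]) (auto simp: D_def sp vimage_def)
  ultimately have "emeasure \<nu> {y. g y \<noteq> f y} = 0" using eq by simp
  moreover have "{y. g y \<noteq> f y} \<in> sets \<nu>" using f g assms(2) by measurable
  ultimately show ?thesis by (intro AE_I[of _ _ "{y. g y \<noteq> f y}"]) auto
qed

text \<open>As \<open>restricted \<mu> C\<close> does not charge the complement of \<open>C\<close>,
  \<open>f\<close> maps almost all of \<open>B\<close> into \<open>C\<close>; likewise
  \<open>g\<close> maps almost all of the complement of \<open>B\<close> outside \<open>C\<close>.
  This fixes the preimage of \<open>C\<close>.\<close>

lemma monge_glue:
  assumes \<mu>: "\<mu> \<in> fm" and \<nu>: "\<nu> \<in> fm" and C: "C \<in> sets borel" and B: "B \<in> sets borel"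
    and f: "monge (restricted \<mu> C) (restricted \<nu> B) f" and g: "monge (restricted \<mu> (-C)) (restricted \<nu> (-B)) g"
  shows "monge \<mu> \<nu> (\<lambda>y. if y \<in> B then f y else g y)" 
    and "AE y in \<nu>. (if y \<in> B then f y else g y) \<in> C \<longleftrightarrow> y \<in> B"
proof -
  let ?h = "\<lambda>y. if y \<in> B then f y else g y"
  interpret \<nu>: finite_measure \<nu> by (rule fmD(1)[OF \<nu>])
  interpret \<mu>: finite_measure \<mu> by (rule fmD(1)[OF \<mu>])
  note s = fmD(2)[OF \<nu>] fmD(2)[OF \<mu>]
  have B': "- B \<in> sets borel" and C': "- C \<in> sets borel" using B C by auto
  have fm: "f \<in> borel_measurable borel" and gm: "g \<in> borel_measurable borel"
    using f g by (auto simp: monge_def)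
  have h: "?h \<in> borel_measurable borel" using fm gm B by measurable
  have f': "measure \<nu> (B \<inter> f -` A) = measure \<mu> (C \<inter> A)" "(LINT y:B \<inter> f -` A|\<nu>. y) = (LINT x:C \<inter> A|\<mu>. x)"
    and g': "measure \<nu> (-B \<inter> g -` A) = measure \<mu> (-C \<inter> A)" "(LINT y:-B \<inter> g -` A|\<nu>. y) = (LINT x:-C \<inter> A|\<mu>. x)"
    if A: "A \<in> sets borel" for A
    using f[unfolded monge_def, THEN conjunct2, rule_format, OF A] g[unfolded monge_def, THEN conjunct2, rule_format, OF A]
    by (simp_all add: measure_restricted set_integral_restricted s A B C B' C' borel_vimage[OF fm A] borel_vimage[OF gm A])
  show "monge \<mu> \<nu> ?h"
    unfolding monge_def
  proof (intro conjI ballI h)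
    fix A :: "real set" assume A: "A \<in> sets borel"
    note vm = borel_vimage[OF fm A] borel_vimage[OF gm A]
    have eq: "?h -` A = (B \<inter> f -` A) \<union> (-B \<inter> g -` A)" by (auto split: if_splits)
    have eqA: "A = (C \<inter> A) \<union> (-C \<inter> A)" by auto
    have "measure \<nu> (?h -` A) = measure \<nu> (B \<inter> f -` A) + measure \<nu> (-B \<inter> g -` A)"
      unfolding eq by (rule \<nu>.finite_measure_Union) (use vm B s in auto)
    moreover have "measure \<mu> A = measure \<mu> (C \<inter> A) + measure \<mu> (-C \<inter> A)"
      by (subst eqA, rule \<mu>.finite_measure_Union) (use A C s in auto)
    ultimately show "measure \<nu> (?h -` A) = measure \<mu> A" using f' g' A by simp
    have "(LINT y:?h -` A|\<nu>. y) = (LINT y:B \<inter> f -` A|\<nu>. y) + (LINT y:-B \<inter> g -` A|\<nu>. y)"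
      unfolding eq
      by (rule set_integral_Un, blast)
        (rule fm_set_integrable[OF \<nu> _ fmD(4)[OF \<nu>]], use vm B in auto)+
    moreover have "(LINT x:A|\<mu>. x) = (LINT x:C \<inter> A|\<mu>. x) + (LINT x:-C \<inter> A|\<mu>. x)"
      by (subst eqA, rule set_integral_Un, blast)
        (rule fm_set_integrable[OF \<mu> _ fmD(4)[OF \<mu>]], use A C in auto)+
    ultimately show "(LINT y:?h -` A|\<nu>. y) = (LINT x:A|\<mu>. x)" using f' g' A by simp
  qed
  have "measure \<nu> (B \<inter> f -` (-C)) = 0" "measure \<nu> (-B \<inter> g -` C) = 0"
    using f'(1)[OF C'] g'(1)[OF C] by auto
  then have "B \<inter> f -` (-C) \<in> null_sets \<nu>" "-B \<inter> g -` C \<in> null_sets \<nu>"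
    using borel_vimage[OF fm C'] borel_vimage[OF gm C] B s
    by (auto intro!: null_setsI simp: \<nu>.emeasure_eq_measure)
  from AE_not_in[OF this(1)] AE_not_in[OF this(2)]
  show "AE y in \<nu>. (if y \<in> B then f y else g y) \<in> C \<longleftrightarrow> y \<in> B" by eventually_elim auto
qed

text \<open>Turns a splitting into a Monge transport with \<open>B\<close> as its sublevel set at
  \<open>c\<close>, so essentially different splittings yield different transports.\<close>

lemma monge_through_admissible:
  assumes cx: "put_le \<mu> \<nu>" and at: "atomless \<nu>" and B: "admissible \<mu> \<nu> c B"
  obtains f where "monge \<mu> \<nu> f" "AE y in \<nu>. f y \<le> c \<longleftrightarrow> y \<in> B"
proof -
  interpret atomless_fm \<nu> by unfold_locales (rule put_leD(2)[OF cx], rule at)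
  have Bs: "B \<in> sets borel" "- B \<in> sets borel" using B by (auto simp: admissible_def)
  have C: "- {..c} = {c<..}" by auto
  obtain f where f: "monge (restricted \<mu> {..c}) (restricted \<nu> B) f"
    using monge_exists[of "restricted \<mu> {..c}" "restricted \<nu> B"] B atomless_restricted[OF Bs(1)] by (auto simp: admissible_def atomless_fm_def)
  obtain g where g: "monge (restricted \<mu> (- {..c})) (restricted \<nu> (- B)) g"
    using monge_exists[of "restricted \<mu> (- {..c})" "restricted \<nu> (- B)"] B atomless_restricted[OF Bs(2)] by (auto simp: admissible_def atomless_fm_def C)
  show thesis
    using monge_glue[OF put_leD(1)[OF cx] fm _ Bs(1) f g] that by auto
qed

text \<open>If the Monge martingale transport is unique, none of the splits admits the perturbation, so the
  sublevel sets of the transport map are half-lines: the map is the monotone rearrangement.\<close>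

lemma unique_monge_sublevel:
  assumes cx: "put_le \<mu> \<nu>" and at: "atomless \<nu>"
    and unique: "\<And>g. monge \<mu> \<nu> g \<Longrightarrow> AE y in \<nu>. f y = g y"
  shows "AE y in \<nu>. f y \<le> c \<longleftrightarrow> cdf \<nu> y \<le> cdf \<mu> c"
proof -
  interpret atomless_fm \<nu> by unfold_locales (rule put_leD(2)[OF cx], rule at)
  have B: "AE y in \<nu>. f y \<le> c \<longleftrightarrow> y \<in> B" if B: "admissible \<mu> \<nu> c B" for B
  proof -
    obtain g where g: "monge \<mu> \<nu> g" "AE y in \<nu>. g y \<le> c \<longleftrightarrow> y \<in> B"
      using monge_through_admissible[OF cx at B] .
    show ?thesis using g(2) unique[OF g(1)] by eventually_elim auto
  qed
  show ?thesis
  proof (rule split_alternative[OF cx, of c])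
    fix B assume *: "admissible \<mu> \<nu> c B" "AE y in \<nu>. y \<in> B \<longleftrightarrow> y \<in> lev (measure \<mu> {..c})"
    show ?thesis using B[OF *(1)] *(2) by eventually_elim (auto simp: lev_def cdf_def2)
  next
    fix B B' assume *: "admissible \<mu> \<nu> c B" "admissible \<mu> \<nu> c B'" "measure \<nu> (B' - B) > 0"
    have "AE y in \<nu>. y \<notin> B' - B"
      using B[OF *(1)] B[OF *(2)] by eventually_elim auto
    then have "emeasure \<nu> (B' - B) = 0"
      using *(1,2) by (subst (asm) AE_iff_measurable[of "B' - B"]) (auto simp: admissible_def)
    then show ?thesis using *(3) by (simp add: measure_def)
  qed
qed

section \<open>Shadows of point masses\<close>

lemma convex_measurable:
  fixes \<phi> :: "real \<Rightarrow> real"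
  assumes "convex_on UNIV \<phi>" shows "\<phi> \<in> borel_measurable borel"
  by (intro borel_measurable_continuous_onI convex_on_continuous assms) simp

lemma convex_support:
  fixes \<phi> :: "real \<Rightarrow> real"
  assumes "convex_on UNIV \<phi>" obtains s where "\<And>y. \<phi> x + s * (y - x) \<le> \<phi> y"
  using convex_le_Inf_differential[OF assms, of x] that by auto

text \<open>A line of support bounds the negative part by an integrable function, so failing
  integrability can only come from the positive part.\<close>

lemma ext_integral_not_integrable:
  assumes M: "M \<in> fm" and \<phi>: "convex_on UNIV \<phi>" and n: "\<not> integrable M \<phi>"
  shows "ext_integral M \<phi> = \<infinity>"
proof -
  note [measurable_cong] = fmD(2)[OF M] and [measurable] = convex_measurable[OF \<phi>]
  obtain s where s: "\<And>y. \<phi> 0 + s * (y - 0) \<le> \<phi> y" using convex_support[OF \<phi>, of 0] by blast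
  have "integrable M (\<lambda>y. - \<phi> 0 + (- s) * y)" by (rule fm_integrable_affine[OF M])
  then have "(\<integral>\<^sup>+y. ennreal (norm (- \<phi> 0 + (- s) * y)) \<partial>M) < \<infinity>" by (simp add: integrable_iff_bounded)
  moreover have "(\<integral>\<^sup>+y. ennreal (- \<phi> y) \<partial>M) \<le> (\<integral>\<^sup>+y. ennreal (norm (- \<phi> 0 + (- s) * y)) \<partial>M)"
  proof (intro nn_integral_mono ennreal_leI)
    fix y show "- \<phi> y \<le> norm (- \<phi> 0 + (- s) * y)" using s[of y] by simp
  qed
  ultimately have neg: "(\<integral>\<^sup>+y. ennreal (- \<phi> y) \<partial>M) < \<infinity>" by (rule le_less_trans[rotated])
  then have pos: "(\<integral>\<^sup>+y. ennreal (\<phi> y) \<partial>M) = \<infinity>"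
    using n by (auto simp: real_integrable_def)
  obtain q where "0 \<le> q" "(\<integral>\<^sup>+y. ennreal (- \<phi> y) \<partial>M) = ennreal q"
    using neg by (metis ennreal_cases infinity_ennreal_def less_irrefl)
  then show ?thesis unfolding ext_integral_def pos by simp
qed

text \<open>A convex function that is not integrable for \<open>N\<close> has integral \<infinity>
  there, so the inequality for it is trivial.\<close>

lemma le_cxI:
  assumes M: "M \<in> fm" and N: "N \<in> fm"
    and le: "\<And>\<phi>. convex_on UNIV \<phi> \<Longrightarrow> integrable N \<phi> \<Longrightarrow> integrable M \<phi> \<and> (LINT x|M. \<phi> x) \<le> (LINT x|N. \<phi> x)"
  shows "M \<le>cx N"
  unfolding le_cx_def
proof (intro allI impI)
  fix \<phi> :: "real \<Rightarrow> real" assume \<phi>: "convex_on UNIV \<phi>"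
  show "ext_integral M \<phi> \<le> ext_integral N \<phi>"
  proof (cases "integrable N \<phi>")
    case True
    then show ?thesis using le[OF \<phi> True] by (simp add: ext_integral_integrable)
  next
    case False
    then show ?thesis using ext_integral_not_integrable[OF N \<phi>] by simp
  qed
qed

section \<open>Point masses and the uniqueness of shadows\<close>

lemma sets_point_mass [simp]: "sets (point_mass a x) = sets borel" "space (point_mass a x) = UNIV"
  by (simp_all add: point_mass_def space_scale_measure)

lemma emeasure_point_mass: "A \<in> sets borel \<Longrightarrow> emeasure (point_mass a x) A = ennreal a * indicator A x"
  by (simp add: point_mass_def)

lemma integral_point_mass:
  fixes g :: "real \<Rightarrow> real"
  assumes a: "0 \<le> a" and g: "g \<in> borel_measurable borel"
  shows "integrable (point_mass a x) g" "(LINT y|point_mass a x. g y) = a * g x"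
proof -
  have eq: "point_mass a x = density (return borel x) (\<lambda>_. ennreal a)"
    by (rule measure_eqI) (auto simp: emeasure_point_mass emeasure_density nn_integral_cmult)
  have [measurable]: "g \<in> borel_measurable (return borel x)" using g by simp
  have "(\<integral>\<^sup>+y. ennreal (norm (g y)) \<partial>return borel x) < \<infinity>"
    using g by (subst nn_integral_return) auto
  then have int: "integrable (return borel x) g" using g by (simp add: integrable_iff_bounded)
  show "integrable (point_mass a x) g"
    unfolding eq using a int by (subst integrable_density) auto
  show "(LINT y|point_mass a x. g y) = a * g x"
    unfolding eq using a g by (subst integral_density) (auto simp: integral_return)
qed

lemma point_mass_fm:
  assumes "0 \<le> a" shows "point_mass a x \<in> fm"
proof -
  have "finite_measure (point_mass a x)"
    by (intro finite_measureI) (simp add: emeasure_point_mass)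
  then show ?thesis
    using integral_point_mass(1)[OF assms, of "\<lambda>y. y"] by (simp add: finite_moment_measures_def)
qed

lemma mass_point_mass: "0 \<le> a \<Longrightarrow> measure (point_mass a x) UNIV = a"
  by (simp add: measure_def emeasure_point_mass)

text \<open>Jensen's inequality, by integrating a line of support at \<open>x\<close>. Together with
  \<open>point_mass_le_cxD\<close> it identifies the candidates for the shadow of a point mass as
  the submeasures with the given mass and mean.\<close>

lemma point_mass_le_cx:
  assumes a: "0 \<le> a" and N: "N \<in> fm" "measure N UNIV = a" "(LINT y|N. y) = a * x"
  shows "point_mass a x \<le>cx N"
proof (rule le_cxI[OF point_mass_fm[OF a] N(1)], intro conjI)
  fix \<phi> :: "real \<Rightarrow> real" assume \<phi>: "convex_on UNIV \<phi>" and int: "integrable N \<phi>"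
  show "integrable (point_mass a x) \<phi>"
    using integral_point_mass(1)[OF a convex_measurable[OF \<phi>]] .
  obtain s where s: "\<And>y. \<phi> x + s * (y - x) \<le> \<phi> y" using convex_support[OF \<phi>, of x] by blast
  have "a * \<phi> x = (\<phi> x - s * x) * measure N UNIV + s * (LINT y|N. y)"
    using N by (simp add: algebra_simps)
  also have "\<dots> = (LINT y|N. (\<phi> x - s * x) + s * y)"
    by (rule integral_affine[OF N(1), symmetric])
  also have "\<dots> \<le> (LINT y|N. \<phi> y)"
    using s by (intro integral_mono fm_integrable_affine N int) (simp add: algebra_simps)
  finally show "(LINT y|point_mass a x. \<phi> y) \<le> (LINT y|N. \<phi> y)"
    using integral_point_mass(2)[OF a convex_measurable[OF \<phi>]] by simp
qed

lemma point_mass_le_cxD: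
  assumes "0 \<le> a" "N \<in> fm" "point_mass a x \<le>cx N"
  shows "measure N UNIV = a" "(LINT y|N. y) = a * x"
  using le_cx_affine[OF assms(3) point_mass_fm[OF assms(1)] assms(2)] integral_point_mass(2)[OF assms(1), of "\<lambda>y. y" x]
    mass_point_mass[OF assms(1)] by simp_all

text \<open>The put function determines the measure: its right derivative is the distribution function.\<close>

lemma fm_eqI_put:
  assumes M: "M \<in> fm" and N: "N \<in> fm" and mass: "measure M UNIV = measure N UNIV"
    and put: "\<And>t. put M t = put N t"
  shows "M = N"
proof -
  have lim: "(\<lambda>n. real (Suc n) * (put L (t + 1 / real (Suc n)) - put L t)) \<longlonglongrightarrow> measure L {..t}"
    if L: "L \<in> fm" for L t
  proof -
    note [measurable_cong] = fmD(2)[OF L]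
    interpret finite_measure L by (rule fmD(1)[OF L])
    define d where "d n x = real (Suc n) * (max 0 (t + 1 / real (Suc n) - x) - max 0 (t - x))" for n x
    have b: "0 \<le> d n x" "d n x \<le> 1" for n x
    proof -
      define h where "h = 1 / real (Suc n)"
      have h: "0 < h" "real (Suc n) * h = 1" by (simp_all add: h_def)
      have "0 \<le> max 0 (t + h - x) - max 0 (t - x)" "max 0 (t + h - x) - max 0 (t - x) \<le> h"
        using h(1) by auto
      from mult_left_mono[OF this(1), of "real (Suc n)"] mult_left_mono[OF this(2), of "real (Suc n)"]
      show "0 \<le> d n x" "d n x \<le> 1" using h(2) unfolding d_def h_def by simp_all
    qed
    have "(\<lambda>n. LINT x|L. d n x) \<longlonglongrightarrow> (LINT x|L. indicator {..t} x)"
    proof (rule integral_dominated_convergence[where w = "\<lambda>_. 1"])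
      show "AE x in L. (\<lambda>n. d n x) \<longlonglongrightarrow> indicator {..t} x"
      proof (intro AE_I2 tendsto_eventually)
        fix x
        show "\<forall>\<^sub>F n in sequentially. d n x = indicator {..t} x"
        proof (cases "x \<le> t")
          case True
          have "d n x = 1" for n
          proof -
            have "0 \<le> t - x" using True by simp
            moreover have "0 \<le> 1 / real (Suc n)" by simp
            ultimately have "0 \<le> t - x" "0 \<le> t + 1 / real (Suc n) - x" by linarith+
            then show ?thesis by (simp add: d_def field_simps)
          qed
          then show ?thesis using True by simp
        next
          case False
          then have "0 < x - t" by simp
          from order_tendstoD(2)[OF LIMSEQ_Suc[OF lim_1_over_n] this] show ?thesis
            by eventually_elim (use False in \<open>simp add: d_def\<close>)
        qed
      qed
      show "AE x in L. norm (d n x) \<le> 1" for n using b[of n] by (auto intro!: AE_I2)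
    qed (auto simp: d_def)
    moreover have "(LINT x|L. d n x) = real (Suc n) * (put L (t + 1 / real (Suc n)) - put L t)" for n
      unfolding d_def put_def
      by (subst integral_mult_right_zero, subst Bochner_Integration.integral_diff)
        (auto intro: fm_integrable_put[OF L])
    ultimately show ?thesis by (simp add: fmD(3)[OF L] del: of_nat_Suc)
  qed
  have cdf: "measure M {..t} = measure N {..t}" for t
    using lim[OF M, of t] lim[OF N, of t] unfolding put by (rule LIMSEQ_unique)
  have C: "{t<..} = - {..t}" for t :: real by auto
  have "measure M {t<..} = measure N {t<..}" for t
    using measure_Compl_fm[OF M, of "{..t}"] measure_Compl_fm[OF N, of "{..t}"] mass cdf[of t] unfolding C by simp
  moreover have "emeasure M {t<..} = ennreal (measure M {t<..})" "emeasure N {t<..} = ennreal (measure N {t<..})" for t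
    using finite_measure.emeasure_eq_measure[OF fmD(1)[OF M]] finite_measure.emeasure_eq_measure[OF fmD(1)[OF N]] by blast+
  ultimately show ?thesis
    by (intro measure_eqI_lessThan[OF fmD(2)[OF M] fmD(2)[OF N]]) simp_all
qed

text \<open>Two least candidates have the same put function, and \<open>fm_eqI_put\<close>
  identifies them.\<close>

lemma shadow_eqI:
  assumes "\<eta> \<in> shadow_candidates \<nu> \<gamma>" "\<And>\<eta>'. \<eta>' \<in> shadow_candidates \<nu> \<gamma> \<Longrightarrow> \<eta> \<le>cx \<eta>'"
  shows "shadow \<nu> \<gamma> = \<eta>"
  unfolding shadow_def
proof (rule the_equality)
  fix \<eta>' assume "\<eta>' \<in> shadow_candidates \<nu> \<gamma> \<and> (\<forall>\<xi>\<in>shadow_candidates \<nu> \<gamma>. \<eta>' \<le>cx \<xi>)"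
  then have *: "\<eta>' \<in> fm" "\<eta> \<in> fm" "\<eta>' \<le>cx \<eta>" "\<eta> \<le>cx \<eta>'"
    using assms by (auto simp: shadow_candidates_def)
  show "\<eta>' = \<eta>"
    by (intro fm_eqI_put *(1,2) le_cx_affine(1)[OF *(3)] antisym le_cx_put[OF *(3)] le_cx_put[OF *(4)])
qed (use assms in auto)

section \<open>Submeasures with prescribed mass and mean\<close>

lemma emeasure_le_measure:
  assumes "\<eta> \<le> \<nu>" "sets \<eta> = sets borel" "sets \<nu> = sets borel"
  shows "emeasure \<eta> A \<le> emeasure \<nu> A"
  by (rule le_measureD3[OF assms(1)]) (simp add: assms(2,3))

lemma integral_mono_measure:
  fixes g :: "real \<Rightarrow> real"
  assumes \<eta>: "\<eta> \<in> fm" and \<nu>: "\<nu> \<in> fm" and le: "\<eta> \<le> \<nu>" and int: "integrable \<eta> g" "integrable \<nu> g" and g: "\<And>y. 0 \<le> g y"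
  shows "(LINT y|\<eta>. g y) \<le> (LINT y|\<nu>. g y)"
proof -
  have "(\<integral>\<^sup>+y. ennreal (g y) \<partial>\<eta>) \<le> (\<integral>\<^sup>+y. ennreal (g y) \<partial>\<nu>)"
    by (rule nn_integral_mono_measure) (simp_all add: le fmD(2)[OF \<eta>] fmD(2)[OF \<nu>])
  then have "ennreal (LINT y|\<eta>. g y) \<le> ennreal (LINT y|\<nu>. g y)"
    using int g by (simp add: nn_integral_eq_integral)
  then show ?thesis using g by (simp add: integral_nonneg_AE)
qed

lemma restricted_le:
  assumes "\<nu> \<in> fm" "I \<in> sets borel" shows "restricted \<nu> I \<le> \<nu>"
proof -
  note s = fmD(2)[OF assms(1)]
  have "emeasure (restricted \<nu> I) A \<le> emeasure \<nu> A" for A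
  proof (cases "A \<in> sets borel")
    case True
    then show ?thesis using assms s by (auto simp: emeasure_restricted intro!: emeasure_mono)
  next
    case False
    then show ?thesis using s by (simp add: emeasure_notin_sets)
  qed
  then show ?thesis by (simp add: le_measure_iff le_fun_def)
qed

text \<open>The affine function exists if \<open>I\<close> is an unbounded interval or empty.\<close>

lemma submeasure_rigid:
  assumes \<eta>: "\<eta> \<in> fm" and \<nu>: "\<nu> \<in> fm" and le: "\<eta> \<le> \<nu>" and I: "I \<in> sets borel"
    and mass: "measure \<eta> UNIV = measure \<nu> I" and mean: "(LINT y|\<eta>. y) = (LINT y:I|\<nu>. y)"
    and on: "\<And>y. y \<in> I \<Longrightarrow> 0 \<le> p + q * y" and off: "\<And>y. y \<notin> I \<Longrightarrow> p + q * y < 0"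
  shows "\<eta> = restricted \<nu> I"
proof -
  let ?h = "\<lambda>y. p + q * y"
  note s = fmD(2)[OF \<eta>] fmD(2)[OF \<nu>]
  interpret \<eta>: finite_measure \<eta> by (rule fmD(1)[OF \<eta>])
  interpret \<nu>: finite_measure \<nu> by (rule fmD(1)[OF \<nu>])
  have int: "integrable L ?h" "integrable L (\<lambda>y. max 0 (?h y))" if "L \<in> fm" for L
    using fm_integrable_affine[OF that] fm_integrable_const[OF that, of 0] by auto
  \<comment> \<open>The \<eta>-integral of the positive part of \<open>?h\<close> is at most its
    \<nu>-integral, which by mass and mean equals the \<eta>-integral of \<open>?h\<close> itself;
    hence \<open>?h\<close> is nonnegative \<eta>-almost everywhere and \<eta> lives on
    \<open>I\<close>.\<close>
  have "(LINT y|\<eta>. max 0 (?h y)) \<le> (LINT y|\<nu>. max 0 (?h y))"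
    by (rule integral_mono_measure[OF \<eta> \<nu> le]) (use int[OF \<eta>] int[OF \<nu>] in auto)
  also have "\<dots> = (LINT y:I|\<nu>. ?h y)"
    unfolding set_lebesgue_integral_def
  proof (rule Bochner_Integration.integral_cong)
    fix y show "max 0 (?h y) = indicator I y *\<^sub>R ?h y"
      using on[of y] off[of y] by (cases "y \<in> I") auto
  qed simp
  also have "\<dots> = (LINT y|\<eta>. ?h y)"
    using mass mean by (simp add: set_integral_affine[OF \<nu> I] integral_affine[OF \<eta>])
  finally have "(LINT y|\<eta>. max 0 (?h y) - ?h y) \<le> 0"
    using int[OF \<eta>] by (subst Bochner_Integration.integral_diff) auto
  moreover have "0 \<le> (LINT y|\<eta>. max 0 (?h y) - ?h y)" by (rule integral_nonneg_AE) auto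
  ultimately have "AE y in \<eta>. max 0 (?h y) - ?h y = 0"
    using int[OF \<eta>] by (subst integral_nonneg_eq_0_iff_AE[symmetric]) auto
  then have "AE y in \<eta>. y \<in> I"
  proof eventually_elim
    case (elim y)
    then show ?case using off[of y] by (cases "y \<in> I") auto
  qed
  then have AE: "emeasure \<eta> A = emeasure \<eta> (I \<inter> A)" if "A \<in> sets borel" for A
    using that I s by (intro emeasure_eq_AE) auto
  have le': "measure \<eta> A \<le> measure (restricted \<nu> I) A" if A: "A \<in> sets borel" for A
    using AE[OF A] emeasure_le_measure[OF le s, of "I \<inter> A"] emeasure_restricted[OF s(2) I A]
    by (simp add: \<eta>.emeasure_eq_measure \<nu>.emeasure_eq_measure measure_restricted[OF s(2) I A])
  show ?thesis
  proof (rule measure_eqI)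
    fix A assume "A \<in> sets \<eta>"
    then have A: "A \<in> sets borel" "- A \<in> sets borel" using s by auto
    \<comment> \<open>Domination on \<open>A\<close> and on its complement, with equal totals,
      forces equality.\<close>
    have "measure \<eta> A = measure (restricted \<nu> I) A"
      using le'[OF A(1)] le'[OF A(2)] measure_Compl_fm[OF \<eta> A(1)] measure_Compl_fm[OF fm_restricted[OF \<nu> I] A(1)]
        mass mass_restricted[OF \<nu> I] by linarith
    then show "emeasure \<eta> A = emeasure (restricted \<nu> I) A"
      using finite_measure.emeasure_eq_measure[OF fmD(1)[OF fm_restricted[OF \<nu> I]]] \<eta>.emeasure_eq_measure by simp
  qed (use s in simp)
qed

text \<open>The chord of a convex function over \<open>(l, r]\<close> lies above it on this interval and below it outside.\<close>

lemma submeasure_chord: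
  assumes \<eta>: "\<eta> \<in> fm" and \<nu>: "\<nu> \<in> fm" and le: "\<eta> \<le> \<nu>" and lr: "l < r"
    and mass: "measure \<eta> UNIV = measure \<nu> {l<..r}" and mean: "(LINT y|\<eta>. y) = (LINT y:{l<..r}|\<nu>. y)"
  shows "restricted \<nu> {l<..r} \<le>cx \<eta>"
proof (rule le_cxI)
  let ?I = "{l<..r}"
  note s = fmD(2)[OF \<eta>] fmD(2)[OF \<nu>]
  have I: "?I \<in> sets borel" by simp
  show "\<eta> \<in> fm" by (rule \<eta>)
  show R: "restricted \<nu> ?I \<in> fm" by (rule fm_restricted[OF \<nu> I])
  fix \<phi> :: "real \<Rightarrow> real" assume \<phi>: "convex_on UNIV \<phi>" and int: "integrable \<eta> \<phi>"
  have \<phi>m: "\<phi> \<in> borel_measurable borel" by (rule convex_measurable[OF \<phi>])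
  define k where "k = (\<phi> r - \<phi> l) / (r - l)"
  define ell where "ell y = (\<phi> l - k * l) + k * y" for y
  have k: "k * (r - l) = \<phi> r - \<phi> l" using lr by (simp add: k_def)
  have ellr: "ell r = \<phi> r" "ell l = \<phi> l" using k by (auto simp: ell_def algebra_simps)
  have on: "\<phi> y \<le> ell y" if "y \<in> ?I" for y
  proof -
    define t where "t = (y - l) / (r - l)"
    have t: "0 \<le> t" "t \<le> 1" "t * (r - l) = y - l" using that lr by (auto simp: t_def)
    have y: "(1 - t) *\<^sub>R l + t *\<^sub>R r = y" using t(3) by (simp add: algebra_simps)
    have "\<phi> y \<le> (1 - t) * \<phi> l + t * \<phi> r"
      using convex_onD[OF \<phi> t(1,2), of l r] y by simp
    also have "\<dots> = \<phi> l + t * (k * (r - l))" unfolding k by (simp add: algebra_simps)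
    also have "\<dots> = \<phi> l + k * (t * (r - l))" by simp
    finally show ?thesis unfolding t(3) by (simp add: ell_def algebra_simps)
  qed
  have off: "ell y \<le> \<phi> y" if "y \<notin> ?I" for y
  proof (cases "y \<le> l")
    case True
    define t where "t = (l - y) / (r - y)"
    have t: "0 \<le> t" "t < 1" "t * (r - y) = l - y" using True lr by (auto simp: t_def)
    have l: "(1 - t) *\<^sub>R y + t *\<^sub>R r = l" using t(3) by (simp add: algebra_simps)
    have "\<phi> l \<le> (1 - t) * \<phi> y + t * \<phi> r"
      using convex_onD[OF \<phi> t(1), of y r] t l by simp
    moreover have "\<phi> l = (1 - t) * ell y + t * \<phi> r"
      unfolding ellr[symmetric] by (subst l[symmetric]) (simp add: ell_def algebra_simps)
    ultimately have "(1 - t) * ell y \<le> (1 - t) * \<phi> y" by simp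
    then show ?thesis using t by simp
  next
    case False
    then have y: "r < y" using that by auto
    define t where "t = (r - l) / (y - l)"
    have t: "0 < t" "t \<le> 1" "t * (y - l) = r - l" using y lr by (auto simp: t_def)
    have r: "(1 - t) *\<^sub>R l + t *\<^sub>R y = r" using t(3) by (simp add: algebra_simps)
    have "\<phi> r \<le> (1 - t) * \<phi> l + t * \<phi> y"
      using convex_onD[OF \<phi> _ t(2), of l y] t r by simp
    moreover have "\<phi> r = (1 - t) * \<phi> l + t * ell y"
      unfolding ellr[symmetric] by (subst r[symmetric]) (simp add: ell_def algebra_simps)
    ultimately have "t * ell y \<le> t * \<phi> y" by simp
    then show ?thesis using t by simp
  qed
  have intI: "integrable L (\<lambda>y. indicator ?I y * \<phi> y)" if L: "L \<in> fm" for L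
  proof -
    note [measurable_cong] = fmD(2)[OF L] and [measurable] = \<phi>m
    have "continuous_on {l..r} \<phi>"
      using convex_on_continuous[OF _ \<phi>] continuous_on_subset by blast
    then obtain B where "\<forall>y \<in> {l..r}. norm (\<phi> y) \<le> B"
      using compact_imp_bounded[OF compact_continuous_image, of "{l..r}" \<phi>] by (auto simp: bounded_iff)
    then have "\<bar>indicator ?I y * \<phi> y\<bar> \<le> \<bar>B\<bar>" for y
      by (cases "y \<in> {l<..r}") (auto intro: order_trans[OF _ abs_ge_self])
    then show ?thesis
      by (intro Bochner_Integration.integrable_bound[OF fm_integrable_const[OF L, of "\<bar>B\<bar>"]]) auto
  qed
  have intell: "integrable L ell" "integrable L (\<lambda>y. indicator ?I y * ell y)" if L: "L \<in> fm" for L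
    using fm_set_integrable[OF L I fm_integrable_affine[OF L, of "\<phi> l - k * l" k]] fm_integrable_affine[OF L, of "\<phi> l - k * l" k]
    by (auto simp: ell_def[abs_def] set_integrable_def)
  have intR: "integrable (restricted \<nu> ?I) \<phi>"
    using intI[OF \<nu>] integral_restricted(2)[OF s(2) I \<phi>m] by (simp add: set_integrable_def)
  \<comment> \<open>On the interval \<phi> is the chord minus a nonnegative gap: the chord has the
    same integral on both sides, the gap has the larger integral for \<nu>, and outside the interval
    the chord lies below \<phi>.\<close>
  have "(LINT y|restricted \<nu> ?I. \<phi> y) = (LINT y|\<nu>. indicator ?I y * \<phi> y)"
    using integral_restricted(1)[OF s(2) I \<phi>m] by (simp add: set_lebesgue_integral_def)
  also have "\<dots> = (LINT y:?I|\<nu>. ell y) - (LINT y|\<nu>. indicator ?I y * ell y - indicator ?I y * \<phi> y)"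
    using intell[OF \<nu>] intI[OF \<nu>] by (simp add: set_lebesgue_integral_def)
  also have "\<dots> \<le> (LINT y|\<eta>. ell y) - (LINT y|\<eta>. indicator ?I y * ell y - indicator ?I y * \<phi> y)"
  proof (rule diff_mono)
    show "(LINT y:?I|\<nu>. ell y) \<le> (LINT y|\<eta>. ell y)"
      unfolding ell_def using mass mean by (simp add: set_integral_affine[OF \<nu> I] integral_affine[OF \<eta>])
    show "(LINT y|\<eta>. indicator ?I y * ell y - indicator ?I y * \<phi> y) \<le> (LINT y|\<nu>. indicator ?I y * ell y - indicator ?I y * \<phi> y)"
      by (rule integral_mono_measure[OF \<eta> \<nu> le])
        (use intell[OF \<eta>] intI[OF \<eta>] intell[OF \<nu>] intI[OF \<nu>] on in \<open>auto split: split_indicator\<close>)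
  qed
  also have "\<dots> = (LINT y|\<eta>. ell y - (indicator ?I y * ell y - indicator ?I y * \<phi> y))"
    using intell[OF \<eta>] intI[OF \<eta>] by simp
  also have "\<dots> \<le> (LINT y|\<eta>. \<phi> y)"
  proof (rule integral_mono)
    show "integrable \<eta> (\<lambda>y. ell y - (indicator ?I y * ell y - indicator ?I y * \<phi> y))"
      using intell[OF \<eta>] intI[OF \<eta>] by auto
    fix y show "ell y - (indicator ?I y * ell y - indicator ?I y * \<phi> y) \<le> \<phi> y"
      using off[of y] by (cases "y \<in> ?I") auto
  qed (rule int)
  finally show "integrable (restricted \<nu> ?I) \<phi> \<and> (LINT y|restricted \<nu> ?I. \<phi> y) \<le> (LINT y|\<eta>. \<phi> y)"
    using intR by simp
qed

lemma le_cx_refl: "M \<le>cx M"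
  by (simp add: le_cx_def)

context atomless_fm
begin

lemma AE_lev_cdf: "AE y in \<nu>. y \<in> lev (cdf \<nu> r) \<longleftrightarrow> y \<le> r"
  using AE_cdf_neq[of "cdf \<nu> r"]
proof eventually_elim
  case (elim y)
  then show ?case
    using cdf_nondecreasing[of y r] cdf_nondecreasing[of r y] by (cases "y \<le> r") (auto simp: lev_def)
qed

lemma AE_lev_0: "AE y in \<nu>. y \<notin> lev 0"
  using AE_cdf_neq[of 0]
proof eventually_elim
  case (elim y)
  then show ?case using cdf_nonneg[of y] by (auto simp: lev_def)
qed

text \<open>Among the parts of \<nu> with mass \<open>a\<close> and first moment
  \<open>a * x\<close>, the one that fills an interval is the most concentrated. A chord needs two
  finite endpoints; if the interval is empty or unbounded, mass and mean already determine the
  candidate.\<close>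

lemma shadow_lev:
  assumes uv: "0 \<le> u" "u \<le> v" "v \<le> mass" and a: "a = v - u" and x: "J v - J u = a * x"
  shows "shadow \<nu> (point_mass a x) = restricted \<nu> (lev v - lev u)"
    and "\<eta> \<in> shadow_candidates \<nu> (point_mass a x) \<Longrightarrow> restricted \<nu> (lev v - lev u) \<le>cx \<eta>"
proof -
  define R where "R = restricted \<nu> (lev v - lev u)"
  have Ib: "lev v - lev u \<in> sets borel" by auto
  have R: "R \<in> fm" "measure R UNIV = a" "(LINT y|R. y) = a * x"
    unfolding R_def using uv fm a x Ib
    by (simp_all add: fm_restricted mass_restricted mean_restricted measure_lev_diff set_integral_lev_diff)
  have a0: "0 \<le> a" using a uv by simp
  have cand: "R \<in> shadow_candidates \<nu> (point_mass a x)"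
    unfolding shadow_candidates_def using R a0 restricted_le[OF fm Ib] by (auto intro: point_mass_le_cx simp: R_def)
  have least: "R \<le>cx \<eta>" if "\<eta> \<in> shadow_candidates \<nu> (point_mass a x)" for \<eta>
  proof -
    have \<eta>: "\<eta> \<in> fm" "\<eta> \<le> \<nu>" "measure \<eta> UNIV = a" "(LINT y|\<eta>. y) = a * x"
      using that point_mass_le_cxD[OF a0] by (auto simp: shadow_candidates_def)
    have I: "R = restricted \<nu> I \<and> measure \<eta> UNIV = measure \<nu> I \<and> (LINT y|\<eta>. y) = (LINT y:I|\<nu>. y)"
      if I: "I \<in> sets borel" "AE y in \<nu>. y \<in> lev v - lev u \<longleftrightarrow> y \<in> I" for I
    proof -
      have "R = restricted \<nu> I" unfolding R_def by (rule restricted_cong_AE) (use I Ib in auto)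
      then show ?thesis using R \<eta> fm I by (simp add: mass_restricted mean_restricted)
    qed
    have rigid: "R \<le>cx \<eta>"
      if "I \<in> sets borel" "AE y in \<nu>. y \<in> lev v - lev u \<longleftrightarrow> y \<in> I"
        "\<And>y. y \<in> I \<Longrightarrow> 0 \<le> p + q * y" "\<And>y. y \<notin> I \<Longrightarrow> p + q * y < 0" for I p q
      using submeasure_rigid[OF \<eta>(1) fm \<eta>(2) that(1) _ _ that(3,4)] I[OF that(1,2)] le_cx_refl by simp
    \<comment> \<open>The levels 0 and \<open>mass\<close> need not be attained, so they stand for
      infinite endpoints.\<close>
    consider "u = v" | "u = 0" "v = mass" | "u = 0" "0 < v" "v < mass" | "0 < u" "u < mass" "v = mass"
      | "0 < u" "u < v" "v < mass"
      using uv by linarith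
    then show ?thesis
    proof cases
      case 1
      then show ?thesis by (intro rigid[of "{}" "-1" 0]) auto
    next
      case 2
      then show ?thesis
        using AE_lev_0 by (intro rigid[of UNIV 0 0]) (auto simp: lev_eq_UNIV)
    next
      case 3
      then obtain r where r: "cdf \<nu> r = v" using cdf_surj by metis
      have "AE y in \<nu>. y \<in> lev v - lev u \<longleftrightarrow> y \<in> {..r}"
        using AE_lev_0 AE_lev_cdf[of r] by eventually_elim (use 3 r in auto)
      then show ?thesis by (intro rigid[of "{..r}" r "-1"]) auto
    next
      case 4
      then obtain l where l: "cdf \<nu> l = u" using cdf_surj by metis
      \<comment> \<open>The half-line is closed at \<open>l\<close>, since the affine function must
        be strictly negative off it; the point \<open>l\<close> is null.\<close>
      have "{l} \<in> null_sets \<nu>" using atomless by (auto simp: atomless_def)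
      from AE_not_in[OF this] AE_lev_cdf[of l] have "AE y in \<nu>. y \<in> lev v - lev u \<longleftrightarrow> y \<in> {l..}"
        by eventually_elim (use 4 l in \<open>auto simp: lev_eq_UNIV\<close>)
      then show ?thesis by (intro rigid[of "{l..}" "-l" 1]) auto
    next
      case 5
      then obtain l r where lr: "cdf \<nu> l = u" "cdf \<nu> r = v"
        using cdf_surj[of u] cdf_surj[of v] by (metis less_trans)
      have "l < r" using lr 5 cdf_nondecreasing[of r l] by force
      have ae: "AE y in \<nu>. y \<in> lev v - lev u \<longleftrightarrow> y \<in> {l<..r}"
        using AE_lev_cdf[of l] AE_lev_cdf[of r] by eventually_elim (use lr in auto)
      show ?thesis
        using submeasure_chord[OF \<eta>(1) fm \<eta>(2) \<open>l < r\<close>] I[OF _ ae] by simp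
    qed
  qed
  show "shadow \<nu> (point_mass a x) = restricted \<nu> (lev v - lev u)"
    using shadow_eqI[OF cand least] by (simp add: R_def)
  show "\<eta> \<in> shadow_candidates \<nu> (point_mass a x) \<Longrightarrow> restricted \<nu> (lev v - lev u) \<le>cx \<eta>"
    using least by (simp add: R_def)
qed

text \<open>A window whose mass \<open>a\<close> is that of the atom slides through the levels, and
  its first moment passes from \<open>J a\<close> to \<open>J mass - J (mass - a)\<close>;
  \<open>J_measure_le\<close> for the atom and for its complement puts \<open>a * x\<close> in
  between.\<close>

lemma atom_interval:
  assumes cx: "put_le \<mu> \<nu>"
  obtains u where "0 \<le> u" "u + measure \<mu> {x} \<le> mass" "J (u + measure \<mu> {x}) - J u = measure \<mu> {x} * x"
proof -
  note \<mu> = put_leD[OF cx]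
  define a where "a = measure \<mu> {x}"
  have a: "0 \<le> a" "a \<le> mass"
    using finite_measure.bounded_measure[OF fmD(1)[OF \<mu>(1)], of "{x}"] fmD(3)[OF \<mu>(1)] \<mu>(3)
    by (auto simp: mass_def a_def)
  have pt: "(LINT z:{x}|\<mu>. z) = a * x"
    unfolding a_def using \<mu>(1) fmD(2)[OF \<mu>(1)] finite_measure.emeasure_finite[OF fmD(1)[OF \<mu>(1)]]
    by (subst set_integral_at_point) (auto intro: fm_set_integrable fmD(4))
  have lo: "J a \<le> a * x" using J_measure_le[OF cx, of "{x}"] pt by (simp add: a_def)
  have "J (mass - a) \<le> J mass - a * x"
    using J_measure_le[OF cx, of "- {x}"] measure_Compl_fm[OF \<mu>(1), of "{x}"] pt
      set_integral_split[OF \<mu>(1) _ fmD(4)[OF \<mu>(1)], of "{x}"] \<mu>(3,4)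
    by (simp add: a_def J_mass flip: mass_def)
  then have hi: "a * x \<le> J (mass - a + a) - J (mass - a)" by simp
  have cont: "isCont (\<lambda>u. J (u + a) - J u) u" for u
    by (intro continuous_intros isCont_J isCont_o2[OF _ isCont_J])
  obtain u where "0 \<le> u" "u \<le> mass - a" "J (u + a) - J u = a * x"
    using IVT[of "\<lambda>u. J (u + a) - J u" 0 "a * x" "mass - a"] lo hi a cont by (auto simp: J_0)
  then show thesis by (intro that[of u]) (auto simp: a_def)
qed

end

section \<open>Monotone maps and the third condition\<close>

lemma suminf_indicator_at:
  fixes A :: "nat \<Rightarrow> 'a set"
  assumes "\<And>i j. y \<in> A i \<Longrightarrow> y \<in> A j \<Longrightarrow> i = j"
  shows "(\<Sum>i. indicator (A i) y :: ennreal) = indicator (\<Union>i. A i) y"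
proof (cases "\<exists>i. y \<in> A i")
  case True
  then obtain i where i: "y \<in> A i" by auto
  have "(\<Sum>i. indicator (A i) y :: ennreal) = (\<Sum>k\<in>{i}. indicator (A k) y)"
    by (rule suminf_finite) (use assms i in \<open>auto split: split_indicator\<close>)
  then show ?thesis using i by (auto simp: indicator_def)
qed auto

lemma nn_integral_UN_AE_disjoint:
  fixes A :: "nat \<Rightarrow> 'a set"
  assumes A [measurable]: "\<And>i. A i \<in> sets M" and g [measurable]: "g \<in> borel_measurable M"
    and dis: "AE y in M. \<forall>i j. y \<in> A i \<longrightarrow> y \<in> A j \<longrightarrow> i = j"
  shows "(\<Sum>i. \<integral>\<^sup>+y. indicator (A i) y * g y \<partial>M) = (\<integral>\<^sup>+y. indicator (\<Union>i. A i) y * g y \<partial>M)"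
proof -
  have "(\<Sum>i. \<integral>\<^sup>+y. indicator (A i) y * g y \<partial>M) = (\<integral>\<^sup>+y. (\<Sum>i. indicator (A i) y * g y) \<partial>M)"
    by (rule nn_integral_suminf[symmetric]) auto
  also have "\<dots> = (\<integral>\<^sup>+y. indicator (\<Union>i. A i) y * g y \<partial>M)"
  proof (rule nn_integral_cong_AE)
    show "AE y in M. (\<Sum>i. indicator (A i) y * g y) = indicator (\<Union>i. A i) y * g y"
      using dis
    proof eventually_elim
      case (elim y)
      then show ?case using suminf_indicator_at[of y A] by simp
    qed
  qed
  finally show ?thesis .
qed

text \<open>For the case of equality between put functions: the totals are known in
  \<open>ennreal\<close>, and their finiteness yields summability.\<close>

lemma suminf_eq_imp_eq:
  fixes r r' :: "nat \<Rightarrow> real"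
  assumes r: "\<And>j. 0 \<le> r j" "\<And>j. r j \<le> r' j" and A: "0 \<le> A" "A \<le> A'"
    and eq: "(\<Sum>j. ennreal (r j)) + ennreal A = T" "(\<Sum>j. ennreal (r' j)) + ennreal A' = T" and T: "T \<noteq> top"
  shows "r j = r' j" "A = A'"
proof -
  have r': "0 \<le> r' j" for j using r[of j] by simp
  have nt: "(\<Sum>j. ennreal (r j)) \<noteq> top" "(\<Sum>j. ennreal (r' j)) \<noteq> top" using eq T by auto
  have s: "summable r" "summable r'" by (rule summable_suminf_not_top, rule r, rule nt, rule summable_suminf_not_top, rule r', rule nt)
  have "ennreal (suminf r + A) = ennreal (suminf r' + A')"
    using eq r r' nt A s by (simp add: suminf_nonneg)
  then have "suminf r + A = suminf r' + A'"
    using A s r r' by (subst (asm) ennreal_inj) (auto intro!: add_nonneg_nonneg suminf_nonneg)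
  moreover have "suminf r \<le> suminf r'" using r s by (intro suminf_le)
  ultimately have *: "A = A'" "suminf (\<lambda>j. r' j - r j) = 0"
    using A suminf_diff[OF s(2,1)] by auto
  then have "\<forall>j. r' j - r j = 0"
    using suminf_eq_zero_iff[OF summable_diff[OF s(2,1)]] r by simp
  then show "r j = r' j" "A = A'" using * by auto
qed

lemma set_integral_singleton:
  fixes M :: "real measure"
  assumes "M \<in> fm" shows "(LINT z:{x}|M. z) = measure M {x} * x"
  using assms fmD(2)[OF assms] finite_measure.emeasure_finite[OF fmD(1)[OF assms]]
  by (subst set_integral_at_point) (auto intro: fm_set_integrable fmD(4))

locale atoms_setting = atomless_fm +
  fixes \<mu> :: "real measure" and a x :: "nat \<Rightarrow> real"
  assumes prob: "\<mu> \<in> prob_moment_measures" "\<nu> \<in> prob_moment_measures"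
    and cx: "put_le \<mu> \<nu>" and a_nonneg: "\<And>j. 0 \<le> a j" and inj_x: "inj x"
    and atoms: "atomic_part \<mu> = suminf_measure (\<lambda>j. point_mass (a j) (x j))"
begin

lemma fm_\<mu>: "\<mu> \<in> fm"
  by (rule put_leD(1)[OF cx])

lemma sets_\<mu> [measurable_cong]: "sets \<mu> = sets borel" and space_\<mu>: "space \<mu> = UNIV"
  by (rule fmD(2)[OF fm_\<mu>], rule fmD(3)[OF fm_\<mu>])

sublocale M: finite_borel_measure \<mu>
  using fmD(1,2)[OF fm_\<mu>] by (simp add: finite_borel_measure_def finite_borel_measure_axioms_def)

text \<open>Listed points with \<open>a j = 0\<close> are removed as well; they form a \<mu>-null
  set.\<close>

abbreviation N :: "real set" where "N \<equiv> - range x"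

lemma N: "N \<in> sets borel"
proof -
  have "range x \<in> sets borel" by (rule sets.countable) auto
  then show ?thesis by auto
qed

lemma emeasure_atoms:
  assumes "B \<in> sets borel"
  shows "emeasure \<mu> ({y. emeasure \<mu> {y} \<noteq> 0} \<inter> B) = (\<Sum>j. ennreal (a j) * indicator B (x j))"
proof -
  have "(emeasure \<mu> {y} \<noteq> 0) = (measure \<mu> {y} \<noteq> 0)" for y
    unfolding M.emeasure_eq_measure by simp
  then have "countable {y. emeasure \<mu> {y} \<noteq> 0}" using M.countable_support by simp
  then have "{y. emeasure \<mu> {y} \<noteq> 0} \<in> sets borel"
    by (rule sets.countable[rotated]) simp
  from emeasure_restricted[OF sets_\<mu> this assms] show ?thesis
    using assms unfolding restricted_def atomic_part_def[symmetric] atoms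
    by (simp add: emeasure_suminf_measure emeasure_point_mass)
qed

lemma measure_atom: "measure \<mu> {x j} = a j"
proof -
  have "(\<Sum>i. ennreal (a i) * indicator {x j} (x i)) = (\<Sum>i\<in>{j}. ennreal (a i) * indicator {x j} (x i))"
    by (rule suminf_finite) (use inj_x in \<open>auto dest: injD split: split_indicator\<close>)
  then have "emeasure \<mu> ({y. emeasure \<mu> {y} \<noteq> 0} \<inter> {x j}) = ennreal (a j)"
    using emeasure_atoms[of "{x j}"] by simp
  moreover have "emeasure \<mu> ({y. emeasure \<mu> {y} \<noteq> 0} \<inter> {x j}) = emeasure \<mu> {x j}"
    by (cases "emeasure \<mu> {x j} = 0") auto
  ultimately show ?thesis using a_nonneg by (simp add: measure_def)
qed

lemma measure_N: "y \<in> N \<Longrightarrow> measure \<mu> {y} = 0"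
proof (rule ccontr)
  assume y: "y \<in> N" "measure \<mu> {y} \<noteq> 0"
  then have "emeasure \<mu> {y} = emeasure \<mu> ({y. emeasure \<mu> {y} \<noteq> 0} \<inter> {y})"
    by (intro arg_cong[of _ _ "emeasure \<mu>"]) (auto simp: measure_def)
  also have "\<dots> = (\<Sum>j. ennreal (a j) * indicator {y} (x j))" by (rule emeasure_atoms) simp
  also have "\<dots> = (\<Sum>j. 0)"
    by (rule suminf_cong) (use y(1) in \<open>auto split: split_indicator\<close>)
  finally show False using y by (simp add: measure_def)
qed

lemma measure_atomic_part:
  assumes "B \<in> sets borel"
  shows "measure (suminf_measure (\<lambda>j. point_mass (a j) (x j))) B = measure \<mu> (B \<inter> range x)"
proof -
  have "emeasure (suminf_measure (\<lambda>j. point_mass (a j) (x j))) B = (\<Sum>j. ennreal (a j) * indicator B (x j))"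
    using assms by (simp add: emeasure_suminf_measure emeasure_point_mass)
  also have "\<dots> = (\<Sum>j. emeasure \<mu> (B \<inter> {x j}))"
    by (intro suminf_cong) (auto simp: M.emeasure_eq_measure measure_atom split: split_indicator)
  also have "\<dots> = emeasure \<mu> (\<Union>j. B \<inter> {x j})"
    by (rule suminf_emeasure) (use assms inj_x sets_\<mu> in \<open>auto simp: disjoint_family_on_def dest: injD\<close>)
  also have "(\<Union>j. B \<inter> {x j}) = B \<inter> range x" by auto
  finally show ?thesis by (simp add: measure_def)
qed

definition condition_iii :: bool where
  "condition_iii \<longleftrightarrow>
     (\<forall>i j. i \<noteq> j \<longrightarrow>
        mutually_singular (shadow \<nu> (point_mass (a i) (x i))) (shadow \<nu> (point_mass (a j) (x j)))) \<and>
     (\<forall>A \<in> sets borel.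
        measure \<mu> A - measure (suminf_measure (\<lambda>j. point_mass (a j) (x j))) A =
        measure \<nu> A - measure (suminf_measure (\<lambda>j. shadow \<nu> (point_mass (a j) (x j)))) A)"

text \<open>Once the shadows are restrictions to sets \<open>I j\<close>, singularity means
  disjointness up to null sets, and countably many pairs give one common null set. The sum of the
  shadows is then the restriction to the union.\<close>

lemma condition_iii_iff:
  assumes I: "\<And>j. I j \<in> sets borel" and sh: "\<And>j. shadow \<nu> (point_mass (a j) (x j)) = restricted \<nu> (I j)"
  shows "condition_iii \<longleftrightarrow> (AE y in \<nu>. \<forall>i j. y \<in> I i \<longrightarrow> y \<in> I j \<longrightarrow> i = j) \<and>
    (\<forall>A \<in> sets borel. measure \<mu> (A \<inter> N) = measure \<nu> (A - (\<Union>j. I j)))"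
proof -
  have 1: "mutually_singular (restricted \<nu> (I i)) (restricted \<nu> (I j)) \<longleftrightarrow> (AE y in \<nu>. y \<notin> I i \<inter> I j)" for i j
  proof
    assume "mutually_singular (restricted \<nu> (I i)) (restricted \<nu> (I j))"
    then obtain A where "A \<in> sets borel" "emeasure \<nu> (I i \<inter> A) = 0" "emeasure \<nu> (I j \<inter> - A) = 0"
      using I by (auto simp: mutually_singular_def emeasure_restricted)
    then have "I i \<inter> A \<in> null_sets \<nu>" "I j \<inter> - A \<in> null_sets \<nu>" using I by auto
    from AE_not_in[OF this(1)] AE_not_in[OF this(2)] show "AE y in \<nu>. y \<notin> I i \<inter> I j"
      by eventually_elim auto
  next
    assume "AE y in \<nu>. y \<notin> I i \<inter> I j"
    then have "emeasure \<nu> (I j \<inter> I i) = 0"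
      using I by (subst (asm) AE_iff_measurable[of "I i \<inter> I j"]) (auto simp: Int_commute)
    then show "mutually_singular (restricted \<nu> (I i)) (restricted \<nu> (I j))"
      unfolding mutually_singular_def using I
      by (intro bexI[of _ "- I i"] conjI) (auto simp: emeasure_restricted)
  qed
  have 2: "(\<forall>i j. i \<noteq> j \<longrightarrow> mutually_singular (restricted \<nu> (I i)) (restricted \<nu> (I j))) \<longleftrightarrow>
      (AE y in \<nu>. \<forall>i j. y \<in> I i \<longrightarrow> y \<in> I j \<longrightarrow> i = j)" (is "?L \<longleftrightarrow> ?R")
  proof -
    have "?L \<longleftrightarrow> (\<forall>i j. AE y in \<nu>. i \<noteq> j \<longrightarrow> y \<notin> I i \<inter> I j)" by (simp add: 1)
    also have "\<dots> \<longleftrightarrow> (AE y in \<nu>. \<forall>i j. i \<noteq> j \<longrightarrow> y \<notin> I i \<inter> I j)" by (simp add: AE_all_countable)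
    also have "\<dots> \<longleftrightarrow> ?R" by (intro arg_cong[of _ _ "almost_everywhere \<nu>"] ext) blast
    finally show ?thesis .
  qed
  have 3: "measure (suminf_measure (\<lambda>j. restricted \<nu> (I j))) A = measure \<nu> (A \<inter> (\<Union>j. I j))"
    if dis: "AE y in \<nu>. \<forall>i j. y \<in> I i \<longrightarrow> y \<in> I j \<longrightarrow> i = j" and A: "A \<in> sets borel" for A
  proof -
    note [measurable] = I A
    have "emeasure (suminf_measure (\<lambda>j. restricted \<nu> (I j))) A = (\<Sum>j. \<integral>\<^sup>+y. indicator (I j) y * indicator A y \<partial>\<nu>)"
      using I A by (simp add: emeasure_suminf_measure emeasure_restricted indicator_inter_arith[symmetric])
    also have "\<dots> = (\<integral>\<^sup>+y. indicator (\<Union>j. I j) y * indicator A y \<partial>\<nu>)"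
      by (rule nn_integral_UN_AE_disjoint) (use dis in auto)
    also have "\<dots> = emeasure \<nu> (A \<inter> (\<Union>j. I j))"
      by (simp add: indicator_inter_arith[symmetric] Int_commute)
    finally show ?thesis by (simp add: measure_def)
  qed
  have 4: "measure \<mu> A - measure \<mu> (A \<inter> range x) = measure \<mu> (A \<inter> N)"
    "measure \<nu> A - measure \<nu> (A \<inter> (\<Union>j. I j)) = measure \<nu> (A - (\<Union>j. I j))" if A: "A \<in> sets borel" for A
  proof -
    have r: "range x \<in> sets borel" using N by (metis borel_comp double_compl)
    show "measure \<mu> A - measure \<mu> (A \<inter> range x) = measure \<mu> (A \<inter> N)"
      using M.finite_measure_Diff'[of A "range x"] A r sets_\<mu> by (simp add: Diff_eq)
    show "measure \<nu> A - measure \<nu> (A \<inter> (\<Union>j. I j)) = measure \<nu> (A - (\<Union>j. I j))"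
      using finite_measure_Diff'[of A "\<Union>j. I j"] A I by auto
  qed
  show ?thesis
    unfolding condition_iii_def sh 2
    \<comment> \<open>\<open>conj_cong\<close> makes the disjointness available in the second
      conjunct, where the sum of the shadows is evaluated.\<close>
    by (intro conj_cong refl ball_cong) (simp add: 3 4 measure_atomic_part)
qed

text \<open>The preimage of the atom \<open>x j\<close> consists of the levels between
  \<open>measure \<mu> {..<x j}\<close> and \<open>cdf \<mu> (x j)\<close>, and \<open>f\<close> is
  the identity on the preimage of \<open>N\<close>. So the sets \<open>I j\<close> carry the
  shadows, and \<mu> and \<nu> agree on what is left.\<close>

lemma unique_monge_imp_iii:
  assumes f: "monge \<mu> \<nu> f" and unique: "\<And>g. monge \<mu> \<nu> g \<Longrightarrow> AE y in \<nu>. f y = g y"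
  shows condition_iii
proof -
  define I where "I j = lev (cdf \<mu> (x j)) - lev (measure \<mu> {..<x j})" for j
  have Ib: "I j \<in> sets borel" for j by (simp add: I_def)
  have fb: "f \<in> borel_measurable borel" using f by (simp add: monge_def)
  note vm = borel_vimage[OF fb]
  have fm1: "measure \<nu> (f -` A) = measure \<mu> A" "(LINT y:f -` A|\<nu>. y) = (LINT x:A|\<mu>. x)"
    if "A \<in> sets borel" for A using f that by (auto simp: monge_def)
  have sub: "AE y in \<nu>. f y \<le> c \<longleftrightarrow> cdf \<nu> y \<le> cdf \<mu> c" for c
    by (rule unique_monge_sublevel[OF cx atomless unique])
  have cuts: "AE y in \<nu>. \<forall>i. f y \<le> cut i \<longleftrightarrow> cdf \<nu> y \<le> cdf \<mu> (cut i)"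
    using sub by (simp add: AE_all_countable)
  have mu_mass: "measure \<mu> UNIV = mass" using put_leD(3)[OF cx] by (simp add: mass_def)
  have leM: "measure \<mu> B \<le> mass" for B
    using M.bounded_measure[of B] space_\<mu> mu_mass by simp
  have cdfx: "cdf \<mu> c = measure \<mu> {..<c} + measure \<mu> {c}" for c
  proof -
    have "{..<c} \<union> {c} = {..c}" by auto
    then show ?thesis
      using M.finite_measure_Union[of "{..<c}" "{c}"] by (simp add: cdf_def sets_\<mu> del: Un_insert_right)
  qed
  \<comment> \<open>One inclusion comes from a rational cut between \<open>f y\<close> and
    \<open>c\<close>, the other from equality of the masses.\<close>
  have less: "AE y in \<nu>. f y < c \<longleftrightarrow> cdf \<nu> y \<le> measure \<mu> {..<c}" for c
  proof -
    let ?A = "f -` {..<c}" and ?B = "lev (measure \<mu> {..<c})"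
    have A: "?A \<in> sets borel" by (rule vm) simp
    have imp: "AE y in \<nu>. y \<in> ?A \<longrightarrow> y \<in> ?B"
      using cuts
    proof eventually_elim
      case (elim y)
      show ?case
      proof
        assume "y \<in> ?A"
        then obtain i where i: "f y < cut i" "cut i < c" using cut_dense[of "f y" c] by auto
        then have "cdf \<nu> y \<le> cdf \<mu> (cut i)" using elim[rule_format, of i] by simp
        also have "\<dots> \<le> measure \<mu> {..<c}"
          unfolding cdf_def using i by (intro M.finite_measure_mono) (auto simp: sets_\<mu>)
        finally show "y \<in> ?B" by (simp add: lev_def)
      qed
    qed
    have "measure \<nu> ?A = measure \<nu> (?B \<inter> ?A)"
    proof (rule measure_eq_AE)
      show "AE y in \<nu>. (y \<in> ?A) = (y \<in> ?B \<inter> ?A)" using imp by eventually_elim auto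
    qed (use A in simp_all)
    moreover have "measure \<nu> ?A = measure \<nu> ?B"
      using fm1(1)[of "{..<c}"] leM by (simp add: measure_lev)
    ultimately have "measure \<nu> (?B - ?A) = 0"
      using finite_measure_Diff'[of ?B ?A] A by simp
    then have "?B - ?A \<in> null_sets \<nu>" using A by (intro null_setsI) (auto simp: emeasure_eq_measure)
    from AE_not_in[OF this] imp show ?thesis by eventually_elim (auto simp: lev_def)
  qed
  have fI: "AE y in \<nu>. f y = x j \<longleftrightarrow> y \<in> I j" for j
    using sub[of "x j"] less[of "x j"] by eventually_elim (auto simp: I_def lev_def)
  then have fI: "AE y in \<nu>. \<forall>j. f y = x j \<longleftrightarrow> y \<in> I j" by (simp add: AE_all_countable)
  have sh: "shadow \<nu> (point_mass (a j) (x j)) = restricted \<nu> (I j)" for j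
    unfolding I_def
  proof (rule shadow_lev)
    show "cdf \<mu> (x j) \<le> mass" unfolding cdf_def by (rule leM)
    show "measure \<mu> {..<x j} \<le> cdf \<mu> (x j)" "a j = cdf \<mu> (x j) - measure \<mu> {..<x j}"
      using cdfx[of "x j"] measure_atom[of j] a_nonneg[of j] by auto
    then have "J (cdf \<mu> (x j)) - J (measure \<mu> {..<x j}) = (LINT y:I j|\<nu>. y)"
      by (simp add: I_def set_integral_lev_diff)
    also have "\<dots> = (LINT y:f -` {x j}|\<nu>. y)"
      by (rule set_integral_cong_set) (use fI vm[of "{x j}"] Ib[of j] in
          \<open>auto simp: set_borel_measurable_def intro!: borel_measurable_times elim!: eventually_mono\<close>)
    also have "\<dots> = a j * x j"
      using fm1(2)[of "{x j}"] set_integral_singleton[OF fm_\<mu>, of "x j"] measure_atom[of j] by simp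
    finally show "J (cdf \<mu> (x j)) - J (measure \<mu> {..<x j}) = a j * x j" .
  qed simp
  \<comment> \<open>Where \<mu> has no atom, \<open>cdf \<mu>\<close> is continuous, and the
    sublevel relation at rational cuts on either side of \<open>f y\<close> pins down the level of
    \<open>y\<close>.\<close>
  have G: "AE y in \<nu>. f y \<in> N \<longrightarrow> cdf \<nu> y = cdf \<mu> (f y)"
    using cuts
  proof eventually_elim
    case (elim y)
    show ?case
    proof
      assume "f y \<in> N"
      then have "isCont (cdf \<mu>) (f y)" by (simp add: M.isCont_cdf measure_N)
      then have cont: "(cdf \<mu> \<longlongrightarrow> cdf \<mu> (f y)) (at_left (f y))" "(cdf \<mu> \<longlongrightarrow> cdf \<mu> (f y)) (at_right (f y))"
        by (simp_all add: isCont_def filterlim_at_split)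
      show "cdf \<nu> y = cdf \<mu> (f y)"
      proof (rule ccontr)
        assume "cdf \<nu> y \<noteq> cdf \<mu> (f y)"
        then consider "cdf \<nu> y < cdf \<mu> (f y)" | "cdf \<mu> (f y) < cdf \<nu> y" by linarith
        then show False
        proof cases
          case 1
          have "\<forall>\<^sub>F z in at_left (f y). cdf \<nu> y < cdf \<mu> z"
            by (rule order_tendstoD(1)[OF cont(1) 1])
          then obtain b where b: "b < f y" "\<And>z. b < z \<Longrightarrow> z < f y \<Longrightarrow> cdf \<nu> y < cdf \<mu> z"
            using eventually_at_left[of "f y - 1" "f y"] by auto
          then obtain i where "b < cut i" "cut i < f y" using cut_dense by blast
          then show False using b(2)[of "cut i"] elim[rule_format, of i] by simp
        next
          case 2
          have "\<forall>\<^sub>F z in at_right (f y). cdf \<mu> z < cdf \<nu> y"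
            by (rule order_tendstoD(2)[OF cont(2) 2])
          then obtain b where b: "f y < b" "\<And>z. f y < z \<Longrightarrow> z < b \<Longrightarrow> cdf \<mu> z < cdf \<nu> y"
            using eventually_at_right[of "f y" "f y + 1"] by auto
          then obtain i where "f y < cut i" "cut i < b" using cut_dense by blast
          then show False using b(2)[of "cut i"] elim[rule_format, of i] by simp
        qed
      qed
    qed
  qed
  have Gm [measurable]: "cdf \<mu> \<in> borel_measurable borel"
    by (rule borel_measurable_mono) (simp add: mono_def M.cdf_nondecreasing)
  note N [measurable]
  \<comment> \<open>Excludes \<open>f y \<le> c < y\<close> up to plateaus of
    \<open>cdf \<nu>\<close>. By \<open>G\<close> the set can be described through the value
    \<open>f y\<close> alone, as it must be, since first moments are preserved only over preimages.
    Relative to \<open>c\<close> the integrand is positive on the side of \<nu> and nonpositive on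
    the side of \<mu>.\<close>
  have lower: "AE y in \<nu>. \<not> (f y \<in> N \<and> f y \<le> c \<and> cdf \<nu> c < cdf \<mu> (f y))" for c
  proof -
    define A where "A = {z. z \<in> N \<and> z \<le> c \<and> cdf \<nu> c < cdf \<mu> z}"
    have A: "A \<in> sets borel" unfolding A_def by measurable
    note fA = vm[OF A]
    have pos: "AE y in \<nu>. y \<in> f -` A \<longrightarrow> 0 < y - c"
      using G
    proof eventually_elim
      case (elim y)
      then show ?case using cdf_nondecreasing[of y c] by (force simp: A_def)
    qed
    have "0 \<le> (LINT x:A|\<mu>. c - x)"
      unfolding set_lebesgue_integral_def
      by (intro integral_nonneg_AE AE_I2) (auto simp: A_def split: split_indicator)
    moreover have "(LINT y:f -` A|\<nu>. y - c) = - (LINT x:A|\<mu>. c - x)"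
      using fm1[OF A] by (simp add: set_integral_above[OF fm fA] set_integral_below[OF fm_\<mu> A])
    ultimately have le: "(LINT y:f -` A|\<nu>. y - c) \<le> 0" by simp
    have ge: "0 \<le> (LINT y:f -` A|\<nu>. y - c)"
      unfolding set_lebesgue_integral_def using pos
      by (intro integral_nonneg_AE) (auto elim!: eventually_mono split: split_indicator)
    have "f -` A \<in> null_sets \<nu>"
    proof (rule null_if_pos_func_has_zero_int)
      show "integrable \<nu> (\<lambda>y. y - c)" using fm_integrable_affine[OF fm, of "-c" 1] by simp
      show "AE y \<in> f -` A in \<nu>. 0 < y - c" using pos .
    qed (use le ge fA in auto)
    from AE_not_in[OF this] show ?thesis by eventually_elim (auto simp: A_def)
  qed
  \<comment> \<open>The mirror image, for \<open>y < c \<le> f y\<close>.\<close>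
  have upper: "AE y in \<nu>. \<not> (f y \<in> N \<and> c \<le> f y \<and> cdf \<mu> (f y) < cdf \<nu> c)" for c
  proof -
    define A where "A = {z. z \<in> N \<and> c \<le> z \<and> cdf \<mu> z < cdf \<nu> c}"
    have A: "A \<in> sets borel" unfolding A_def by measurable
    note fA = vm[OF A]
    have pos: "AE y in \<nu>. y \<in> f -` A \<longrightarrow> 0 < c - y"
      using G
    proof eventually_elim
      case (elim y)
      then show ?case using cdf_nondecreasing[of c y] by (force simp: A_def)
    qed
    have "0 \<le> (LINT x:A|\<mu>. x - c)"
      unfolding set_lebesgue_integral_def
      by (intro integral_nonneg_AE AE_I2) (auto simp: A_def split: split_indicator)
    moreover have "(LINT y:f -` A|\<nu>. c - y) = - (LINT x:A|\<mu>. x - c)"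
      using fm1[OF A] by (simp add: set_integral_below[OF fm fA] set_integral_above[OF fm_\<mu> A])
    ultimately have le: "(LINT y:f -` A|\<nu>. c - y) \<le> 0" by simp
    have ge: "0 \<le> (LINT y:f -` A|\<nu>. c - y)"
      unfolding set_lebesgue_integral_def using pos
      by (intro integral_nonneg_AE) (auto elim!: eventually_mono split: split_indicator)
    have "f -` A \<in> null_sets \<nu>"
    proof (rule null_if_pos_func_has_zero_int)
      show "integrable \<nu> (\<lambda>y. c - y)" using fm_integrable_affine[OF fm, of c "-1"] by simp
      show "AE y \<in> f -` A in \<nu>. 0 < c - y" using pos .
    qed (use le ge fA in auto)
    from AE_not_in[OF this] show ?thesis by eventually_elim (auto simp: A_def)
  qed
  \<comment> \<open>The last conjunct removes the plateaus: a cut between \<open>y\<close> and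
    \<open>f y\<close> then has a level different from that of \<open>y\<close>.\<close>
  have "AE y in \<nu>. \<forall>i. \<not> (f y \<in> N \<and> f y \<le> cut i \<and> cdf \<nu> (cut i) < cdf \<mu> (f y)) \<and>
      \<not> (f y \<in> N \<and> cut i \<le> f y \<and> cdf \<mu> (f y) < cdf \<nu> (cut i)) \<and> cdf \<nu> y \<noteq> cdf \<nu> (cut i)"
    unfolding AE_all_countable using lower upper AE_cdf_neq by (intro allI AE_conjI)
  then have id: "AE y in \<nu>. f y \<in> N \<longrightarrow> f y = y"
    using G
  proof eventually_elim
    case (elim y)
    show ?case
    proof (rule impI, rule ccontr)
      assume y: "f y \<in> N" "f y \<noteq> y"
      then have eq: "cdf \<nu> y = cdf \<mu> (f y)" using elim by simp
      consider "f y < y" | "y < f y" using y by linarith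
      then show False
      proof cases
        case 1
        then obtain i where i: "f y < cut i" "cut i < y" using cut_dense by blast
        then have "cdf \<nu> (cut i) \<le> cdf \<nu> y" by (intro cdf_nondecreasing) simp
        then have "cdf \<nu> (cut i) < cdf \<mu> (f y)" using elim(1) eq by (metis order_le_less)
        then show False using elim(1) i y by (metis less_imp_le)
      next
        case 2
        then obtain i where i: "y < cut i" "cut i < f y" using cut_dense by blast
        then have "cdf \<nu> y \<le> cdf \<nu> (cut i)" by (intro cdf_nondecreasing) simp
        then have "cdf \<mu> (f y) < cdf \<nu> (cut i)" using elim(1) eq by (metis order_le_less)
        then show False using elim(1) i y by (metis less_imp_le)
      qed
    qed
  qed
  have "AE y in \<nu>. \<forall>i j. y \<in> I i \<longrightarrow> y \<in> I j \<longrightarrow> i = j"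
    using fI by eventually_elim (use inj_x in \<open>metis injD\<close>)
  moreover have "measure \<mu> (A \<inter> N) = measure \<nu> (A - (\<Union>j. I j))" if A: "A \<in> sets borel" for A
  proof -
    have AN: "A \<inter> N \<in> sets borel" using A N by auto
    have "measure \<nu> (f -` (A \<inter> N)) = measure \<nu> (A - (\<Union>j. I j))"
    proof (rule measure_eq_AE)
      show "AE y in \<nu>. (y \<in> f -` (A \<inter> N)) = (y \<in> A - (\<Union>j. I j))"
        using id fI
      proof eventually_elim
        case (elim y)
        have "y \<in> (\<Union>j. I j) \<longleftrightarrow> f y \<in> range x" using elim(2) by auto
        then show ?case using elim(1) by auto
      qed
      show "f -` (A \<inter> N) \<in> sets \<nu>" using vm[OF AN] by simp
      show "A - (\<Union>j. I j) \<in> sets \<nu>" using A Ib by auto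
    qed
    then show ?thesis using fm1(1)[OF AN] by simp
  qed
  ultimately show ?thesis using condition_iii_iff[OF Ib sh] by blast
qed

end

section \<open>Uniqueness of the martingale transport\<close>

text \<open>The sets \<open>I j\<close> do not come from the transport: two transports are compared
  by interpreting this locale twice with the same sets.\<close>

locale transport_setting = atoms_setting +
  fixes \<pi> :: "(real \<times> real) measure" and I :: "nat \<Rightarrow> real set"
  assumes \<pi>: "\<pi> \<in> martingale_transports \<mu> \<nu>"
    and I [measurable]: "\<And>j. I j \<in> sets borel"
    and mass_I: "\<And>j. measure \<nu> (I j) = a j"
    and least: "\<And>j \<eta>. \<eta> \<in> shadow_candidates \<nu> (point_mass (a j) (x j)) \<Longrightarrow> restricted \<nu> (I j) \<le>cx \<eta>"
    and disj: "AE y in \<nu>. \<forall>i j. y \<in> I i \<longrightarrow> y \<in> I j \<longrightarrow> i = j"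
    and rest: "\<And>A. A \<in> sets borel \<Longrightarrow> measure \<mu> (A \<inter> N) = measure \<nu> (A - (\<Union>j. I j))"
begin

section \<open>Projections and fibres of a martingale transport\<close>

lemma \<pi>_props:
  shows "prob_space \<pi>" and sets_\<pi> [measurable_cong]: "sets \<pi> = sets borel"
    and fst_\<pi>: "distr \<pi> borel fst = \<mu>" and snd_\<pi>: "distr \<pi> borel snd = \<nu>"
    and mart: "A \<in> sets borel \<Longrightarrow> (LINT z:fst -` A|\<pi>. snd z) = (LINT z:fst -` A|\<pi>. fst z)"
  using \<pi> unfolding martingale_transports_iff[OF prob] by simp_all

sublocale P: prob_space \<pi> by (rule \<pi>_props)

lemma meas_\<pi> [measurable]: "fst \<in> measurable \<pi> borel" "snd \<in> measurable \<pi> borel"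
  by measurable

lemma vimage_fst [measurable, simp]: "A \<in> sets borel \<Longrightarrow> fst -` A \<in> sets (borel :: (real \<times> real) measure)"
  and vimage_snd [measurable, simp]: "A \<in> sets borel \<Longrightarrow> snd -` A \<in> sets (borel :: (real \<times> real) measure)"
  using measurable_sets[OF fst_snd_measurable(1), of A] measurable_sets[OF fst_snd_measurable(2), of A] by simp_all

lemma space_\<pi>: "space \<pi> = UNIV"
  using sets_eq_imp_space_eq[OF sets_\<pi>] by simp

lemma emeasure_fst: "A \<in> sets borel \<Longrightarrow> emeasure \<pi> (fst -` A) = emeasure \<mu> A"
  and emeasure_snd: "A \<in> sets borel \<Longrightarrow> emeasure \<pi> (snd -` A) = emeasure \<nu> A"
  using emeasure_distr[OF meas_\<pi>(1), of A] emeasure_distr[OF meas_\<pi>(2), of A]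
  by (simp_all add: fst_\<pi> snd_\<pi> space_\<pi>)

lemma set_integral_fst:
  fixes g :: "real \<Rightarrow> real"
  assumes [measurable]: "A \<in> sets borel" "g \<in> borel_measurable borel"
  shows "(LINT z:fst -` A|\<pi>. g (fst z)) = (LINT x:A|\<mu>. g x)"
  unfolding set_lebesgue_integral_def fst_\<pi>[symmetric]
  by (subst integral_distr) (auto intro!: Bochner_Integration.integral_cong split: split_indicator)

lemma integrable_fst: "g \<in> borel_measurable borel \<Longrightarrow> integrable \<mu> g \<Longrightarrow> integrable \<pi> (\<lambda>z. g (fst z) :: real)"
  and integrable_snd: "g \<in> borel_measurable borel \<Longrightarrow> integrable \<nu> g \<Longrightarrow> integrable \<pi> (\<lambda>z. g (snd z) :: real)"
  using integrable_distr_eq[OF meas_\<pi>(1), of g] integrable_distr_eq[OF meas_\<pi>(2), of g]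
  by (simp_all add: fst_\<pi> snd_\<pi>)

lemma integrable_\<pi>:
  "integrable \<pi> (\<lambda>z. t - fst z)" "integrable \<pi> (\<lambda>z. t - snd z)" "integrable \<pi> (\<lambda>z. max 0 (t - snd z))"
  using integrable_fst[of "\<lambda>x. t - x"] integrable_snd[of "\<lambda>x. t - x"] integrable_snd[of "\<lambda>x. max 0 (t - x)"]
    fm_integrable_affine[OF fm_\<mu>, of t "-1"] fm_integrable_affine[OF fm, of t "-1"] fm_integrable_put[OF fm, of t]
  by simp_all

lemma set_integrable_\<pi>:
  fixes g :: "real \<times> real \<Rightarrow> real"
  assumes "A \<in> sets borel" "integrable \<pi> g" shows "set_integrable \<pi> A g"
  unfolding set_integrable_def using assms sets_\<pi> by (intro integrable_mult_indicator) simp_all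

text \<open>The conditional law of the second coordinate at the atom \<open>x j\<close> times
  \<open>a j\<close>, without the division that fails for \<open>a j = 0\<close>.\<close>

definition fibre :: "nat \<Rightarrow> real measure" where
  "fibre j = distr (density \<pi> (indicator (fst -` {x j}))) borel snd"

lemma sets_fibre [simp]: "sets (fibre j) = sets borel" "space (fibre j) = UNIV"
  by (simp_all add: fibre_def)

lemma emeasure_fibre:
  assumes [measurable]: "B \<in> sets borel"
  shows "emeasure (fibre j) B = emeasure \<pi> (fst -` {x j} \<inter> snd -` B)"
proof -
  have "emeasure (fibre j) B = emeasure (density \<pi> (indicator (fst -` {x j}))) (snd -` B)"
    unfolding fibre_def by (subst emeasure_distr) (auto simp: space_\<pi>)
  also have "\<dots> = (\<integral>\<^sup>+z. indicator (fst -` {x j}) z * indicator (snd -` B) z \<partial>\<pi>)"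
    by (rule emeasure_density) auto
  also have "\<dots> = (\<integral>\<^sup>+z. indicator (fst -` {x j} \<inter> snd -` B) z \<partial>\<pi>)"
    by (simp add: indicator_inter_arith)
  also have "\<dots> = emeasure \<pi> (fst -` {x j} \<inter> snd -` B)"
    by (rule nn_integral_indicator) (simp add: sets_\<pi>)
  finally show ?thesis .
qed

lemma nn_integral_fibre:
  assumes [measurable]: "g \<in> borel_measurable borel"
  shows "(\<integral>\<^sup>+y. g y \<partial>fibre j) = (\<integral>\<^sup>+z. indicator (fst -` {x j}) z * g (snd z) \<partial>\<pi>)"
  unfolding fibre_def by (subst nn_integral_distr, measurable, subst nn_integral_density) auto

lemma integral_fibre:
  fixes g :: "real \<Rightarrow> real"
  assumes [measurable]: "g \<in> borel_measurable borel"
  shows "(LINT y|fibre j. g y) = (LINT z:fst -` {x j}|\<pi>. g (snd z))"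
    and "integrable (fibre j) g \<longleftrightarrow> set_integrable \<pi> (fst -` {x j}) (\<lambda>z. g (snd z))"
proof -
  have eq: "fibre j = distr (density \<pi> (\<lambda>z. ennreal (indicator (fst -` {x j}) z))) borel snd"
    by (simp add: fibre_def ennreal_indicator[abs_def])
  show "(LINT y|fibre j. g y) = (LINT z:fst -` {x j}|\<pi>. g (snd z))"
    unfolding eq set_lebesgue_integral_def by (subst integral_distr, measurable, subst integral_density) auto
  show "integrable (fibre j) g \<longleftrightarrow> set_integrable \<pi> (fst -` {x j}) (\<lambda>z. g (snd z))"
    unfolding eq set_integrable_def by (subst integrable_distr_eq, measurable, subst integrable_density) auto
qed

lemma fibre_fm: "fibre j \<in> fm"
proof -
  have "emeasure (fibre j) UNIV < \<infinity>"
    using emeasure_fibre[of UNIV j] P.emeasure_finite by (simp add: less_top[symmetric])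
  then have "finite_measure (fibre j)" by (intro finite_measureI) simp
  moreover have "integrable \<pi> snd" 
    by (rule integrable_snd[OF _ integrable_id]) simp
  then have "integrable (fibre j) (\<lambda>y. y)"
    using integral_fibre(2)[of "\<lambda>y. y" j] set_integrable_\<pi>[of "fst -` {x j}" snd] by simp
  ultimately show ?thesis by (simp add: finite_moment_measures_def)
qed

lemma mass_fibre: "measure (fibre j) UNIV = a j"
  using emeasure_fibre[of UNIV j] emeasure_fst[of "{x j}"] measure_atom[of j] by (simp add: measure_def)

text \<open>The martingale property gives the mean, and the fibre is part of the second
  marginal.\<close>

lemma fibre_candidate: "fibre j \<in> shadow_candidates \<nu> (point_mass (a j) (x j))"
proof -
  have "(LINT y|fibre j. y) = (LINT z:fst -` {x j}|\<pi>. fst z)"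
    using integral_fibre(1)[of "\<lambda>y. y" j] mart[of "{x j}"] by simp
  also have "\<dots> = a j * x j"
    using set_integral_fst[of "{x j}" "\<lambda>x. x"] set_integral_singleton[OF fm_\<mu>, of "x j"] measure_atom[of j] by simp
  finally have "point_mass (a j) (x j) \<le>cx fibre j"
    by (rule point_mass_le_cx[OF a_nonneg fibre_fm mass_fibre])
  moreover have "emeasure (fibre j) B \<le> emeasure \<nu> B" for B
  proof (cases "B \<in> sets borel")
    case True
    then show ?thesis
      unfolding emeasure_fibre[OF True] emeasure_snd[OF True, symmetric]
      by (intro emeasure_mono Int_lower2) (simp only: sets_\<pi> vimage_snd[OF True])
  next
    case False
    then show ?thesis by (simp add: emeasure_notin_sets)
  qed
  then have "fibre j \<le> \<nu>" by (simp add: le_measure_iff le_fun_def)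
  ultimately show ?thesis using fibre_fm by (simp add: shadow_candidates_def)
qed

lemma put_fibre_ge: "put (restricted \<nu> (I j)) t \<le> put (fibre j) t"
  by (rule le_cx_put[OF least[OF fibre_candidate] fm_restricted[OF fm I] fibre_fm])

text \<open>The martingale property over \<open>N \<inter> {..<t}\<close> replaces
  \<open>fst\<close> by \<open>snd\<close>. It is kept as an equation because the case of equality
  in Jensen's inequality is read off from it in \<open>AE_diagonal\<close>.\<close>

lemma set_integral_N:
  "(LINT x:N|\<mu>. max 0 (t - x)) = (LINT z:fst -` (N \<inter> {..<t})|\<pi>. t - snd z)"
proof -
  note N [measurable]
  have b: "N \<inter> {..<t} \<in> sets borel" "fst -` (N \<inter> {..<t}) \<in> sets (borel :: (real \<times> real) measure)"
    using N by (auto intro!: vimage_fst)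
  have "(LINT x:N|\<mu>. max 0 (t - x)) = (LINT x:N \<inter> {..<t}|\<mu>. t - x)"
    unfolding set_lebesgue_integral_def
    by (rule Bochner_Integration.integral_cong) (auto split: split_indicator)
  also have "\<dots> = (LINT z:fst -` (N \<inter> {..<t})|\<pi>. t - fst z)"
    by (rule set_integral_fst[symmetric]) (use b in auto)
  also have "\<dots> = (LINT z:fst -` (N \<inter> {..<t})|\<pi>. (t - snd z) + (snd z - fst z))" by simp
  also have "\<dots> = (LINT z:fst -` (N \<inter> {..<t})|\<pi>. t - snd z) + (LINT z:fst -` (N \<inter> {..<t})|\<pi>. snd z - fst z)"
    using integrable_\<pi>[of 0] integrable_\<pi>[of t]
    by (intro set_integral_add(2) set_integrable_\<pi> b) (auto simp: Bochner_Integration.integrable_diff)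
  also have "(LINT z:fst -` (N \<inter> {..<t})|\<pi>. snd z - fst z) = 0"
    using mart[OF b(1)] integrable_\<pi>[of 0]
    by (subst set_integral_diff(2)) (auto intro!: set_integrable_\<pi> b(2))
  finally show ?thesis by simp
qed

lemma put_N_ge: "(LINT x:N|\<mu>. max 0 (t - x)) \<le> (LINT z:fst -` N|\<pi>. max 0 (t - snd z))"
  unfolding set_integral_N
  by (rule set_integral_mono_set)
    (use N in \<open>auto intro!: set_integrable_\<pi> integrable_\<pi> split: split_indicator\<close>)

text \<open>The lower bounds exhaust \<open>put \<nu>\<close>: the sets \<open>I j\<close> are
  disjoint, and off their union \<nu> is \<mu> on \<open>N\<close>.\<close>

lemma put_total_\<nu>:
  "(\<Sum>j. ennreal (put (restricted \<nu> (I j)) t)) + ennreal (LINT x:N|\<mu>. max 0 (t - x)) = ennreal (put \<nu> t)"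
proof -
  let ?g = "\<lambda>y. ennreal (max 0 (t - y))"
  define U where "U = (\<Union>j. I j)"
  have U [measurable]: "U \<in> sets borel" unfolding U_def using I by auto
  have nn: "(\<integral>\<^sup>+y. indicator A y * ?g y \<partial>\<nu>) = ennreal (LINT y:A|\<nu>. max 0 (t - y))" if "A \<in> sets borel" for A
  proof -
    have "(\<integral>\<^sup>+y. indicator A y * ?g y \<partial>\<nu>) = (\<integral>\<^sup>+y. ennreal (indicator A y * max 0 (t - y)) \<partial>\<nu>)"
      by (rule nn_integral_cong) (auto split: split_indicator)
    also have "\<dots> = ennreal (LINT y:A|\<nu>. max 0 (t - y))"
      unfolding set_lebesgue_integral_def
      using fm_set_integrable_call_put(1)[OF fm that] by (subst nn_integral_eq_integral) (auto simp: set_integrable_def)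
    finally show ?thesis .
  qed
  have rest': "restricted \<mu> N = restricted \<nu> (- U)"
  proof (rule measure_eqI)
    fix B assume "B \<in> sets (restricted \<mu> N)"
    then have B: "B \<in> sets borel" by (simp add: sets_\<mu>)
    have "N \<inter> B = B \<inter> N" "- U \<inter> B = B - U" by auto
    then show "emeasure (restricted \<mu> N) B = emeasure (restricted \<nu> (- U)) B"
      using rest[OF B] B N U by (simp add: emeasure_restricted sets_\<mu> M.emeasure_eq_measure emeasure_eq_measure U_def)
  qed (simp add: sets_\<mu>)
  have "(LINT x:N|\<mu>. max 0 (t - x)) = (LINT y:- U|\<nu>. max 0 (t - y))"
    using put_restricted[OF fm_\<mu> N, of t] put_restricted[OF fm, of "- U" t] rest' U by simp
  then have N': "ennreal (LINT x:N|\<mu>. max 0 (t - x)) = (\<integral>\<^sup>+y. indicator (- U) y * ?g y \<partial>\<nu>)"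
    using nn[of "- U"] U by simp
  have "(\<Sum>j. ennreal (put (restricted \<nu> (I j)) t)) = (\<Sum>j. \<integral>\<^sup>+y. indicator (I j) y * ?g y \<partial>\<nu>)"
    by (simp only: put_restricted[OF fm I] nn[OF I])
  also have "\<dots> = (\<integral>\<^sup>+y. indicator U y * ?g y \<partial>\<nu>)"
    unfolding U_def by (rule nn_integral_UN_AE_disjoint) (use disj in auto)
  finally have "(\<Sum>j. ennreal (put (restricted \<nu> (I j)) t)) + ennreal (LINT x:N|\<mu>. max 0 (t - x)) =
      (\<integral>\<^sup>+y. indicator U y * ?g y + indicator (- U) y * ?g y \<partial>\<nu>)"
    unfolding N' by (subst nn_integral_add) auto
  also have "\<dots> = (\<integral>\<^sup>+y. ?g y \<partial>\<nu>)"
    by (rule nn_integral_cong) (auto split: split_indicator)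
  also have "\<dots> = ennreal (put \<nu> t)"
    unfolding put_def by (rule nn_integral_eq_integral) (auto simp: fm_integrable_put[OF fm])
  finally show ?thesis .
qed

text \<open>The same total, split according to the first coordinate of the transport.\<close>

lemma put_total_\<pi>:
  "(\<Sum>j. ennreal (put (fibre j) t)) + ennreal (LINT z:fst -` N|\<pi>. max 0 (t - snd z)) = ennreal (put \<nu> t)"
proof -
  note N [measurable]
  let ?g = "\<lambda>z. ennreal (max 0 (t - snd z))"
  have "(\<integral>\<^sup>+z. indicator (fst -` N) z * ?g z \<partial>\<pi>) = (\<integral>\<^sup>+z. ennreal (indicator (fst -` N) z * max 0 (t - snd z)) \<partial>\<pi>)"
    by (rule nn_integral_cong) (auto split: split_indicator)
  also have "\<dots> = ennreal (LINT z:fst -` N|\<pi>. max 0 (t - snd z))"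
    unfolding set_lebesgue_integral_def
    using set_integrable_\<pi>[OF vimage_fst[OF N] integrable_\<pi>(3)[of t]]
    by (subst nn_integral_eq_integral) (auto simp: set_integrable_def)
  finally have N': "ennreal (LINT z:fst -` N|\<pi>. max 0 (t - snd z)) = (\<integral>\<^sup>+z. indicator (fst -` N) z * ?g z \<partial>\<pi>)" ..
  have "ennreal (put (fibre j) t) = (\<integral>\<^sup>+z. indicator (fst -` {x j}) z * ?g z \<partial>\<pi>)" for j
  proof -
    have "ennreal (put (fibre j) t) = (\<integral>\<^sup>+y. ennreal (max 0 (t - y)) \<partial>fibre j)"
      unfolding put_def by (rule nn_integral_eq_integral[symmetric]) (auto simp: fm_integrable_put[OF fibre_fm])
    also have "\<dots> = (\<integral>\<^sup>+z. indicator (fst -` {x j}) z * ?g z \<partial>\<pi>)" by (rule nn_integral_fibre) simp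
    finally show ?thesis .
  qed
  then have "(\<Sum>j. ennreal (put (fibre j) t)) = (\<Sum>j. \<integral>\<^sup>+z. indicator (fst -` {x j}) z * ?g z \<partial>\<pi>)" by simp
  also have "\<dots> = (\<integral>\<^sup>+z. indicator (\<Union>j. fst -` {x j}) z * ?g z \<partial>\<pi>)"
    by (rule nn_integral_UN_AE_disjoint) (use inj_x in \<open>auto simp: sets_\<pi> intro!: AE_I2 dest: injD\<close>)
  finally have "(\<Sum>j. ennreal (put (fibre j) t)) + ennreal (LINT z:fst -` N|\<pi>. max 0 (t - snd z)) =
      (\<integral>\<^sup>+z. indicator (\<Union>j. fst -` {x j}) z * ?g z + indicator (fst -` N) z * ?g z \<partial>\<pi>)"
    unfolding N' by (subst nn_integral_add) auto
  also have "\<dots> = (\<integral>\<^sup>+z. ?g z \<partial>\<pi>)"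
    by (rule nn_integral_cong) (auto split: split_indicator)
  also have "\<dots> = (\<integral>\<^sup>+y. ennreal (max 0 (t - y)) \<partial>\<nu>)"
    unfolding snd_\<pi>[symmetric] by (rule nn_integral_distr[symmetric]) auto
  also have "\<dots> = ennreal (put \<nu> t)"
    unfolding put_def by (rule nn_integral_eq_integral) (auto simp: fm_integrable_put[OF fm])
  finally show ?thesis .
qed

section \<open>Equality in all lower bounds\<close>

lemma put_equalities:
  "put (restricted \<nu> (I j)) t = put (fibre j) t"
  "(LINT x:N|\<mu>. max 0 (t - x)) = (LINT z:fst -` N|\<pi>. max 0 (t - snd z))"
proof -
  have pos: "0 \<le> put L t" for L unfolding put_def by (rule integral_nonneg_AE) simp
  have posN: "0 \<le> (LINT x:N|\<mu>. max 0 (t - x))"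
    unfolding set_lebesgue_integral_def by (rule integral_nonneg_AE) simp
  \<comment> \<open>Two decompositions of one finite total, ordered term by term.\<close>
  note * = suminf_eq_imp_eq[OF pos put_fibre_ge posN put_N_ge put_total_\<nu> put_total_\<pi> ennreal_neq_top]
  show "put (restricted \<nu> (I j)) t = put (fibre j) t" by (rule *(1))
  show "(LINT x:N|\<mu>. max 0 (t - x)) = (LINT z:fst -` N|\<pi>. max 0 (t - snd z))" by (rule *(2))
qed

lemma fibre_eq: "fibre j = restricted \<nu> (I j)"
  by (rule fm_eqI_put[OF fibre_fm fm_restricted[OF fm I]])
    (simp_all add: put_equalities mass_fibre mass_restricted[OF fm I] mass_I)

text \<open>Equality in Jensen's inequality: for each rational \<open>t\<close> the put payoff at
  \<open>snd z\<close> is \<open>t - snd z\<close> if \<open>fst z < t\<close>, and 0 otherwise. A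
  rational strictly between the two coordinates violates this.\<close>

lemma AE_diagonal: "AE z in \<pi>. fst z \<in> N \<longrightarrow> fst z = snd z"
proof -
  note N [measurable]
  have "AE z in \<pi>. fst z \<in> N \<longrightarrow> max 0 (t - snd z) = (if fst z < t then t - snd z else 0)" for t
  proof -
    let ?A = "fst -` N :: (real \<times> real) set" and ?B = "fst -` (N \<inter> {..<t}) :: (real \<times> real) set"
    let ?h = "\<lambda>z. indicator ?A z * max 0 (t - snd z) - indicator ?B z * (t - snd z)"
    have B: "?B \<in> sets borel" by (rule vimage_fst) (use N in auto)
    have int: "integrable \<pi> (\<lambda>z. indicator ?A z * max 0 (t - snd z))" "integrable \<pi> (\<lambda>z. indicator ?B z * (t - snd z))"
      using set_integrable_\<pi>[OF vimage_fst[OF N] integrable_\<pi>(3)[of t]] set_integrable_\<pi>[OF B integrable_\<pi>(2)[of t]]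
      by (simp_all add: set_integrable_def)
    have "(LINT z|\<pi>. ?h z) = 0"
      using int put_equalities(2)[of t] set_integral_N[of t] by (simp add: set_lebesgue_integral_def)
    moreover have nn: "AE z in \<pi>. 0 \<le> ?h z" by (rule AE_I2) (auto split: split_indicator)
    moreover have "integrable \<pi> ?h" using int by (rule Bochner_Integration.integrable_diff)
    ultimately have "AE z in \<pi>. ?h z = 0" using integral_nonneg_eq_0_iff_AE by blast
    then show ?thesis by eventually_elim (auto split: split_indicator_asm)
  qed
  then have "AE z in \<pi>. \<forall>i. fst z \<in> N \<longrightarrow> max 0 (cut i - snd z) = (if fst z < cut i then cut i - snd z else 0)"
    unfolding AE_all_countable by blast
  then show ?thesis
  proof eventually_elim
    case (elim z)
    show ?case
    proof (rule impI, rule ccontr)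
      assume z: "fst z \<in> N" "fst z \<noteq> snd z"
      then consider "fst z < snd z" | "snd z < fst z" by linarith
      then show False
      proof cases
        case 1
        then obtain i where "fst z < cut i" "cut i < snd z" using cut_dense by blast
        then show False using elim[rule_format, of i] z by simp
      next
        case 2
        then obtain i where "snd z < cut i" "cut i < fst z" using cut_dense by blast
        then show False using elim[rule_format, of i] z by simp
      qed
    qed
  qed
qed

text \<open>The right side does not involve the transport: it is \<mu> on the diagonal over
  \<open>N\<close> plus, over each atom, \<nu> on \<open>I j\<close>. This gives uniqueness.\<close>

lemma emeasure_transport:
  assumes D: "D \<in> sets borel"
  shows "emeasure \<pi> D = emeasure \<mu> (N \<inter> {t. (t, t) \<in> D}) + (\<Sum>j. emeasure \<nu> (I j \<inter> {y. (x j, y) \<in> D}))"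
proof -
  note N [measurable] and D [measurable]
  have diag: "(\<lambda>t. (t, t)) \<in> borel_measurable (borel :: real measure)"
    and sect: "\<And>j. (\<lambda>y. (x j, y)) \<in> borel_measurable (borel :: real measure)"
    by (auto intro!: borel_measurable_Pair)
  have Dd: "{t. (t, t) \<in> D} \<in> sets borel"
    using measurable_sets[OF diag D] by (simp add: vimage_def)
  have Ds: "{y. (x j, y) \<in> D} \<in> sets borel" for j
    using measurable_sets[OF sect D] by (simp add: vimage_def)
  have ND: "N \<inter> {t. (t, t) \<in> D} \<in> sets borel" using N Dd by auto
  have eq: "D = (D \<inter> fst -` N) \<union> (\<Union>j. fst -` {x j} \<inter> snd -` {y. (x j, y) \<in> D})"
  proof (rule set_eqI)
    fix z :: "real \<times> real"
    show "z \<in> D \<longleftrightarrow> z \<in> (D \<inter> fst -` N) \<union> (\<Union>j. fst -` {x j} \<inter> snd -` {y. (x j, y) \<in> D})"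
      by (cases z) auto
  qed
  have F: "fst -` {x j} \<inter> snd -` {y. (x j, y) \<in> D} \<in> sets \<pi>" for j
    unfolding sets_\<pi> using vimage_snd[OF Ds] by (intro sets.Int vimage_fst) auto
  have "emeasure \<pi> D = emeasure \<pi> (D \<inter> fst -` N) + emeasure \<pi> (\<Union>j. fst -` {x j} \<inter> snd -` {y. (x j, y) \<in> D})"
    by (subst eq, rule plus_emeasure[symmetric]) (use F D N in \<open>auto simp: sets_\<pi>\<close>)
  also have "emeasure \<pi> (D \<inter> fst -` N) = emeasure \<pi> (fst -` (N \<inter> {t. (t, t) \<in> D}))"
  proof (rule emeasure_eq_AE)
    show "AE z in \<pi>. (z \<in> D \<inter> fst -` N) = (z \<in> fst -` (N \<inter> {t. (t, t) \<in> D}))"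
      using AE_diagonal
    proof eventually_elim
      case (elim z)
      then show ?case by (cases z) auto
    qed
    show "D \<inter> fst -` N \<in> sets \<pi>" unfolding sets_\<pi> using D vimage_fst[OF N] by auto
    show "fst -` (N \<inter> {t. (t, t) \<in> D}) \<in> sets \<pi>" unfolding sets_\<pi> by (rule vimage_fst[OF ND])
  qed
  also have "\<dots> = emeasure \<mu> (N \<inter> {t. (t, t) \<in> D})" by (rule emeasure_fst[OF ND])
  also have "emeasure \<pi> (\<Union>j. fst -` {x j} \<inter> snd -` {y. (x j, y) \<in> D}) =
      (\<Sum>j. emeasure \<pi> (fst -` {x j} \<inter> snd -` {y. (x j, y) \<in> D}))"
    by (rule suminf_emeasure[symmetric]) (use F inj_x in \<open>auto simp: disjoint_family_on_def dest: injD\<close>)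
  also have "\<dots> = (\<Sum>j. emeasure \<nu> (I j \<inter> {y. (x j, y) \<in> D}))"
    by (simp only: emeasure_fibre[OF Ds, symmetric] fibre_eq emeasure_restricted[OF sets_\<nu> I Ds])
  finally show ?thesis .
qed

end

context atoms_setting
begin

lemma iii_imp_unique:
  assumes iii: condition_iii and \<pi>: "\<pi> \<in> martingale_transports \<mu> \<nu>" "\<pi>' \<in> martingale_transports \<mu> \<nu>"
  shows "\<pi> = \<pi>'"
proof -
  have "\<forall>j. \<exists>u. 0 \<le> u \<and> u + a j \<le> mass \<and> J (u + a j) - J u = a j * x j"
    using atom_interval[OF cx] measure_atom by metis
  then obtain u where u: "\<And>j. 0 \<le> u j" "\<And>j. u j + a j \<le> mass" "\<And>j. J (u j + a j) - J (u j) = a j * x j"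
    by metis
  define I where "I j = lev (u j + a j) - lev (u j)" for j
  have I: "I j \<in> sets borel" for j by (simp add: I_def)
  have mI: "measure \<nu> (I j) = a j" for j
    unfolding I_def using u a_nonneg by (subst measure_lev_diff) auto
  have sh: "shadow \<nu> (point_mass (a j) (x j)) = restricted \<nu> (I j)"
    and least: "\<eta> \<in> shadow_candidates \<nu> (point_mass (a j) (x j)) \<Longrightarrow> restricted \<nu> (I j) \<le>cx \<eta>" for j \<eta>
    unfolding I_def using shadow_lev[of "u j" "u j + a j" "a j" "x j"] u a_nonneg by auto
  from iii condition_iii_iff[OF I sh]
  have iii': "AE y in \<nu>. \<forall>i j. y \<in> I i \<longrightarrow> y \<in> I j \<longrightarrow> i = j"
      "\<And>A. A \<in> sets borel \<Longrightarrow> measure \<mu> (A \<inter> N) = measure \<nu> (A - (\<Union>j. I j))" by blast+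
  interpret p: transport_setting \<nu> \<mu> a x \<pi> I
    by unfold_locales (fact \<pi> I mI least iii')+
  interpret q: transport_setting \<nu> \<mu> a x \<pi>' I
    by unfold_locales (fact \<pi> I mI least iii')+
  show ?thesis
  proof (rule measure_eqI)
    show "sets \<pi> = sets \<pi>'" by (simp add: p.sets_\<pi> q.sets_\<pi>)
    fix D assume "D \<in> sets \<pi>"
    then show "emeasure \<pi> D = emeasure \<pi>' D"
      by (simp add: p.sets_\<pi> p.emeasure_transport q.emeasure_transport)
  qed
qed

lemma equivalences:
  "(is_singleton (martingale_transports \<mu> \<nu>) \<longleftrightarrow> is_singleton (monge_martingale_transports \<mu> \<nu>)) \<and>
   (is_singleton (monge_martingale_transports \<mu> \<nu>) \<longleftrightarrow> condition_iii)"
proof -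
  have sub: "monge_martingale_transports \<mu> \<nu> \<subseteq> martingale_transports \<mu> \<nu>"
    by (auto simp: monge_martingale_transports_def)
  \<comment> \<open>Supplies the non-emptiness of both sets and the reference map for the uniqueness
    of Monge transports.\<close>
  obtain f where f: "monge \<mu> \<nu> f" using monge_exists[OF cx atomless] .
  note ne = graph_law_monge[OF prob f]
  have i_ii: "is_singleton (monge_martingale_transports \<mu> \<nu>)" if s: "is_singleton (martingale_transports \<mu> \<nu>)"
  proof (rule is_singletonI')
    show "monge_martingale_transports \<mu> \<nu> \<noteq> {}" using ne by auto
    fix p q assume "p \<in> monge_martingale_transports \<mu> \<nu>" "q \<in> monge_martingale_transports \<mu> \<nu>"
    then have "p \<in> martingale_transports \<mu> \<nu>" "q \<in> martingale_transports \<mu> \<nu>" using sub by auto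
    then show "p = q" using s by (auto elim!: is_singletonE)
  qed
  have ii_iii: condition_iii if s: "is_singleton (monge_martingale_transports \<mu> \<nu>)"
  proof (rule unique_monge_imp_iii[OF f])
    fix g assume g: "monge \<mu> \<nu> g"
    have "graph_law \<nu> f = graph_law \<nu> g"
      using s ne graph_law_monge[OF prob g] by (auto elim!: is_singletonE)
    then show "AE y in \<nu>. f y = g y"
      using f g by (intro graph_law_inj finite_measure_axioms sets_\<nu>) (simp_all add: monge_def)
  qed
  have iii_i: "is_singleton (martingale_transports \<mu> \<nu>)" if condition_iii
  proof (rule is_singletonI')
    show "martingale_transports \<mu> \<nu> \<noteq> {}" using ne sub by auto
  qed (rule iii_imp_unique[OF that])
  show ?thesis using i_ii ii_iii iii_i by blast
qed

end

theorem theorem2p5: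
  fixes \<mu> \<nu> :: "real measure" and a x :: "nat \<Rightarrow> real"
  assumes "\<mu> \<in> prob_moment_measures" and "\<nu> \<in> prob_moment_measures"
    and "\<mu> \<le>cx \<nu>" and "atomless \<nu>"
    and "\<And>j. 0 \<le> a j" and "inj x"
    and "atomic_part \<mu> = suminf_measure (\<lambda>j. point_mass (a j) (x j))"
  shows
    "(is_singleton (martingale_transports \<mu> \<nu>) \<longleftrightarrow>
        is_singleton (monge_martingale_transports \<mu> \<nu>)) \<and>
     (is_singleton (monge_martingale_transports \<mu> \<nu>) \<longleftrightarrow>
        (\<forall>i j. i \<noteq> j \<longrightarrow>
           mutually_singular (shadow \<nu> (point_mass (a i) (x i))) (shadow \<nu> (point_mass (a j) (x j)))) \<and>
        (\<forall>A \<in> sets borel.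
           measure \<mu> A - measure (suminf_measure (\<lambda>j. point_mass (a j) (x j))) A =
           measure \<nu> A - measure (suminf_measure (\<lambda>j. shadow \<nu> (point_mass (a j) (x j)))) A))"
proof -
  interpret atoms_setting \<nu> \<mu> a x
    by unfold_locales
      (rule assms prob_moment_fm[OF assms(2)]
        le_cx_imp_put_le[OF assms(3) prob_moment_fm[OF assms(1)] prob_moment_fm[OF assms(2)]])+
  show ?thesis using equivalences unfolding condition_iii_def .
qed

end
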